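(* Let $F\in R\setminus k((X))$ be devoid of multiple factors in $R$ (that is, $F\neq 0$ and the ideal $FR$ is its own radical in $R$), let $0\ne G\in R$, and let $T=T(FG)$ be the tree of $FG$. Let $J(F,G)=F_XG_Y-F_YG_X$. Then the following hold. (JF1.1) If $B\in T$ is such that $\Omega_B(G)=1$ and $S(G,B)\ne 0$, then $$\deg_Y\Omega_B(J(F,G))=\deg_Y\Omega_B((FG)_Y)=\deg_Y\Omega_B(F_Y)=D''(B)$$ and $$\deg_Y\Omega'_B(J(F,G))=\deg_Y\Omega'_B((FG)_Y)=\deg_Y\Omega'_B(F_Y)=D'(B)$$ and $$\Omega_B(J(F,G))=\Omega'_B(J(F,G))\prod_{B'\in\pi(T,B)}\Omega'_{B'}(J(F,G)),$$ where for every $B'\in\pi(T,B)$ we have $\Omega_{B'}(G)=1$ and $S(G,B')\ne 0$ and $$\deg_Y\Omega_{B'}(J(F,G))=\deg_Y\Omega_{B'}((FG)_Y)=\deg_Y\Omega_{B'}(F_Y)=D''(B')$$ and $$\deg_Y\Omega'_{B'}(J(F,G))=\deg_Y\Omega'_{B'}((FG)_Y)=\deg_Y\Omega'_{B'}(F_Y)=D'(B').$$ (JF1.2) If $B\in T$ is such that $\Omega_B(G)=1$, then $$\deg_Y\Omega_B((FG)_Y)=\deg_Y\Omega_B(F_Y)=D''(B)\quad\text{and}\quad\deg_Y\Omega'_B((FG)_Y)=\deg_Y\Omega'_B(F_Y)=D'(B)$$ and $$\Omega_B((FG)_Y)=\Omega'_B((FG)_Y)\prod_{B'\in\pi(T,B)}\Omega'_{B'}((FG)_Y),$$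 where for every $B'\in\pi(T,B)$ we have $\Omega_{B'}(G)=1$ and $$\deg_Y\Omega_{B'}((FG)_Y)=\deg_Y\Omega_{B'}(F_Y)=D''(B')\quad\text{and}\quad\deg_Y\Omega'_{B'}((FG)_Y)=\deg_Y\Omega'_{B'}(F_Y)=D'(B').$$
   Context: Setting. $k$ is an algebraically closed field of characteristic zero, $k((X))$ is the field of formal meromorphic (Laurent) series in $X$ over $k$, and $R=k((X))[Y]$. Subscripts $X,Y$ on elements of $R$ denote partial derivatives. For $H\in R$, $\mathrm{ord}_XH$ is the smallest exponent of $X$ occurring in $H$ ($\infty$ if $H=0$). $R^\natural$ is the set of all monic irreducible polynomials in $Y$ over $k((X))$ (so of positive $Y$-degree). Every $H\in R$ is written $H=H_0\prod_{1\le j\le\chi(H)}H_j$ with $H_0\in k((X))$ and $H_j\in R^\natural$ (not necessarily distinct), where $\chi(H)=0$ iff $H\in k((X))$. Empty products equal $1$. Contact. For $f\in R^\natural$ with $\deg_Yf=n$, write $f(X^n,Y)=\prod_{1\le j\le n}(Y-z_j(X))$ with $z_j\in k((X))$ (Newton's Theorem). For $f,f'\in R^\natural$ of $Y$-degrees $n,n'$ with $f(X^n,Y)=\prod_{1\le j\le n}(Y-z_j(X))$ and $f'(X^{n'},Y)=\prod_{1\le j'\le n'}(Y-z'_{j'}(X))$, where $z_j,z'_{j'}\in k((X))$, the normalized contact is $\mathrm{noc}(f,f')=\max_{j,j'}\frac{1}{nn'}\mathrm{ord}_X[z_j(X^{n'})-z'_{j'}(X^n)]$ (so it is rational if $f\ne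 f'$ and $\infty$ if $f=f'$). Characteristic sequence. For $f\in R^\natural$ of $Y$-degree $n$, let $\mathrm{Supp}(z_1)$ be the set of exponents with nonzero coefficient in $z_1$ (it is the same for all $z_j$). Put $m_0=d_1=n$. If $f=Y$ put $h=0$. If $f\ne Y$ put $m_1=\min\mathrm{Supp}(z_1)$, $d_2=\gcd(m_0,m_1)$, and, for $i\ge 2$ as long as $d_i>1$, $m_i=\min(\mathrm{Supp}(z_1)\setminus d_i\mathbb Z)$ and $d_{i+1}=\gcd(m_0,\dots,m_i)$; $h\ge 1$ is the last index, so $d_{h+1}=1$. Put $c_i(f)=m_i/n$ for $1\le i\le h$; $q_1=m_1$, $q_i=m_i-m_{i-1}$ for $2\le i\le h$; $s_i=q_1d_1+\dots+q_id_i$. For $\lambda\in\mathbb Q$ let $p$ (resp. $p^*$) be the number of $i\in\{1,\dots,h\}$ with $c_i(f)<\lambda$ (resp. $c_i(f)\le\lambda$), and put $D(f,\lambda)=n/d_{p+1}$, $D^*(f,\lambda)=n/d_{p^*+1}$, and $S(f,\lambda)=(s_p+(n\lambda-m_p)d_{p+1})/n^2$ if $p\neq 0$, $S(f,\lambda)=\lambda$ if $p=0$. Buds. A bud is a pair $B=(\sigma(B),\lambda(B))$ with $\emptyset\ne\sigma(B)\subset R^\natural$, $\lambda(B)\in\mathbb Q$, and $\mathrm{noc}(f,f')\ge\lambda(B)$ for all $f,f'\in\sigma(B)$. An improper bud is such a pair with $\lambda(B)=-\infty$ and $\sigma(B)$ any nonempty subset of $R^\natural$. A generalized bud is a bud or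 an improper bud. For a generalized bud $B$: $\tau(B)=\{f\in R^\natural:\mathrm{noc}(f,f')\ge\lambda(B)\ \forall f'\in\sigma(B)\}$, $\tau^*(B)=\{f\in\tau(B):\mathrm{noc}(f,f')>\lambda(B)\text{ for some }f'\in\sigma(B)\}$, $\tau'(B)=\tau(B)\setminus\tau^*(B)$ (for improper $B$, $\tau(B)=\tau^*(B)=R^\natural$). A strict bud is a bud with $\mathrm{noc}(f,f')>\lambda(B)$ for all $f,f'\in\sigma(B)$. For a bud $B$, $D(B)$ is the common value of $D(f,\lambda(B))$ for $f\in\tau(B)$; for a strict bud $B$, $D^*(B)$ is the common value of $D^*(f,\lambda(B))$ for $f\in\tau^*(B)$. For a generalized bud $B$, $R^*(B)$ is the set of all strict or improper buds $B'$ with $\lambda(B')=\lambda(B)$ and $\sigma(B')=\tau^*(B')\cap\sigma(B)$ (the stems of these $B'$ partition $\sigma(B)$). Put $D'(B)=-D(B)+\sum_{B'\in R^*(B)}D^*(B')$ if $B$ is a bud, and $D'(B)=-1+\sum_{B'\in R^*(B)}1$ if $B$ is improper (this is then $0$); $D''(B)=-D(B)+\sum_{f\in\sigma(B)}\deg_Yf$ if $B$ is a bud, and $D''(B)=-1+\sum_{f\in\sigma(B)}\deg_Yf$ if $B$ is improper. Strength. For $f\in R^\natural$ and a bud $B$, let $\mathrm{noc}(f,B)=\min\{\mathrm{noc}(f,f'):f'\in\tau(B)\}$ (equal to $\lambda(B)$ if $f\in\tau(B)$, and otherwise to the common value of $\mathrm{noc}(f,f')$, $f'\in\tau(B)$).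 For $H\in R$ put $S(H,B)=\mathrm{ord}_XH_0+\sum_{1\le j\le\chi(H)}(\deg_YH_j)\,S(H_j,\mathrm{noc}(H_j,B))$ if $B$ is a bud, where in the sum $S(f,\lambda)$ is the number defined for $f\in R^\natural$ and $\lambda\in\mathbb Q$ by $S(f,\lambda)=(s_p+(n\lambda-m_p)d_{p+1})/n^2$ if $p\ne0$ and $S(f,\lambda)=\lambda$ if $p=0$; and $S(H,B)=\mathrm{ord}_XH_0+\sum_{1\le j\le\chi(H)}\mathrm{ord}_XH_j$ if $B$ is improper. Slices. For a generalized bud $B$ and $H\in R$: $\Omega_B(H)=\prod_{1\le j\le\chi(H),\,H_j\in\tau(B)}H_j$ and $\Omega'_B(H)=\prod_{1\le j\le\chi(H),\,H_j\in\tau'(B)}H_j$. Tree of $H\in R$. The contact set is $C(H)=\{c_i(H_j): 1\le j\le\chi(H),\ 1\le i\le h\text{ for }H_j,\ c_i(H_j)\notin\mathbb Z\}\cup\{\mathrm{noc}(H_j,H_{j'}):j<j',\ H_j\ne H_{j'}\}$, a finite set of rationals. Let $\widehat\sigma=\{H_1,\dots,H_{\chi(H)}\}$ if $\chi(H)>0$ and $\widehat\sigma=\{Y\}$ if $\chi(H)=0$. The tree $T(H)$ is the finite set of generalized buds consisting of the improper bud with stem $\widehat\sigma$ (the root) and, for each $\lambda\in C(H)$, the buds $(\sigma,\lambda)$ where $\sigma$ runs over the equivalence classes of $\widehat\sigma$ under the relation $\mathrm{noc}(f,f')\ge\lambda$. For $B$ in a tree $T$, $\pi(T,B)=\{B'\in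 T:\lambda(B')>\lambda(B)\text{ and }\tau(B')\subset\tau(B)\}$. *)

theory Defs
  imports
    "HOL-Library.Extended"
    "HOL-Library.Multiset"
    "HOL-Computational_Algebra.Polynomial"
    "HOL-Computational_Algebra.Formal_Laurent_Series"
begin

text \<open>
  The ring \<open>R = k((X))[Y]\<close> is rendered as \<^typ>\<open>'a fls poly\<close>. Contacts and levels live in
  \<^typ>\<open>rat extended\<close>, that is, in the rationals together with \<^const>\<open>Pinf\<close> and \<^const>\<open>Minf\<close>.
\<close>

subsection \<open>Series, derivatives, factorization\<close>

definition DX :: "'a::field_char_0 fls poly \<Rightarrow> 'a fls poly" where
  "DX H = map_poly fls_deriv H"

abbreviation DY :: "'a::field_char_0 fls poly \<Rightarrow> 'a fls poly" where
  "DY H \<equiv> pderiv H"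

definition jac :: "'a::field_char_0 fls poly \<Rightarrow> 'a fls poly \<Rightarrow> 'a fls poly" where
  "jac F G = DX F * DY G - DY F * DX G"

definition ordX_fls :: "'a::zero fls \<Rightarrow> rat extended" where
  "ordX_fls z = (if z = 0 then Pinf else Fin (of_int (fls_subdegree z)))"

definition ordX :: "'a::zero fls poly \<Rightarrow> rat extended" where
  "ordX H = (if H = 0 then Pinf else Fin (of_int (LEAST e. \<exists>i. fls_nth (coeff H i) e \<noteq> 0)))"

definition Rnat :: "'a::field fls poly set" where
  "Rnat = {f. irreducible f \<and> lead_coeff f = 1}"

text \<open>
  The multiset of the \<open>H\<^sub>j\<close> in \<open>H = H\<^sub>0 \<Prod> H\<^sub>j\<close>; the factor \<open>H\<^sub>0\<close> is then the leading coefficient.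
  An \<open>H\<close> in \<open>k((X))\<close>, in particular \<open>H = 0\<close>, has no factors \<open>H\<^sub>j\<close>.
\<close>
definition Rfactors :: "'a::field fls poly \<Rightarrow> 'a fls poly multiset" where
  "Rfactors H = (if H = 0 then {#}
     else (THE M. set_mset M \<subseteq> Rnat \<and> (\<exists>c. H = smult c (prod_mset M))))"

text \<open>\<open>F \<noteq> 0\<close> and the principal ideal \<open>F R\<close> equals its radical.\<close>
definition no_multiple_factors :: "'a::field fls poly \<Rightarrow> bool" where
  "no_multiple_factors F \<longleftrightarrow> F \<noteq> 0 \<and> {A. \<exists>n>0. F dvd A ^ n} = {A. F dvd A}"

subsection \<open>Newton roots and contact\<close>

text \<open>The set of the \<open>z\<^sub>j\<close> with \<open>f(X\<^sup>n, Y) = \<Prod> (Y - z\<^sub>j)\<close>, where \<open>n = deg\<^sub>Y f\<close>.\<close>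
definition newton_roots :: "'a::field fls poly \<Rightarrow> 'a fls set" where
  "newton_roots f = {z. poly (map_poly (\<lambda>c. fls_compose_power c (degree f)) f) z = 0}"

definition noc :: "'a::field fls poly \<Rightarrow> 'a fls poly \<Rightarrow> rat extended" where
  "noc f g = Max {map_extended (\<lambda>r. r / of_nat (degree f * degree g))
                    (ordX_fls (fls_compose_power z (degree g) - fls_compose_power w (degree f)))
                  | z w. z \<in> newton_roots f \<and> w \<in> newton_roots g}"

subsection \<open>Characteristic sequence\<close>

text \<open>The support does not depend on the choice of the root.\<close>
definition supp :: "'a::field fls poly \<Rightarrow> int set" where
  "supp f = {e. fls_nth (SOME z. z \<in> newton_roots f) e \<noteq> 0}"

text \<open>
  The pair \<open>(m\<^sub>i, d\<^sub>i\<^sub>+\<^sub>1)\<close>. It is meaningful only for \<open>i \<le> h\<close>: beyond that the least element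
  is taken over an empty set.
\<close>
primrec char_pair :: "'a::field fls poly \<Rightarrow> nat \<Rightarrow> int \<times> int" where
  "char_pair f 0 = (int (degree f), int (degree f))"
| "char_pair f (Suc i) =
     (let d = snd (char_pair f i);
          m = (if i = 0 then LEAST e. e \<in> supp f
               else LEAST e. e \<in> supp f \<and> \<not> d dvd e)
      in (m, gcd d m))"

definition char_m :: "'a::field fls poly \<Rightarrow> nat \<Rightarrow> int" where
  "char_m f i = fst (char_pair f i)"

text \<open>Indexed from 1, as \<open>d\<^sub>1, \<dots>, d\<^sub>h\<^sub>+\<^sub>1\<close>.\<close>
definition char_d :: "'a::field fls poly \<Rightarrow> nat \<Rightarrow> int" where
  "char_d f i = snd (char_pair f (i - 1))"

definition char_h :: "'a::field fls poly \<Rightarrow> nat" where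
  "char_h f = (if f = [:0, 1:] then 0 else LEAST i. 1 \<le> i \<and> char_d f (i + 1) = 1)"

definition char_c :: "'a::field fls poly \<Rightarrow> nat \<Rightarrow> rat" where
  "char_c f i = of_int (char_m f i) / of_nat (degree f)"

definition char_q :: "'a::field fls poly \<Rightarrow> nat \<Rightarrow> int" where
  "char_q f i = (if i = 1 then char_m f 1 else char_m f i - char_m f (i - 1))"

definition char_s :: "'a::field fls poly \<Rightarrow> nat \<Rightarrow> int" where
  "char_s f i = (\<Sum>j = 1..i. char_q f j * char_d f j)"

definition char_p :: "'a::field fls poly \<Rightarrow> rat \<Rightarrow> nat" where
  "char_p f l = card {i \<in> {1..char_h f}. char_c f i < l}"

definition char_p_star :: "'a::field fls poly \<Rightarrow> rat \<Rightarrow> nat" where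
  "char_p_star f l = card {i \<in> {1..char_h f}. char_c f i \<le> l}"

definition Dval :: "'a::field fls poly \<Rightarrow> rat \<Rightarrow> rat" where
  "Dval f l = of_nat (degree f) / of_int (char_d f (char_p f l + 1))"

definition Dval_star :: "'a::field fls poly \<Rightarrow> rat \<Rightarrow> rat" where
  "Dval_star f l = of_nat (degree f) / of_int (char_d f (char_p_star f l + 1))"

definition Sval :: "'a::field fls poly \<Rightarrow> rat \<Rightarrow> rat" where
  "Sval f l = (let n = of_nat (degree f); p = char_p f l in
     if p = 0 then l
     else (of_int (char_s f p) + (n * l - of_int (char_m f p)) * of_int (char_d f (p + 1))) / n\<^sup>2)"

subsection \<open>Buds\<close>

text \<open>A generalized bud is a pair of its stem and its level; the level is \<^const>\<open>Minf\<close> iff it is improper.\<close>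
type_synonym 'a gbud = "'a fls poly set \<times> rat extended"

abbreviation stem :: "'a::zero gbud \<Rightarrow> 'a fls poly set" where
  "stem B \<equiv> fst B"

abbreviation level :: "'a::zero gbud \<Rightarrow> rat extended" where
  "level B \<equiv> snd B"

text \<open>Only used on finite values, where it is the underlying rational number.\<close>
definition finval :: "rat extended \<Rightarrow> rat" where
  "finval x = (case x of Fin r \<Rightarrow> r | _ \<Rightarrow> undefined)"

definition bud :: "'a::field gbud \<Rightarrow> bool" where
  "bud B \<longleftrightarrow> stem B \<noteq> {} \<and> stem B \<subseteq> Rnat \<and> (\<exists>r. level B = Fin r)
     \<and> (\<forall>f\<in>stem B. \<forall>g\<in>stem B. noc f g \<ge> level B)"

definition improper_bud :: "'a::field gbud \<Rightarrow> bool" where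
  "improper_bud B \<longleftrightarrow> stem B \<noteq> {} \<and> stem B \<subseteq> Rnat \<and> level B = Minf"

definition strict_bud :: "'a::field gbud \<Rightarrow> bool" where
  "strict_bud B \<longleftrightarrow> bud B \<and> (\<forall>f\<in>stem B. \<forall>g\<in>stem B. noc f g > level B)"

definition tau :: "'a::field gbud \<Rightarrow> 'a fls poly set" where
  "tau B = {f \<in> Rnat. \<forall>g\<in>stem B. noc f g \<ge> level B}"

definition tau_star :: "'a::field gbud \<Rightarrow> 'a fls poly set" where
  "tau_star B = {f \<in> tau B. \<exists>g\<in>stem B. noc f g > level B}"

definition tau_prime :: "'a::field gbud \<Rightarrow> 'a fls poly set" where
  "tau_prime B = tau B - tau_star B"

definition D_bud :: "'a::field gbud \<Rightarrow> rat" where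
  "D_bud B = (THE d. \<forall>f\<in>tau B. Dval f (finval (level B)) = d)"

definition D_star_bud :: "'a::field gbud \<Rightarrow> rat" where
  "D_star_bud B = (THE d. \<forall>f\<in>tau_star B. Dval_star f (finval (level B)) = d)"

definition R_star :: "'a::field gbud \<Rightarrow> 'a gbud set" where
  "R_star B = {B'. (strict_bud B' \<or> improper_bud B') \<and> level B' = level B
                   \<and> stem B' = tau_star B' \<inter> stem B}"

definition D_prime :: "'a::field gbud \<Rightarrow> rat" where
  "D_prime B = (if level B = Minf then - 1 + (\<Sum>B'\<in>R_star B. 1)
                else - D_bud B + (\<Sum>B'\<in>R_star B. D_star_bud B'))"

definition D_pprime :: "'a::field gbud \<Rightarrow> rat" where
  "D_pprime B = (if level B = Minf then - 1 + (\<Sum>f\<in>stem B. of_nat (degree f))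
                 else - D_bud B + (\<Sum>f\<in>stem B. of_nat (degree f)))"

subsection \<open>Strength and slices\<close>

text \<open>The minimum is taken over an infinite set, whence the use of \<^const>\<open>Least\<close>.\<close>
definition noc_bud :: "'a::field fls poly \<Rightarrow> 'a gbud \<Rightarrow> rat extended" where
  "noc_bud f B = (LEAST x. x \<in> noc f ` tau B)"

definition strength :: "'a::field fls poly \<Rightarrow> 'a gbud \<Rightarrow> rat extended" where
  "strength H B =
     (if level B = Minf then ordX_fls (lead_coeff H) + (\<Sum>f\<in>#Rfactors H. ordX f)
      else ordX_fls (lead_coeff H)
           + (\<Sum>f\<in>#Rfactors H. Fin (of_nat (degree f) * Sval f (finval (noc_bud f B)))))"

definition Omega :: "'a::field gbud \<Rightarrow> 'a fls poly \<Rightarrow> 'a fls poly" where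
  "Omega B H = prod_mset {# f \<in># Rfactors H. f \<in> tau B #}"

definition Omega_prime :: "'a::field gbud \<Rightarrow> 'a fls poly \<Rightarrow> 'a fls poly" where
  "Omega_prime B H = prod_mset {# f \<in># Rfactors H. f \<in> tau_prime B #}"

subsection \<open>Trees\<close>

definition contact_set :: "'a::field fls poly \<Rightarrow> rat set" where
  "contact_set H =
     {char_c f i | f i. f \<in># Rfactors H \<and> 1 \<le> i \<and> i \<le> char_h f \<and> char_c f i \<notin> \<int>}
     \<union> {l. \<exists>f g. f \<in># Rfactors H \<and> g \<in># Rfactors H \<and> f \<noteq> g \<and> noc f g = Fin l}"

definition root_stem :: "'a::field fls poly \<Rightarrow> 'a fls poly set" where
  "root_stem H = (if Rfactors H = {#} then {[:0, 1:]} else set_mset (Rfactors H))"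

definition tree :: "'a::field fls poly \<Rightarrow> 'a gbud set" where
  "tree H = insert (root_stem H, Minf)
     {(\<sigma>, Fin l) | \<sigma> l. l \<in> contact_set H \<and>
        \<sigma> \<in> root_stem H // {(f, g). f \<in> root_stem H \<and> g \<in> root_stem H \<and> noc f g \<ge> Fin l}}"

definition tree_pi :: "'a::field gbud set \<Rightarrow> 'a gbud \<Rightarrow> 'a gbud set" where
  "tree_pi T B = {B' \<in> T. level B' > level B \<and> tau B' \<subseteq> tau B}"

end

theory Submission
  imports Defs "HOL-Computational_Algebra.Computational_Algebra"
begin

text \<open>
  Let \<open>X = t\<^sup>N\<close>, with \<open>N\<close> divisible by the degrees of all irreducible factors in sight. By the
  Newton-Puiseux theorem everything splits over \<open>k((t))\<close>, and the roots of a monic irreducible \<open>f\<close>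
  are distinct and form one orbit under the rotations \<open>t \<mapsto> \<zeta>t\<close>, \<open>\<zeta>\<^sup>N = 1\<close> (\<open>newton_theorem\<close>,
  \<open>rts_transitive\<close>). Contact becomes distance: \<open>noc f g \<ge> \<lambda>\<close> if and only if a given root of \<open>f\<close>
  agrees with some root of \<open>g\<close> below \<open>t\<^sup>l\<close>, \<open>l = \<lambda>N\<close> (\<open>noc_ge_iff\<close>). So a bud \<open>B\<close> of level \<open>\<lambda>\<close> is
  an orbit of balls \<open>z + t\<^sup>l k[[t]]\<close>; the set \<open>tau B\<close> consists of the \<open>f\<close> with a root in such a ball, and
  \<open>tau_star B\<close> of those with a root in an open sub-ball that also contains a root of a stem element.
  The open sub-balls correspond to residues in \<open>k\<close>. The characteristic sequence counts conjugates:
  \<open>D_bud B\<close> is the number of balls in the orbit (\<open>Dval_ball_orbit\<close>). As rotations distribute roots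
  evenly, each degree in the theorem is \<open>D_bud B\<close> times a number of roots in a single ball.
  If \<open>F\<close> has \<open>m\<close> roots in the ball, with \<open>r\<close> distinct residues, then \<open>D_pprime B\<close> and \<open>D_prime B\<close>
  are \<open>D_bud B\<close> times \<open>m - 1\<close> and \<open>r - 1\<close> (\<open>R_star_sum\<close>, \<open>adapted_degrees\<close>).

  To count roots in a ball, substitute \<open>Y = z + t\<^sup>l Y'\<close>. Up to a power of \<open>t\<close> and modulo \<open>t\<close>, the
  polynomial \<open>F\<close> becomes a constant times the product \<open>q\<close> of the \<open>Y' - u\<close> over the residues \<open>u\<close> of
  its \<open>m\<close> roots, while \<open>G\<close>, which has no root in the ball, becomes a constant times \<open>t\<^sup>b\<close> with
  \<open>b = N S(G, B)\<close> (\<open>strength_bud\<close>). Hence \<open>F\<^sub>Y\<close> and \<open>(FG)\<^sub>Y\<close> reduce to multiples of \<open>q'\<close>. The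
  Jacobian reduces to a multiple of \<open>b q'\<close>: the derivation \<open>t d/dt\<close> multiplies \<open>t\<^sup>b\<close> by \<open>b\<close>, and the
  term with \<open>G\<^sub>Y\<close> disappears because the reduction of \<open>G\<close> is constant (\<open>lform_jac\<close>). This is why the
  strength has to be nonzero. The reduction counts the roots in the ball, so all three polynomials
  have \<open>m - 1\<close> of them. In characteristic zero a root of \<open>q\<close> of multiplicity \<open>e\<close> is a root of \<open>q'\<close>
  of multiplicity \<open>e - 1\<close>, which leaves \<open>r - 1\<close> roots with residues different from those of \<open>F\<close>
  (\<open>ball_residues_pderiv\<close>).

  For the product formula, let \<open>H\<close> be one of the three polynomials and \<open>f\<close> an irreducible factor of
  \<open>H\<close> in \<open>tau B\<close>. Applied to a ball that isolates one root of \<open>F\<close>, the count shows that \<open>f\<close> does not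
  divide \<open>F\<close> (\<open>derived_no_common_factor\<close>). Unless \<open>f\<close> is in \<open>tau_prime B\<close>, let \<open>\<mu>\<close> be its largest
  contact with a stem element. It belongs to \<open>tau_prime B'\<close> for a bud \<open>B'\<close> of level \<open>\<mu>\<close>, for which
  therefore \<open>r \<ge> 2\<close>, so \<open>F\<close> has two roots at distance exactly \<open>\<mu>\<close>. They show that \<open>\<mu>\<close> is a contact of
  two factors of \<open>F\<close> or a nonintegral characteristic exponent of one of them (\<open>contact_setI\<close>). Either
  way \<open>B'\<close> is in the tree (\<open>tau_prime_exists\<close>). By the ultrametric inequality there is only one such
  member of the tree (\<open>tau_prime_unique\<close>).
\<close>

unbundle fps_syntax

section \<open>Ramification, rotation and closeness of series\<close>

lemma map_poly_add_hom:
  assumes "f 0 = 0" "\<And>a b. f (a + b) = f a + f b"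
  shows "map_poly f (p + q) = map_poly f p + map_poly f q"
  by (rule poly_eqI) (simp add: coeff_map_poly assms)

lemma map_poly_mult_hom:
  fixes f :: "'a::comm_semiring_0 \<Rightarrow> 'b::comm_semiring_0"
  assumes "f 0 = 0" "\<And>a b. f (a + b) = f a + f b" "\<And>a b. f (a * b) = f a * f b"
  shows "map_poly f (p * q) = map_poly f p * map_poly f q"
proof (rule poly_eqI)
  fix i
  have s: "f (sum g A) = (\<Sum>x\<in>A. f (g x))" if "finite A" for g and A :: "nat set"
    using that by induction (simp_all add: assms)
  show "coeff (map_poly f (p * q)) i = coeff (map_poly f p * map_poly f q) i"
    by (simp add: coeff_map_poly coeff_mult assms s)
qed

lemma poly_map_poly_hom:
  fixes f :: "'a::comm_semiring_0 \<Rightarrow> 'b::comm_semiring_0"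
  assumes "f 0 = 0" "\<And>a b. f (a + b) = f a + f b" "\<And>a b. f (a * b) = f a * f b"
  shows "poly (map_poly f p) (f z) = f (poly p z)"
  by (induction p) (simp_all add: assms map_poly_pCons)

lemma fls_compose_power_compose:
  assumes "a > 0" "b > 0"
  shows "fls_compose_power (fls_compose_power f a) b = fls_compose_power f (a * b)"
proof (rule fls_eqI)
  fix n
  have "int b dvd n \<and> int a dvd n div int b \<longleftrightarrow> int a * int b dvd n"
    using assms by (auto simp: dvd_def)
  then show "fls_compose_power (fls_compose_power f a) b $$ n = fls_compose_power f (a * b) $$ n"
    using assms by (auto simp: fls_nth_compose_power zdiv_zmult2_eq mult.commute)
qed

lemma fls_compose_power_one [simp]: "fls_compose_power f (Suc 0) = f"
  by (rule fls_eqI) (simp add: fls_nth_compose_power)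

lemma fls_compose_power_nth_mult:
  "d > 0 \<Longrightarrow> fls_compose_power f d $$ (int d * n) = f $$ n"
  by (simp add: fls_nth_compose_power)

lemma fls_compose_power_inj: "d > 0 \<Longrightarrow> fls_compose_power f d = fls_compose_power g d \<longleftrightarrow> f = g"
  by (metis fls_compose_power_nth_mult fls_eqI)

lemma fls_compose_power_eq_0 [simp]: "d > 0 \<Longrightarrow> fls_compose_power f d = 0 \<longleftrightarrow> f = 0"
  using fls_compose_power_inj[of d f 0] by simp

text \<open>
  \<open>P(X\<^sup>N, Y)\<close>, that is, \<open>P\<close> over the series in
  \<open>X\<^bsup>1/N\<^esup>\<close>, whose variable is again written \<open>X\<close>.
\<close>
definition ramify :: "nat \<Rightarrow> 'a::field fls poly \<Rightarrow> 'a fls poly" where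
  "ramify N P = map_poly (\<lambda>c. fls_compose_power c N) P"

lemma coeff_ramify: "coeff (ramify N P) i = fls_compose_power (coeff P i) N"
  by (simp add: ramify_def coeff_map_poly)

lemma ramify_0 [simp]: "ramify N 0 = 0"
  by (simp add: ramify_def)

lemma ramify_1 [simp]: "N > 0 \<Longrightarrow> ramify N 1 = 1"
  by (simp add: ramify_def)

lemma ramify_mult: "ramify N (P * Q) = ramify N P * ramify N Q"
  unfolding ramify_def by (rule map_poly_mult_hom) simp_all

lemma ramify_add: "ramify N (P + Q) = ramify N P + ramify N Q"
  unfolding ramify_def by (rule map_poly_add_hom) simp_all

lemma ramify_diff: "ramify N (P - Q) = ramify N P - ramify N Q"
  by (rule poly_eqI) (simp add: coeff_ramify)

lemma ramify_smult: "ramify N (smult c P) = smult (fls_compose_power c N) (ramify N P)"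
  by (rule poly_eqI) (simp add: coeff_ramify)

lemma ramify_pCons: "ramify N (pCons c P) = pCons (fls_compose_power c N) (ramify N P)"
  by (simp add: ramify_def map_poly_pCons)

lemma ramify_eq_iff: "N > 0 \<Longrightarrow> ramify N P = ramify N Q \<longleftrightarrow> P = Q"
  by (simp add: poly_eq_iff coeff_ramify fls_compose_power_inj)

lemma ramify_eq_0_iff [simp]: "N > 0 \<Longrightarrow> ramify N P = 0 \<longleftrightarrow> P = 0"
  using ramify_eq_iff[of N P 0] by simp

lemma degree_ramify [simp]: "N > 0 \<Longrightarrow> degree (ramify N P) = degree P"
  unfolding ramify_def by (rule degree_map_poly) simp

lemma lead_coeff_ramify: "N > 0 \<Longrightarrow> lead_coeff (ramify N P) = fls_compose_power (lead_coeff P) N"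
  by (simp add: coeff_ramify)

lemma ramify_ramify: "a > 0 \<Longrightarrow> b > 0 \<Longrightarrow> ramify b (ramify a P) = ramify (a * b) P"
  by (rule poly_eqI) (simp add: coeff_ramify fls_compose_power_compose)

lemma ramify_one [simp]: "ramify (Suc 0) P = P"
  by (rule poly_eqI) (simp add: coeff_ramify)

lemma ramify_prod_mset: "N > 0 \<Longrightarrow> ramify N (prod_mset M) = (\<Prod>f\<in>#M. ramify N f)"
  by (induction M) (simp_all add: ramify_mult)

lemma poly_ramify: "poly (ramify N P) (fls_compose_power z N) = fls_compose_power (poly P z) N"
  unfolding ramify_def by (rule poly_map_poly_hom) simp_all

lemma fls_compose_power_of_nat [simp]:
  assumes "N > 0"
  shows "fls_compose_power (of_nat n :: 'a::field fls) N = of_nat n"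
  using assms by (simp add: fls_of_nat)

lemma ramify_pderiv: "N > 0 \<Longrightarrow> ramify N (pderiv P) = pderiv (ramify N (P :: 'a::field_char_0 fls poly))"
  by (rule poly_eqI) (simp add: coeff_ramify coeff_pderiv del: of_nat_Suc)

text \<open>
  The automorphism \<open>X \<mapsto> \<zeta>X\<close>. For \<open>\<zeta>\<^sup>N = 1\<close>
  these are the Galois automorphisms of the series in \<open>X\<close> over those in
  \<open>X\<^sup>N\<close>.
\<close>
definition rot :: "'a::field \<Rightarrow> 'a fls \<Rightarrow> 'a fls" where
  "rot \<zeta> z = fls_compose_fps z (fps_const \<zeta> * fps_X)"

context
  fixes \<zeta> :: "'a::field"
  assumes nz: "\<zeta> \<noteq> 0"
begin

lemma rot_nth: "rot \<zeta> z $$ n = z $$ n * \<zeta> powi n"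
  unfolding rot_def by (rule fls_nth_fls_compose_fps_linear[OF nz])

lemma rot_0 [simp]: "rot \<zeta> 0 = 0"
  by (simp add: rot_def)

lemma rot_add: "rot \<zeta> (z + w) = rot \<zeta> z + rot \<zeta> w"
  by (rule fls_eqI) (simp add: rot_nth algebra_simps)

lemma rot_diff: "rot \<zeta> (z - w) = rot \<zeta> z - rot \<zeta> w"
  by (rule fls_eqI) (simp add: rot_nth algebra_simps)

lemma rot_mult: "rot \<zeta> (z * w) = rot \<zeta> z * rot \<zeta> w"
  unfolding rot_def using nz by (intro fls_compose_fps_mult) auto

lemma rot_eq_0 [simp]: "rot \<zeta> z = 0 \<longleftrightarrow> z = 0"
  using nz by (auto simp: fls_eq_iff rot_nth)

lemma rot_eq_iff: "rot \<zeta> z = rot \<zeta> w \<longleftrightarrow> z = w"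
  using rot_eq_0[of "z - w"] by (simp add: rot_diff del: rot_eq_0)

lemma rot_fls_compose_power:
  assumes "N > 0"
  shows "rot \<zeta> (fls_compose_power z N) = fls_compose_power (rot (\<zeta> ^ N) z) N"
proof (rule fls_eqI)
  fix n
  have "\<zeta> powi n = (\<zeta> ^ N) powi (n div int N)" if "int N dvd n"
    using that assms by (auto simp: power_int_mult elim!: dvdE)
  moreover have "rot (\<zeta> ^ N) z $$ m = z $$ m * (\<zeta> ^ N) powi m" for m
    unfolding rot_def by (rule fls_nth_fls_compose_fps_linear) (use nz in simp)
  ultimately show "rot \<zeta> (fls_compose_power z N) $$ n = fls_compose_power (rot (\<zeta> ^ N) z) N $$ n"
    using assms by (simp add: rot_nth fls_nth_compose_power)
qed

lemma map_poly_rot_mult: "map_poly (rot \<zeta>) (P * Q) = map_poly (rot \<zeta>) P * map_poly (rot \<zeta>) Q"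
  by (rule map_poly_mult_hom) (simp_all add: rot_add rot_mult)

lemma poly_map_rot: "poly (map_poly (rot \<zeta>) P) (rot \<zeta> z) = rot \<zeta> (poly P z)"
  by (rule poly_map_poly_hom) (simp_all add: rot_add rot_mult)

end

lemma rot_1 [simp]: "rot 1 z = z"
  by (rule fls_eqI) (simp add: rot_nth)

lemma rot_rot: "a \<noteq> 0 \<Longrightarrow> b \<noteq> 0 \<Longrightarrow> rot a (rot b z) = rot (a * b) z"
  by (rule fls_eqI) (simp add: rot_nth power_int_mult_distrib mult_ac)

lemma root_of_unity_nonzero: "N > 0 \<Longrightarrow> \<zeta> ^ N = 1 \<Longrightarrow> (\<zeta>::'a::field) \<noteq> 0"
  by (auto simp: power_0_left)

lemma map_poly_rot_ramify:
  assumes "N > 0" "\<zeta> ^ N = 1"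
  shows "map_poly (rot \<zeta>) (ramify N P) = ramify N P"
proof (rule poly_eqI)
  have nz: "\<zeta> \<noteq> 0" using assms by (rule root_of_unity_nonzero)
  fix i
  show "coeff (map_poly (rot \<zeta>) (ramify N P)) i = coeff (ramify N P) i"
    by (subst coeff_map_poly)
      (simp_all add: nz coeff_ramify rot_fls_compose_power assms)
qed

text \<open>
  The relation \<open>ord (z - w) \<ge> l\<close>, expressed by coefficients so that \<open>z =
  w\<close> is no special case.
\<close>
definition near :: "int \<Rightarrow> 'a::zero fls \<Rightarrow> 'a fls \<Rightarrow> bool" where
  "near l z w \<longleftrightarrow> (\<forall>e<l. z $$ e = w $$ e)"

lemma near_refl [simp]: "near l z z"
  by (simp add: near_def)

lemma near_sym: "near l z w \<longleftrightarrow> near l w z"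
  by (auto simp: near_def)

lemma near_trans: "near l z w \<Longrightarrow> near l w x \<Longrightarrow> near l z x"
  by (auto simp: near_def)

lemma near_mono: "near l z w \<Longrightarrow> l' \<le> l \<Longrightarrow> near l' z w"
  by (auto simp: near_def)

lemma near_Suc: "near (l + 1) z w \<longleftrightarrow> near l z w \<and> z $$ l = w $$ l"
  by (auto simp: near_def order_le_less)

lemma near_rot: "\<zeta> \<noteq> 0 \<Longrightarrow> near l (rot \<zeta> z) (rot \<zeta> w) \<longleftrightarrow> near l z w"
  by (auto simp: near_def rot_nth)

lemma near_iff_subdegree:
  "near l (z::'a::ab_group_add fls) w \<longleftrightarrow> z = w \<or> fls_subdegree (z - w) \<ge> l"
proof -
  have "near l z w \<longleftrightarrow> (\<forall>e<l. (z - w) $$ e = 0)" by (simp add: near_def)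
  also have "\<dots> \<longleftrightarrow> z - w = 0 \<or> fls_subdegree (z - w) \<ge> l"
    by (metis fls_eq0_below_subdegree fls_subdegree_geI fls_zero_nth order_less_le_trans)
  finally show ?thesis by simp
qed

lemma not_near_subdegree: "\<not> near l z w \<Longrightarrow> z \<noteq> (w::'a::ab_group_add fls) \<and> fls_subdegree (z - w) < l"
  by (auto simp: near_iff_subdegree)

section \<open>Leading forms\<close>

text \<open>
  \<open>P = X\<^sup>s (q + \<dots>)\<close> with an error divisible by \<open>X\<close>. The case
  \<open>q = 0\<close> is included, so that the relation is closed under differences and
  derivatives; only a nonzero \<open>q\<close> determines \<open>s\<close>.
\<close>
definition lform :: "int \<Rightarrow> 'a::field fls poly \<Rightarrow> 'a poly \<Rightarrow> bool" where
  "lform s P q \<longleftrightarrow> (\<forall>i. (\<forall>e<s. coeff P i $$ e = 0) \<and> coeff P i $$ s = coeff q i)"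

lemma fls_times_low:
  fixes f g :: "'a::field fls"
  assumes "\<forall>e<s. f $$ e = 0" "\<forall>e<t. g $$ e = 0"
  shows "e < s + t \<Longrightarrow> (f * g) $$ e = 0" "(f * g) $$ (s + t) = f $$ s * g $$ t"
proof -
  have "(\<forall>e<s+t. (f * g) $$ e = 0) \<and> (f * g) $$ (s + t) = f $$ s * g $$ t"
  proof (cases "f = 0 \<or> g = 0")
    case False
    then have s: "fls_subdegree f \<ge> s" "fls_subdegree g \<ge> t"
      using assms by (auto intro: fls_subdegree_geI)
    show ?thesis
    proof (cases "fls_subdegree f = s \<and> fls_subdegree g = t")
      case True
      then show ?thesis using fls_times_base[of f g] by (auto simp: fls_times_nth_eq0)
    next
      case F: False
      have z: "f $$ s = 0 \<or> g $$ t = 0"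
        using F s fls_eq0_below_subdegree[of s f] fls_eq0_below_subdegree[of t g] by linarith
      then show ?thesis using F s by (auto intro!: fls_times_nth_eq0)
    qed
  qed auto
  then show "e < s + t \<Longrightarrow> (f * g) $$ e = 0" "(f * g) $$ (s + t) = f $$ s * g $$ t" by auto
qed

lemma lform_mult:
  assumes "lform s P p" "lform t Q q"
  shows "lform (s + t) (P * Q) (p * q)"
  unfolding lform_def
proof (intro allI conjI impI)
  fix i e
  show "coeff (P * Q) i $$ e = 0" if "e < s + t"
    unfolding coeff_mult fls_nth_sum
    using assms that by (intro sum.neutral ballI fls_times_low(1)) (auto simp: lform_def)
next
  fix i
  show "coeff (P * Q) i $$ (s + t) = coeff (p * q) i"
    unfolding coeff_mult fls_nth_sum
    using assms by (intro sum.cong refl) (auto simp: lform_def fls_times_low(2))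
qed

lemma lform_diff: "lform s P p \<Longrightarrow> lform s Q q \<Longrightarrow> lform s (P - Q) (p - q)"
  by (simp add: lform_def)

lemma lform_const: "(\<And>e. e < s \<Longrightarrow> c $$ e = 0) \<Longrightarrow> lform s [:c:] [:c $$ s:]"
  by (auto simp: lform_def coeff_pCons split: nat.splits)

lemma lform_linear:
  "(\<And>e. e < s \<Longrightarrow> c $$ e = 0) \<Longrightarrow> (\<And>e. e < s \<Longrightarrow> d $$ e = 0) \<Longrightarrow>
    lform s [:c, d:] [:c $$ s, d $$ s:]"
  by (auto simp: lform_def coeff_pCons split: nat.splits)

lemma lform_pderiv: "lform s P p \<Longrightarrow> lform s (pderiv P) (pderiv p)"
  by (simp add: lform_def coeff_pderiv fls_of_nat del: of_nat_Suc)

lemma lform_smult: "lform s P p \<Longrightarrow> lform s (smult (fls_const c) P) (smult c p)"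
  by (simp add: lform_def)

text \<open>
  The derivation \<open>X d/dX\<close> multiplies \<open>X\<^sup>s\<close> by \<open>s\<close>.
  This is where the strength enters the Jacobian.
\<close>
lemma lform_X_DX:
  fixes P :: "'a::field_char_0 fls poly"
  shows "lform s P p \<Longrightarrow> lform s (smult fls_X (DX P)) (smult (of_int s) p)"
  by (auto simp: lform_def DX_def coeff_map_poly fls_X_times_conv_shift)

lemma lform_unique:
  assumes "lform s P p" "lform t P q" "p \<noteq> 0" "q \<noteq> 0"
  shows "s = t" "p = q"
proof -
  have "\<not> s' < t'" if "lform s' P p'" "lform t' P q'" "p' \<noteq> 0" for s' t' p' q'
    using that by (auto simp: lform_def poly_eq_iff)
  then show "s = t" using assms by (meson linorder_neqE)
  then show "p = q" using assms by (simp add: lform_def poly_eq_iff)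
qed

lemma lform_nonzero: "lform s P p \<Longrightarrow> p \<noteq> 0 \<Longrightarrow> P \<noteq> 0"
  by (fastforce simp: lform_def poly_eq_iff)

section \<open>Hensel's lemma and the Newton-Puiseux theorem\<close>

lemma coeff_mult_vanish:
  fixes p q :: "'a::comm_ring_1 poly"
  assumes "\<forall>i\<ge>m. coeff p i = 0" "\<forall>i\<ge>d. coeff q i = 0" "m + d \<le> Suc i"
  shows "coeff (p * q) i = 0"
  unfolding coeff_mult
proof (rule sum.neutral, rule ballI)
  fix j assume "j \<in> {..i}"
  then have "j \<ge> m \<or> i - j \<ge> d" using assms(3) by auto
  then show "coeff p j * coeff q (i - j) = 0" using assms by auto
qed

lemma degree_le_1_eq: "degree p \<le> 1 \<Longrightarrow> p = [:coeff p 0, coeff p 1:]"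
  by (rule poly_eqI) (auto simp: coeff_pCons coeff_eq_0 split: nat.splits)

lemma fps_to_fls_sum: "fps_to_fls (sum f A) = (\<Sum>x\<in>A. fps_to_fls (f x))"
  by (induction A rule: infinite_finite_induct) auto

text \<open>
  The Bezout identity behind Hensel's lemma. Since one of the two coprime factors is a power of a
  linear polynomial, the factors \<open>Y - u\<close> can be split off one at a time.
\<close>
lemma linear_power_crt:
  fixes h E :: "'a::field poly"
  assumes "poly h u \<noteq> 0"
  shows "\<exists>G H. E = h * G + [:-u, 1:] ^ m * H \<and> (\<forall>i\<ge>m. coeff G i = 0)"
proof (induction m arbitrary: E)
  case 0
  show ?case by (intro exI[of _ 0] exI[of _ E]) simp
next
  case (Suc m)
  define c where "c = poly E u / poly h u"
  have "poly (E - smult c h) u = 0" using assms by (simp add: c_def)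
  then obtain E' where E': "E - smult c h = [:-u, 1:] * E'"
    by (metis poly_eq_0_iff_dvd dvdE)
  obtain G H where GH: "E' = h * G + [:-u, 1:] ^ m * H" "\<forall>i\<ge>m. coeff G i = 0"
    using Suc.IH by blast
  have "E = h * ([:c:] + [:-u, 1:] * G) + [:-u, 1:] ^ Suc m * H"
  proof -
    have "E = smult c h + [:-u, 1:] * E'" using E' by (simp add: algebra_simps)
    then show ?thesis unfolding GH(1) by (simp add: algebra_simps)
  qed
  moreover have "\<forall>i\<ge>Suc m. coeff ([:c:] + [:-u, 1:] * G) i = 0"
    using GH(2) by (auto simp: coeff_pCons split: nat.splits)
  ultimately show ?case by blast
qed

lemma linear_power_crt_degree:
  fixes h E :: "'a::field poly"
  assumes "poly h u \<noteq> 0" "\<forall>i\<ge>m + degree h. coeff E i = 0"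
  shows "\<exists>G H. E = h * G + [:-u, 1:] ^ m * H \<and> (\<forall>i\<ge>m. coeff G i = 0) \<and> (\<forall>i\<ge>degree h. coeff H i = 0)"
proof -
  obtain G H where GH: "E = h * G + [:-u, 1:] ^ m * H" "\<forall>i\<ge>m. coeff G i = 0"
    using linear_power_crt[OF assms(1)] by blast
  have "\<forall>i\<ge>degree h. coeff H i = 0"
  proof (cases "H = 0")
    case False
    have z: "coeff ([:-u, 1:] ^ m * H) i = 0" if "i \<ge> m + degree h" for i
    proof -
      have "coeff (h * G) i = 0"
        by (rule coeff_mult_vanish[of "Suc (degree h)" _ m]) (use that GH in \<open>auto simp: coeff_eq_0\<close>)
      moreover have "coeff ([:-u, 1:] ^ m * H) i = coeff E i - coeff (h * G) i"
        using GH(1) by simp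
      ultimately show ?thesis using assms(2) that by simp
    qed
    have deg: "degree ([:-u, 1:] ^ m * H) = m + degree H"
      using False by (subst degree_mult_eq) (auto simp: degree_power_eq)
    have "[:-u, 1:] ^ m * H \<noteq> 0" using False by simp
    then have "\<not> degree ([:-u, 1:] ^ m * H) \<ge> m + degree h"
      using z[of "degree ([:-u, 1:] ^ m * H)"] by (metis leading_coeff_neq_0)
    then show ?thesis unfolding deg by (auto intro: coeff_eq_0)
  qed simp
  then show ?thesis using GH by blast
qed

text \<open>
  The factors are determined one power of \<open>X\<close> at a time: the equation for the
  coefficient of \<open>X\<^sup>e\<close> is linear in the coefficients of
  \<open>X\<^sup>e\<close> in the two factors and is solved by
  \<open>linear_power_crt_degree\<close>. Over an algebraically closed field a coprime
  factorization with one factor \<open>(Y - u)\<^sup>m\<close> is always at hand.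
\<close>
lemma hensel_linear_power:
  fixes Q :: "'a::field fls poly"
  assumes Q: "lead_coeff Q = 1" "lform 0 Q q"
    and q: "q = [:-u, 1:] ^ m * h" "lead_coeff h = 1" "poly h u \<noteq> 0" "degree Q = m + degree h"
  shows "\<exists>A B. Q = A * B \<and> degree A = m \<and> degree B = degree h"
proof -
  define d where "d = degree h"
  define L where "L = [:-u, 1:] ^ m"
  \<comment> \<open>the coefficient of \<open>X\<^sup>e\<close> in \<open>Q\<close>, a polynomial in \<open>Y\<close>\<close>
  define F where "F e = map_poly (\<lambda>c. c $$ int e) Q" for e
  have cF: "coeff (F e) i = coeff Q i $$ int e" for e i by (simp add: F_def coeff_map_poly)
  have F0: "F 0 = L * h" using Q(2) q(1) by (intro poly_eqI) (simp add: cF lform_def L_def)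
  have Fv: "coeff (F e) i = 0" if "i \<ge> m + d" "e > 0" for e i
  proof (cases "i = m + d")
    case True
    then have "coeff Q i = 1" using Q(1) q(4) d_def by simp
    then show ?thesis using that by (simp add: cF)
  next
    case False
    then have "coeff Q i = 0" using that q(4) d_def by (intro coeff_eq_0) auto
    then show ?thesis by (simp add: cF)
  qed
  \<comment> \<open>\<open>r\<close> can serve as the pair of \<open>e\<close>-th coefficients after the pairs \<open>f j\<close>, \<open>j < e\<close>\<close>
  define C where "C f e r \<longleftrightarrow> (if e = 0 then r = (L, h) else
      (\<forall>i\<ge>m. coeff (fst r) i = 0) \<and> (\<forall>i\<ge>d. coeff (snd r) i = 0) \<and>
      L * snd r + fst r * h + (\<Sum>j\<in>{1..<e}. fst (f j) * snd (f (e - j))) = F e)"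
    for f :: "nat \<Rightarrow> 'a poly \<times> 'a poly" and e r
  have "\<exists>f. \<forall>e. C f e (f e)"
  proof (rule dependent_wf_choice[of less_than])
    show "wf less_than" by simp
  next
    fix f g :: "nat \<Rightarrow> 'a poly \<times> 'a poly" and e r
    assume fg: "\<And>z. (z, e) \<in> less_than \<Longrightarrow> f z = g z"
    have "(\<Sum>j\<in>{1..<e}. fst (f j) * snd (f (e - j))) = (\<Sum>j\<in>{1..<e}. fst (g j) * snd (g (e - j)))"
      by (rule sum.cong) (use fg in auto)
    then show "C f e r = C g e r" by (simp add: C_def)
  next
    fix e f assume IH: "\<And>y. (y, e) \<in> less_than \<Longrightarrow> C f y (f y)"
    show "\<exists>r. C f e r"
    proof (cases "e = 0")
      case False
      define S where "S = (\<Sum>j\<in>{1..<e}. fst (f j) * snd (f (e - j)))"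
      have "\<forall>i\<ge>m + degree h. coeff (F e - S) i = 0"
      proof (intro allI impI)
        fix i assume i: "i \<ge> m + degree h"
        have "coeff (fst (f j) * snd (f (e - j))) i = 0" if "j \<in> {1..<e}" for j
          using that IH[of j] IH[of "e - j"] i d_def
          by (intro coeff_mult_vanish[of m _ d]) (auto simp: C_def)
        then show "coeff (F e - S) i = 0" using Fv[of i e] i False by (simp add: S_def coeff_sum d_def)
      qed
      from linear_power_crt_degree[OF q(3) this]
      obtain G H where "F e - S = h * G + L * H" "\<forall>i\<ge>m. coeff G i = 0" "\<forall>i\<ge>degree h. coeff H i = 0"
        unfolding L_def by blast
      then have "C f e (G, H)" using False by (simp add: C_def S_def d_def algebra_simps)
      then show ?thesis by blast
    qed (simp add: C_def)
  qed
  then obtain f where f: "\<And>e. C f e (f e)" by blast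
  define a where "a e = fst (f e)" for e
  define b where "b e = snd (f e)" for e
  have a0: "a 0 = L" and b0: "b 0 = h" using f[of 0] by (simp_all add: C_def a_def b_def)
  have degL: "degree L = m" by (simp add: L_def degree_power_eq)
  have av: "coeff (a e) i = 0" if "i > m" for e i
    using f[of e] a0 that degL by (cases "e = 0") (auto simp: C_def a_def intro: coeff_eq_0)
  have bv: "coeff (b e) i = 0" if "i > d" for e i
    using f[of e] b0 that d_def by (cases "e = 0") (auto simp: C_def b_def intro: coeff_eq_0)
  have conv: "(\<Sum>k\<le>e. a k * b (e - k)) = F e" for e
  proof (cases e)
    case 0
    then show ?thesis by (simp add: a0 b0 F0)
  next
    case (Suc n)
    have "{..e} = insert 0 (insert e {1..<e})" using Suc by auto
    then have "(\<Sum>k\<le>e. a k * b (e - k)) = a 0 * b e + (a e * b 0 + (\<Sum>k\<in>{1..<e}. a k * b (e - k)))"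
      using Suc by (simp add: algebra_simps)
    then show ?thesis using f[of e] Suc a0 b0 by (simp add: C_def a_def b_def algebra_simps)
  qed
  \<comment> \<open>exchanges the two variables: coefficients of powers of \<open>X\<close> become coefficients of powers of \<open>Y\<close>\<close>
  define sw where "sw c k = (\<Sum>i\<le>k. monom (fps_to_fls (Abs_fps (\<lambda>e. coeff (c e) i))) i)"
    for c :: "nat \<Rightarrow> 'a poly" and k :: nat
  have csw: "coeff (sw c k) i = fps_to_fls (Abs_fps (\<lambda>e. coeff (c e) i))"
    if "\<And>e i. i > k \<Longrightarrow> coeff (c e) i = 0" for c k i
  proof -
    have "coeff (sw c k) i = (\<Sum>j\<le>k. if j = i then fps_to_fls (Abs_fps (\<lambda>e. coeff (c e) i)) else 0)"
      unfolding sw_def coeff_sum by (rule sum.cong) auto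
    also have "\<dots> = (if i \<le> k then fps_to_fls (Abs_fps (\<lambda>e. coeff (c e) i)) else 0)"
      by simp
    also have "\<dots> = fps_to_fls (Abs_fps (\<lambda>e. coeff (c e) i))"
    proof -
      have "Abs_fps (\<lambda>e. coeff (c e) i) = 0" if "i > k" using that \<open>\<And>e i. i > k \<Longrightarrow> coeff (c e) i = 0\<close>
        by (simp add: fps_eq_iff)
      then show ?thesis by (cases "i > k") auto
    qed
    finally show ?thesis .
  qed
  let ?A = "sw a m" and ?B = "sw b d"
  have AB: "?A * ?B = Q"
  proof (rule poly_eqI)
    fix i
    have "coeff (?A * ?B) i = (\<Sum>j\<le>i. fps_to_fls (Abs_fps (\<lambda>e. coeff (a e) j)) * fps_to_fls (Abs_fps (\<lambda>e. coeff (b e) (i - j))))"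
      unfolding coeff_mult using av bv by (simp add: csw)
    also have "\<dots> = fps_to_fls (\<Sum>j\<le>i. Abs_fps (\<lambda>e. coeff (a e) j) * Abs_fps (\<lambda>e. coeff (b e) (i - j)))"
      by (simp add: fls_times_fps_to_fls fps_to_fls_sum)
    also have "(\<Sum>j\<le>i. Abs_fps (\<lambda>e. coeff (a e) j) * Abs_fps (\<lambda>e. coeff (b e) (i - j))) = Abs_fps (\<lambda>e. coeff (F e) i)"
    proof (rule fps_ext)
      fix e
      have "(\<Sum>j\<le>i. Abs_fps (\<lambda>e. coeff (a e) j) * Abs_fps (\<lambda>e. coeff (b e) (i - j))) $ e
         = (\<Sum>j\<le>i. \<Sum>k\<le>e. coeff (a k) j * coeff (b (e - k)) (i - j))"
        by (simp add: fps_sum_nth fps_mult_nth atLeast0AtMost)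
      also have "\<dots> = (\<Sum>k\<le>e. coeff (a k * b (e - k)) i)"
        unfolding coeff_mult by (rule sum.swap)
      also have "\<dots> = coeff (F e) i" by (simp add: coeff_sum flip: conv)
      finally show "(\<Sum>j\<le>i. Abs_fps (\<lambda>e. coeff (a e) j) * Abs_fps (\<lambda>e. coeff (b e) (i - j))) $ e = Abs_fps (\<lambda>e. coeff (F e) i) $ e"
        by simp
    qed
    also have "fps_to_fls (Abs_fps (\<lambda>e. coeff (F e) i)) = coeff Q i"
      using Q(2) by (intro fls_eqI) (auto simp: cF lform_def)
    finally show "coeff (?A * ?B) i = coeff Q i" .
  qed
  have "degree ?A \<le> m" "degree ?B \<le> d"
    using av bv by (auto intro!: degree_le simp: csw fps_eq_iff)
  moreover have "Q \<noteq> 0" using Q(1) by auto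
  then have "?A \<noteq> 0" "?B \<noteq> 0" using AB by auto
  then have "degree ?A + degree ?B = m + d" using AB q(4) d_def degree_mult_eq[of ?A ?B] by simp
  ultimately show ?thesis using AB d_def by (intro exI[of _ ?A] exI[of _ ?B]) auto
qed

definition splits_properly :: "'a::field poly \<Rightarrow> bool" where
  "splits_properly P \<longleftrightarrow> (\<exists>A B. P = A * B \<and> degree A > 0 \<and> degree B > 0)"

lemma splits_properly_pcompose_iff:
  fixes P :: "'a::field poly"
  assumes "a \<noteq> 0"
  shows "splits_properly (pcompose P [:b, a:]) \<longleftrightarrow> splits_properly P"
proof -
  have "splits_properly (pcompose P [:b, a:])" if a: "splits_properly P" "a \<noteq> 0" for P :: "'a poly" and a b
  proof -
    obtain A B where AB: "P = A * B" "degree A > 0" "degree B > 0" using a(1) by (auto simp: splits_properly_def)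
    then show ?thesis unfolding splits_properly_def using \<open>a \<noteq> 0\<close>
      by (intro exI[of _ "pcompose A [:b, a:]"] exI[of _ "pcompose B [:b, a:]"])
        (simp add: pcompose_mult degree_pcompose)
  qed
  moreover have "pcompose (pcompose P [:b, a:]) [:-b/a, 1/a:] = P"
    using assms by (simp add: pcompose_pCons flip: pcompose_assoc)
  ultimately show ?thesis using assms by (metis divide_eq_0_iff one_neq_zero)
qed

lemma splits_properly_smult_iff:
  fixes P :: "'a::field poly"
  assumes "a \<noteq> 0"
  shows "splits_properly (smult a P) \<longleftrightarrow> splits_properly P"
proof -
  have "splits_properly (smult a P)" if a: "splits_properly P" "a \<noteq> 0" for P :: "'a poly" and a
    using a unfolding splits_properly_def by (metis mult_smult_left degree_smult_eq)
  moreover have "smult (inverse a) (smult a P) = P" using assms by simp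
  ultimately show ?thesis using assms by (metis inverse_nonzero_iff_nonzero)
qed

text \<open>
  A translation moves the second highest coefficient by a multiple of the leading one, hence can
  remove it.
\<close>
lemma coeff_pcompose_shift:
  fixes p :: "'a::field poly"
  assumes "degree p \<le> Suc n"
  shows "coeff (pcompose p [:c, 1:]) n = coeff p n + of_nat (Suc n) * c * coeff p (Suc n)
    \<and> coeff (pcompose p [:c, 1:]) (Suc n) = coeff p (Suc n)"
  using assms
proof (induction n arbitrary: p)
  case 0
  then obtain a b where "p = [:a, b:]" using degree_le_1_eq by (metis One_nat_def)
  then show ?case by (simp add: pcompose_pCons)
next
  case (Suc n)
  obtain a p' where p: "p = pCons a p'" by (cases p) auto
  have d: "degree p' \<le> Suc n" using Suc.prems p by (cases "p' = 0") auto
  have "degree (pcompose p' [:c, 1:]) \<le> Suc n"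
    using degree_pcompose_le[of p' "[:c, 1:]"] d by simp
  then have "coeff (pcompose p' [:c, 1:]) (Suc (Suc n)) = 0" by (intro coeff_eq_0) simp
  then show ?case using Suc.IH[OF d] by (simp add: p pcompose_pCons coeff_pCons algebra_simps)
qed

text \<open>
  The variable \<open>Y\<close> is rescaled by the least slope of the Newton polygon, so that the
  reduction modulo \<open>X\<close> exists and is not \<open>Y\<^sup>n\<close>. Without a term in
  \<open>Y\<^bsup>n-1\<^esup>\<close> it is not \<open>(Y - u)\<^sup>n\<close> for any other
  \<open>u\<close> either, because the characteristic is zero. It therefore has a coprime
  factorization, which Hensel's lemma lifts.
\<close>
lemma tschirnhaus_split:
  fixes P :: "'a::{alg_closed_field, field_char_0} fls poly"
  assumes P: "degree P = n" "lead_coeff P = 1" "n \<ge> 2" "coeff P (n - 1) = 0"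
  shows "\<exists>N>0. splits_properly (ramify N P)"
proof (cases "\<exists>i<n. coeff P i \<noteq> 0")
  case False
  then have "P = monom 1 n" using P by (intro poly_eqI) (metis coeff_eq_0 coeff_monom linorder_neqE_nat)
  then have "ramify 1 P = monom 1 1 * monom 1 (n - 1)" using P(3) by (simp add: mult_monom)
  then show ?thesis using P(3) unfolding splits_properly_def
    by (intro exI[of _ 1] conjI exI[of _ "monom 1 1"] exI[of _ "monom 1 (n - 1)"]) (auto simp: degree_monom_eq)
next
  case True
  define v where "v i = fls_subdegree (coeff P i)" for i
  define I where "I = {i. i < n \<and> coeff P i \<noteq> 0}"
  define r where "r i = (of_int (v i) / of_nat (n - i) :: rat)" for i
  have I: "finite I" "I \<noteq> {}" using True by (auto simp: I_def)
  define i0 where "i0 = arg_min_on r I"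
  have i0: "i0 \<in> I" "\<And>i. i \<in> I \<Longrightarrow> r i0 \<le> r i"
    unfolding i0_def using I arg_min_if_finite(1)[OF I] arg_min_least[OF I] by auto
  \<comment> \<open>ramification by \<open>n - i0\<close> makes the least slope \<open>v i0 / (n - i0)\<close> the integer \<open>v i0\<close>\<close>
  define N where "N = n - i0"
  have N: "N > 0" using i0(1) by (auto simp: N_def I_def)
  define s where "s = v i0"
  have le: "s * int (n - i) \<le> int N * v i" if "i \<in> I" for i
  proof -
    have "of_int s / of_nat N \<le> (of_int (v i) / of_nat (n - i) :: rat)"
      using i0(2)[OF that] by (simp add: r_def s_def N_def)
    moreover have "n - i > 0" using that by (auto simp: I_def)
    ultimately have "of_int s * of_nat (n - i) \<le> (of_int (v i) * of_nat N :: rat)"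
      using N by (simp add: field_simps)
    then have "of_int (s * int (n - i)) \<le> (of_int (v i * int N) :: rat)" by simp
    then show ?thesis by (simp only: of_int_le_iff mult.commute)
  qed
  define Q where "Q = smult (fls_X_intpow (- int n * s)) (pcompose (ramify N P) [:0, fls_X_intpow s:])"
  have cQ: "coeff Q i $$ e = fls_compose_power (coeff P i) N $$ (e + (int n - int i) * s)" for i e
  proof -
    have "coeff Q i = fls_X_intpow (- int n * s) * (fls_X_intpow s ^ i * fls_compose_power (coeff P i) N)"
      by (simp add: Q_def coeff_pcompose_linear coeff_ramify)
    also have "(fls_X_intpow s :: 'a fls) ^ i = fls_X_intpow (int i * s)"
      by (rule fls_X_intpow_power)
    finally show ?thesis by (simp add: fls_X_intpow_times_conv_shift fls_shifted_times_simps algebra_simps)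
  qed
  have low: "coeff Q i $$ e = 0" if "e < 0" for i e
  proof (cases "i \<in> I")
    case True
    then have *: "e + (int n - int i) * s < int N * v i"
      using le[OF True] that by (simp add: I_def of_nat_diff algebra_simps)
    show ?thesis unfolding cQ using N *
      by (auto simp: fls_nth_compose_power v_def)
  next
    case False
    then have "i = n \<or> coeff P i = 0" using P(1) by (auto simp: I_def coeff_eq_0 not_less_iff_gr_or_eq)
    then show ?thesis unfolding cQ using that P(1,2) N by auto
  qed
  define q where "q = map_poly (\<lambda>c. c $$ 0) Q"
  have cq: "coeff q i = coeff Q i $$ 0" for i by (simp add: q_def coeff_map_poly)
  have lf: "lform 0 Q q" using low by (simp add: lform_def cq)
  have shift_nz: "fls_shift k (1::'a fls) \<noteq> 0" for k by (auto simp: fls_eq_iff intro!: exI[of _ "-k"])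
  have dQ: "degree Q = n" 
    using P(1) N shift_nz by (simp add: Q_def degree_pcompose)
  have lQ: "coeff Q n = 1"
  proof (rule fls_eqI)
    fix e show "coeff Q n $$ e = 1 $$ e" unfolding cQ using P(1,2) N by simp
  qed
  have q_n: "coeff q n = 1" by (simp add: cq lQ)
  have dq: "degree q = n"
    by (rule antisym[OF degree_le le_degree]) (use q_n dQ in \<open>auto simp: cq coeff_eq_0\<close>)
  have q_n1: "coeff q (n - 1) = 0" using P(4) by (simp add: cq cQ)
  have q_i0: "coeff q i0 \<noteq> 0"
  proof -
    have eq: "(int n - int i0) * s = int N * s" using i0(1) by (simp add: N_def I_def of_nat_diff)
    have "coeff q i0 = coeff P i0 $$ s"
      unfolding cq cQ eq using N by (simp add: fls_nth_compose_power)
    then show ?thesis using i0(1) by (simp add: s_def v_def I_def)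
  qed
  have i0n: "i0 < n" using i0(1) by (simp add: I_def)
  obtain u where u: "poly q u = 0" using alg_closed_imp_poly_has_root[of q] dq P(3) by auto
  have "q \<noteq> 0" using dq P(3) by auto
  then obtain h where h: "q = [:-u, 1:] ^ order u q * h" "\<not> [:-u, 1:] dvd h"
    using order_decomp by blast
  define m where "m = order u q"
  have m: "m > 0" using u \<open>q \<noteq> 0\<close> order_root m_def by fastforce
  have "h \<noteq> 0" using h \<open>q \<noteq> 0\<close> by auto
  have deg: "n = m + degree h"
    using dq h(1) \<open>h \<noteq> 0\<close> m_def by (metis degree_linear_power degree_mult_eq pCons_eq_0_iff power_eq_0_iff zero_neq_one)
  have lh: "lead_coeff h = 1"
  proof -
    have "lead_coeff q = lead_coeff ([:-u, 1:] ^ m) * lead_coeff h"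
      using h(1) m_def by (metis lead_coeff_mult)
    then show ?thesis using q_n dq by (simp add: lead_coeff_power)
  qed
  have hu: "poly h u \<noteq> 0" using h(2) poly_eq_0_iff_dvd by blast
  have "degree h > 0"
  proof (rule ccontr)
    assume "\<not> degree h > 0"
    then have "h = 1" using lh by (metis degree_0_id gr0I of_nat_0 one_pCons coeff_pCons_0 degree_eq_zeroE)
    then have qu: "q = [:-u, 1:] ^ n" using h(1) deg m_def \<open>\<not> degree h > 0\<close> by auto
    moreover have "pcompose (monom 1 n) [:-u, 1:] = [:-u, 1:] ^ n"
      by (simp add: pcompose_altdef map_poly_monom poly_monom)
    ultimately have "coeff q (n - 1) = - of_nat n * u"
      using coeff_pcompose_shift[of "monom (1::'a) n" "n - 1" "-u"] P(3) by (simp add: degree_monom_eq)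
    then have "u = 0" using q_n1 P(3) by simp
    then have "q = monom 1 n" using qu by (simp add: monom_altdef)
    then show False using q_i0 i0n by simp
  qed
  moreover obtain A B where "Q = A * B" "degree A = m" "degree B = degree h"
    using hensel_linear_power[OF _ lf _ lh hu] dQ lQ h(1) deg m_def by (metis (no_types))
  ultimately have "splits_properly Q" using m unfolding splits_properly_def by metis
  then have "splits_properly (ramify N P)"
    unfolding Q_def using shift_nz by (simp add: splits_properly_smult_iff splits_properly_pcompose_iff)
  then show ?thesis using N by blast
qed

lemma ramify_pcompose_linear:
  assumes "N > 0"
  shows "ramify N (pcompose P [:b, a:]) = pcompose (ramify N P) [:fls_compose_power b N, fls_compose_power a N:]"
  by (induction P) (simp_all add: pcompose_pCons ramify_add ramify_smult ramify_pCons assms)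

lemma ramify_splits_properly:
  fixes P :: "'a::{alg_closed_field, field_char_0} fls poly"
  assumes "degree P \<ge> 2"
  shows "\<exists>N>0. splits_properly (ramify N P)"
proof -
  define n where "n = degree P"
  define l where "l = lead_coeff P"
  have "P \<noteq> 0" using assms by auto
  then have l: "l \<noteq> 0" by (simp add: l_def)
  define b where "b = - coeff P (n - 1) / (of_nat n * l)"
  define P1 where "P1 = smult (inverse l) (pcompose P [:b, 1:])"
  have n: "n = Suc (n - 1)" using assms by (simp add: n_def)
  have c: "coeff (pcompose P [:b, 1:]) (n - 1) = coeff P (n - 1) + of_nat n * b * l"
    "coeff (pcompose P [:b, 1:]) n = l"
    using coeff_pcompose_shift[of P "n - 1" b] n n_def l_def by auto
  have "degree P1 = n" using l by (simp add: P1_def degree_pcompose n_def)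
  moreover have "coeff P1 n = 1" using l c by (simp add: P1_def)
  moreover have "coeff P1 (n - 1) = 0" using l c n by (simp add: P1_def b_def)
  ultimately obtain N where N: "N > 0" "splits_properly (ramify N P1)"
    using tschirnhaus_split[of P1 n] assms n_def by auto
  then show ?thesis using l unfolding P1_def
    by (auto simp: ramify_smult ramify_pcompose_linear splits_properly_smult_iff splits_properly_pcompose_iff)
qed

lemma newton_puiseux:
  fixes P :: "'a::{alg_closed_field, field_char_0} fls poly"
  shows "\<exists>N>0. \<exists>c Z. ramify N P = smult c (\<Prod>z\<in>#Z. [:-z, 1:])"
proof (induction "degree P" arbitrary: P rule: less_induct)
  case less
  consider "degree P = 0" | "degree P = 1" | "degree P \<ge> 2" by linarith
  then show ?case
  proof cases
    case 1
    then obtain c where "P = [:c:]" by (rule degree_eq_zeroE)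
    then show ?thesis by (intro exI[of _ 1] conjI exI[of _ c] exI[of _ "{#}"]) auto
  next
    case 2
    define a b where "a = coeff P 0" and "b = coeff P 1"
    have P: "P = [:a, b:]" "b \<noteq> 0"
      using 2 degree_le_1_eq[of P] leading_coeff_0_iff[of P] by (auto simp del: leading_coeff_0_iff simp: a_def b_def)
    then show ?thesis
      by (intro exI[of _ 1] conjI exI[of _ b] exI[of _ "{#- a / b#}"]) auto
  next
    case 3
    then obtain N A B where N: "N > 0" "ramify N P = A * B" "degree A > 0" "degree B > 0"
      using ramify_splits_properly unfolding splits_properly_def by blast
    have deg: "degree A + degree B = degree P"
      using N degree_mult_eq[of A B] by (metis degree_0 degree_ramify less_numeral_extra(3))
    then obtain Na c Z where A: "Na > 0" "ramify Na A = smult c (\<Prod>z\<in>#Z. [:-z, 1:])"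
      using less[of A] N by auto
    have "degree (ramify Na B) = degree B" using A by simp
    then obtain Nb c' Z' where B: "Nb > 0" "ramify Nb (ramify Na B) = smult c' (\<Prod>z\<in>#Z'. [:-z, 1:])"
      using less[of "ramify Na B"] N deg by auto
    let ?\<phi> = "\<lambda>z. fls_compose_power z Nb"
    have "ramify Nb (ramify Na A) = smult (?\<phi> c) (\<Prod>z\<in>#Z. [:- ?\<phi> z, 1:])"
      using B(1) by (simp add: A(2) ramify_smult ramify_prod_mset ramify_pCons image_mset.compositionality o_def)
    then have "ramify (N * Na * Nb) P = smult (c' * ?\<phi> c) (\<Prod>z\<in>#image_mset ?\<phi> Z + Z'. [:-z, 1:])"
      using N(1,2) A(1) B by (simp add: ramify_ramify[symmetric] ramify_mult image_mset.compositionality o_def)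
    then show ?thesis using N(1) A(1) B(1) by (metis mult_pos_pos)
  qed
qed

section \<open>Roots of unity\<close>

definition unity :: "nat \<Rightarrow> 'a::field set" where
  "unity n = {\<zeta>. \<zeta> ^ n = 1}"

lemma unity_nonzero: "n > 0 \<Longrightarrow> \<zeta> \<in> unity n \<Longrightarrow> \<zeta> \<noteq> 0"
  by (auto simp: unity_def root_of_unity_nonzero)

lemma one_in_unity [simp]: "1 \<in> unity n"
  by (simp add: unity_def)

lemma unity_dvd_mono: "d dvd n \<Longrightarrow> unity d \<subseteq> (unity n :: 'a::field set)"
  by (auto simp: unity_def elim!: dvdE simp: power_mult)

lemma order_prod_linear:
  "order x (\<Prod>z\<in>#Z. [:-z, 1:]) = count Z (x::'a::field)"
proof (induction Z)
  case (add z Z)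
  have "order x [:-z, 1:] = (if z = x then 1 else 0)"
    using order_power_n_n[of x 1] by (auto intro: order_0I)
  moreover have "(\<Prod>z\<in>#Z. [:-z, 1:]) \<noteq> 0" by (auto simp: prod_mset_zero_iff)
  ultimately show ?case using add.IH by (simp add: order_mult del: mult_pCons_left)
qed simp

lemma poly_prod_linear_eq_0_iff: "poly (\<Prod>z\<in>#Z. [:-z, 1:]) (x::'a::field) = 0 \<longleftrightarrow> x \<in># Z"
  by (induction Z) auto

lemma degree_prod_linear: "degree (\<Prod>z\<in>#Z. [:-z, 1::'a::field:]) = size Z"
proof (induction Z)
  case (add z Z)
  have "(\<Prod>z\<in>#Z. [:-z, 1:]) \<noteq> 0" by (auto simp: prod_mset_zero_iff)
  then show ?case using add.IH by (simp add: degree_mult_eq del: mult_pCons_left)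
qed simp

text \<open>
  The polynomial \<open>Y\<^sup>n - 1\<close> is separable in characteristic zero.
\<close>
lemma card_unity:
  assumes "n > 0"
  shows "finite (unity n :: 'a set)" "card (unity n :: 'a::{alg_closed_field, field_char_0} set) = n"
proof -
  define p where "p = monom (1::'a) n - 1"
  have pr: "poly p x = 0 \<longleftrightarrow> x \<in> unity n" for x by (simp add: p_def poly_monom unity_def)
  have dp: "degree p = n"
  proof -
    have "degree (monom (1::'a) n + (- 1)) = degree (monom (1::'a) n)"
      by (rule degree_add_eq_left) (use assms in \<open>simp add: degree_monom_eq\<close>)
    then show ?thesis by (simp add: p_def degree_monom_eq)
  qed
  have "p \<noteq> 0" using dp assms by auto
  obtain A where A: "size A = n" "p = smult (lead_coeff p) (\<Prod>x\<in>#A. [:-x, 1:])"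
    using alg_closed_imp_factorization[OF \<open>p \<noteq> 0\<close>] dp by auto
  have sf: "rsquarefree p"
    unfolding rsquarefree_roots
  proof (intro allI notI)
    fix a assume a: "poly p a = 0 \<and> poly (pderiv p) a = 0"
    then have "a ^ n = 1" "of_nat n * a ^ (n - 1) = 0"
      by (simp_all add: p_def poly_monom pderiv_diff pderiv_monom)
    then show False using assms by (auto simp: power_0_left)
  qed
  have A_eq: "set_mset A = unity n"
  proof -
    have "poly p x = 0 \<longleftrightarrow> x \<in># A" for x
      by (subst A(2)) (use \<open>p \<noteq> 0\<close> in \<open>simp add: poly_prod_linear_eq_0_iff\<close>)
    then show ?thesis using pr by auto
  qed
  have "count A x = (if x \<in># A then 1 else 0)" for x
  proof -
    have "order x p = count A x"
      by (subst A(2)) (use \<open>p \<noteq> 0\<close> in \<open>simp add: order_smult order_prod_linear\<close>)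
    moreover have "order x p = 0 \<or> order x p = 1" using sf by (simp add: rsquarefree_def)
    ultimately show ?thesis by (metis count_eq_zero_iff)
  qed
  then have "A = mset_set (set_mset A)" by (intro multiset_eqI) auto
  then show "card (unity n :: 'a set) = n" using A(1) A_eq by (metis size_mset_set)
  show "finite (unity n :: 'a set)" using A_eq by (metis finite_set_mset)
qed

lemma root_of_unity_order:
  fixes \<zeta> :: "'a::field"
  assumes "n > 0" "\<zeta> \<in> unity n"
  obtains r :: int where "r > 0" "\<And>k. \<zeta> powi k = 1 \<longleftrightarrow> r dvd k"
proof -
  define r where "r = (LEAST m. m > 0 \<and> \<zeta> ^ m = 1)"
  have r: "r > 0" "\<zeta> ^ r = 1"
    using LeastI[of "\<lambda>m. m > 0 \<and> \<zeta> ^ m = 1" n] assms by (auto simp: r_def unity_def)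
  have min: "m = 0" if "m < r" "\<zeta> ^ m = 1" for m
    using that not_less_Least[of m "\<lambda>m. m > 0 \<and> \<zeta> ^ m = 1"] by (auto simp: r_def)
  have nz: "\<zeta> \<noteq> 0" using assms unity_nonzero by blast
  have "\<zeta> powi k = 1 \<longleftrightarrow> int r dvd k" for k
  proof -
    have "\<zeta> powi k = \<zeta> powi (int r * (k div int r) + k mod int r)" by simp
    also have "\<dots> = (\<zeta> ^ r) powi (k div int r) * \<zeta> powi (k mod int r)"
      using nz by (subst power_int_add) (auto simp: power_int_mult)
    also have "\<dots> = \<zeta> ^ nat (k mod int r)"
      using r by (simp add: power_int_def)
    finally have "\<zeta> powi k = 1 \<longleftrightarrow> \<zeta> ^ nat (k mod int r) = 1" by simp
    also have "\<dots> \<longleftrightarrow> nat (k mod int r) = 0"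
      using min[of "nat (k mod int r)"] r by (auto simp: nat_less_iff)
    also have "\<dots> \<longleftrightarrow> int r dvd k"
      using r by (simp add: dvd_eq_mod_eq_0) (metis of_nat_0_less_iff pos_mod_sign order_antisym)
    finally show ?thesis .
  qed
  then show ?thesis using that[of "int r"] r by simp
qed

text \<open>
  The exponents killed by \<open>\<zeta>\<close> are the multiples of its order, so even
  infinitely many conditions collapse to a single one.
\<close>
lemma unity_Gcd:
  fixes \<zeta> :: "'a::field"
  assumes "n > 0" "\<zeta> \<in> unity n"
  shows "(\<forall>e\<in>S. \<zeta> powi e = 1) \<longleftrightarrow> \<zeta> \<in> unity (nat (Gcd (insert (int n) S)))"
proof -
  obtain r :: int where r: "r > 0" "\<And>k. \<zeta> powi k = 1 \<longleftrightarrow> r dvd k"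
    using root_of_unity_order[OF assms] by metis
  have "r dvd int n" using r(2)[of "int n"] assms by (simp add: unity_def)
  then have "(\<forall>e\<in>S. \<zeta> powi e = 1) \<longleftrightarrow> r dvd Gcd (insert (int n) S)"
    unfolding r(2) dvd_Gcd_iff by auto
  also have "\<dots> \<longleftrightarrow> \<zeta> powi (Gcd (insert (int n) S)) = 1" by (simp add: r(2))
  also have "\<dots> \<longleftrightarrow> \<zeta> \<in> unity (nat (Gcd (insert (int n) S)))"
    by (simp add: unity_def power_int_def)
  finally show ?thesis .
qed

text \<open>
  Otherwise all \<open>n\<close>-th roots of unity would be \<open>d\<close>-th roots for \<open>d
  = gcd n e < n\<close>.
\<close>
lemma unity_all_powers:
  assumes "n > 0" "\<And>\<zeta>::'a::{alg_closed_field, field_char_0}. \<zeta> \<in> unity n \<Longrightarrow> \<zeta> powi e = 1"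
  shows "int n dvd e"
proof -
  define d where "d = nat (Gcd {int n, e})"
  have "int d dvd int n" by (simp add: d_def)
  then have "d dvd n" by simp
  have "unity n \<subseteq> (unity d :: 'a set)"
    using unity_Gcd[of n _ "{e}"] assms by (auto simp: d_def)
  then have "unity n = (unity d :: 'a set)" using unity_dvd_mono[OF \<open>d dvd n\<close>] by blast
  moreover have "d > 0" using \<open>d dvd n\<close> assms(1) by (auto intro: Nat.gr0I)
  ultimately have "n = d" by (metis card_unity(2) assms(1))
  then have "int n = Gcd {int n, e}" unfolding d_def by (metis Gcd_int_greater_eq_0 int_nat_eq)
  moreover have "Gcd {int n, e} dvd e" by (rule Gcd_dvd) simp
  ultimately show ?thesis by simp
qed

section \<open>The roots of an irreducible polynomial\<close>

text \<open>
  For \<open>N = degree f\<close> these are the Newton roots. Larger \<open>N\<close> serve to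
  compare several polynomials in one field.
\<close>
definition rts :: "nat \<Rightarrow> 'a::field fls poly \<Rightarrow> 'a fls set" where
  "rts N f = {z. poly (ramify N f) z = 0}"

lemma newton_roots_eq: "newton_roots f = rts (degree f) f"
  by (simp add: newton_roots_def rts_def ramify_def)

lemma Rnat_degree_pos: "f \<in> Rnat \<Longrightarrow> degree f > 0"
  unfolding Rnat_def using is_unit_iff_degree[of f] irreducible_not_unit[of f] by (auto simp: irreducible_def)

lemma Rnat_nonzero: "f \<in> Rnat \<Longrightarrow> f \<noteq> 0"
  using Rnat_degree_pos by force

lemma Rnat_monic: "f \<in> Rnat \<Longrightarrow> lead_coeff f = 1"
  by (simp add: Rnat_def)

lemma rts_rot:
  assumes "N > 0" "\<zeta> \<in> unity N" "z \<in> rts N f"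
  shows "rot \<zeta> z \<in> rts N f"
proof -
  have nz: "\<zeta> \<noteq> 0" using assms unity_nonzero by blast
  have "poly (map_poly (rot \<zeta>) (ramify N f)) (rot \<zeta> z) = 0"
    using assms(3) nz by (simp add: poly_map_rot rts_def)
  then show ?thesis using assms by (simp add: map_poly_rot_ramify rts_def unity_def)
qed

lemma Gcd_support_unit_inj:
  fixes z :: "'a::field fls"
  assumes "n > 0" "Gcd (insert (int n) {e. z $$ e \<noteq> 0}) = 1"
  shows "inj_on (\<lambda>\<zeta>. rot \<zeta> z) (unity n)"
proof (rule inj_onI)
  fix a b :: 'a assume ab: "a \<in> unity n" "b \<in> unity n" "rot a z = rot b z"
  have nz: "a \<noteq> 0" "b \<noteq> 0" using ab assms(1) unity_nonzero by auto
  have u: "a / b \<in> unity n" using ab by (simp add: unity_def power_divide)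
  have "(a / b) powi e = 1" if "z $$ e \<noteq> 0" for e
  proof -
    have "rot a z $$ e = rot b z $$ e" using ab by simp
    then show ?thesis using nz that by (simp add: rot_nth power_int_divide_distrib)
  qed
  then have "a / b \<in> unity 1" using unity_Gcd[OF assms(1) u, of "{e. z $$ e \<noteq> 0}"] assms(2) by simp
  then show "a = b" using nz by (simp add: unity_def)
qed

lemma fls_root_of_compose_power:
  fixes z :: "'a::field fls"
  assumes "d > 0" "\<And>e. z $$ e \<noteq> 0 \<Longrightarrow> int d dvd e"
  shows "\<exists>w. z = fls_compose_power w d"
proof -
  define w where "w = Abs_fls (\<lambda>e. z $$ (int d * e))"
  have "w $$ e = z $$ (int d * e)" for e
    unfolding w_def
  proof (rule nth_Abs_fls_lower_bound[of "- \<bar>fls_subdegree z\<bar>"], intro allI impI)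
    fix k assume k: "k < - \<bar>fls_subdegree z\<bar>"
    then have "k * int d \<le> k * 1" using assms(1) by (intro mult_left_mono_neg) auto
    then have "int d * k \<le> k" by (simp add: mult.commute)
    then show "z $$ (int d * k) = 0" using k by (intro fls_eq0_below_subdegree) auto
  qed
  then have "z = fls_compose_power w d"
    using assms by (intro fls_eqI) (auto simp: fls_nth_compose_power)
  then show ?thesis ..
qed

lemma map_poly_rot_prod_linear:
  assumes "\<zeta> \<noteq> 0" "finite A"
  shows "map_poly (rot \<zeta>) (\<Prod>a\<in>A. [:- g a, 1:]) = (\<Prod>a\<in>A. [:- rot \<zeta> (g a), 1:])"
  using assms(2)
proof induction
  case empty
  have "rot \<zeta> 1 = 1" by (rule fls_eqI) (simp add: rot_nth assms)
  then show ?case by simp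
next
  case (insert x A)
  have 1: "rot \<zeta> 1 = 1" by (rule fls_eqI) (simp add: rot_nth assms)
  have "rot \<zeta> (- g x) = - rot \<zeta> (g x)" by (rule fls_eqI) (simp add: rot_nth assms)
  then show ?case using insert assms(1) 1
    by (simp add: map_poly_rot_mult map_poly_pCons del: mult_pCons_left)
qed

lemma distinct_roots_dvd:
  fixes p :: "'a::field poly"
  assumes "finite A" "\<And>a. a \<in> A \<Longrightarrow> poly p a = 0"
  shows "(\<Prod>a\<in>A. [:-a, 1:]) dvd p"
  using assms
proof (induction A arbitrary: p)
  case (insert x A)
  obtain q where q: "p = [:-x, 1:] * q" using insert.prems by (metis dvdE insertI1 poly_eq_0_iff_dvd)
  have "(\<Prod>a\<in>A. [:-a, 1:]) dvd q" using insert.hyps insert.prems by (intro insert.IH) (auto simp: q)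
  then show ?case using insert.hyps by (simp add: q del: mult_pCons_left)
qed simp

text \<open>
  Take a root \<open>z\<close> with the least ramification index \<open>M\<close>. By minimality
  the exponents of \<open>z\<close> and \<open>M\<close> have greatest common divisor 1, so the
  \<open>M\<close> rotations of \<open>z\<close> are distinct. The product of the corresponding
  linear factors is invariant under rotation, hence of the form \<open>g(X\<^sup>M, Y)\<close>,
  and \<open>g\<close> divides the irreducible \<open>f\<close>. So \<open>g = f\<close> and
  \<open>M = n\<close>.
\<close>
theorem newton_theorem:
  fixes f :: "'a::{alg_closed_field, field_char_0} fls poly"
  assumes f: "f \<in> Rnat" and n: "n = degree f"
  shows "\<exists>z. ramify n f = (\<Prod>\<zeta>\<in>unity n. [:- rot \<zeta> z, 1:]) \<and> Gcd (insert (int n) {e. z $$ e \<noteq> 0}) = 1"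
proof -
  have npos: "n > 0" using f n Rnat_degree_pos by blast
  have f0: "f \<noteq> 0" using f Rnat_nonzero by blast
  define Q where "Q M \<longleftrightarrow> M > 0 \<and> (\<exists>z. z \<in> rts M f)" for M
  have "\<exists>M. Q M"
  proof -
    obtain M c Z where M: "M > 0" "ramify M f = smult c (\<Prod>z\<in>#Z. [:-z, 1:])" using newton_puiseux by blast
    then have "degree f = degree (smult c (\<Prod>z\<in>#Z. [:-z, 1:]))" by (metis degree_ramify)
    also have "\<dots> \<le> size Z" using degree_smult_le degree_prod_linear by metis
    finally obtain z where "z \<in># Z" using npos n by (metis le_zero_eq multiset_nonemptyE not_less0 size_empty)
    then have "z \<in> rts M f" by (simp add: rts_def M(2) poly_prod_linear_eq_0_iff)
    then show ?thesis using M(1) by (auto simp: Q_def)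
  qed
  define M where "M = (LEAST M. Q M)"
  have "Q M" unfolding M_def using \<open>\<exists>M. Q M\<close> by (rule LeastI_ex)
  then obtain z where M: "M > 0" and z: "z \<in> rts M f" by (auto simp: Q_def)
  define d where "d = nat (Gcd (insert (int M) {e. z $$ e \<noteq> 0}))"
  have dG: "int d = Gcd (insert (int M) {e. z $$ e \<noteq> 0})" by (simp add: d_def)
  have "int d dvd int M" unfolding dG by (rule Gcd_dvd) simp
  then obtain M' where M': "M = d * M'" by auto
  have pos: "d > 0" "M' > 0" using M M' by (auto intro: Nat.gr0I)
  have "int d dvd e" if "z $$ e \<noteq> 0" for e unfolding dG by (rule Gcd_dvd) (use that in simp)
  then obtain w where w: "z = fls_compose_power w d" using fls_root_of_compose_power[of d z] pos by blast
  have "poly (ramify d (ramify M' f)) (fls_compose_power w d) = 0"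
    using z w pos by (simp add: rts_def M' ramify_ramify mult.commute)
  then have "w \<in> rts M' f" using pos by (simp add: poly_ramify rts_def)
  then have "Q M'" using pos by (auto simp: Q_def)
  then have "M \<le> M'" unfolding M_def by (rule Least_le)
  then have "d = 1" using M' pos by (metis M mult_le_cancel2 nat_mult_1 le_antisym Suc_leI One_nat_def)
  then have G1: "Gcd (insert (int M) {e. z $$ e \<noteq> 0}) = 1" using dG by simp
  have inj: "inj_on (\<lambda>\<zeta>. rot \<zeta> z) (unity M)" using Gcd_support_unit_inj[OF M G1] .
  have fin: "finite (unity M :: 'a set)" using card_unity M by blast
  define P where "P = (\<Prod>\<zeta>\<in>unity M. [:- rot \<zeta> z, 1:])"
  have P_alt: "P = (\<Prod>w\<in>(\<lambda>\<zeta>. rot \<zeta> z) ` unity M. [:- w, 1:])"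
    unfolding P_def by (simp add: prod.reindex[OF inj])
  have degP: "degree P = M"
    unfolding P_def by (subst degree_prod_eq_sum_degree) (use card_unity(2)[OF M, where 'a = 'a] in auto)
  have lcP: "lead_coeff P = 1" unfolding P_def lead_coeff_prod by simp
  have Pdvd: "P dvd ramify M f"
    unfolding P_alt by (rule distinct_roots_dvd) (use fin rts_rot[OF M _ z] in \<open>auto simp: rts_def\<close>)
  have inv: "map_poly (rot \<xi>) P = P" if \<xi>: "\<xi> \<in> unity M" for \<xi>
  proof -
    have nz: "\<xi> \<noteq> 0" using that M unity_nonzero by blast
    have "map_poly (rot \<xi>) P = (\<Prod>\<zeta>\<in>unity M. [:- rot (\<xi> * \<zeta>) z, 1:])"
      unfolding P_def map_poly_rot_prod_linear[OF nz fin]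
      using nz M by (intro prod.cong refl) (simp add: rot_rot unity_nonzero)
    also have "\<dots> = P" unfolding P_def
      by (rule prod.reindex_bij_witness[of _ "\<lambda>\<zeta>. \<zeta> / \<xi>" "\<lambda>\<zeta>. \<xi> * \<zeta>"])
        (use \<xi> nz in \<open>auto simp: unity_def power_mult_distrib power_divide\<close>)
    finally show ?thesis .
  qed
  have "\<exists>c. coeff P i = fls_compose_power c M" for i
  proof (rule fls_root_of_compose_power[OF M])
    fix e assume e: "coeff P i $$ e \<noteq> 0"
    show "int M dvd e"
    proof (rule unity_all_powers[OF M])
      fix \<xi> :: 'a assume \<xi>: "\<xi> \<in> unity M"
      then have nz: "\<xi> \<noteq> 0" using M unity_nonzero by blast
      have "rot \<xi> (coeff P i) = coeff P i"
        using inv[OF \<xi>] nz by (metis coeff_map_poly rot_0)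
      then have "coeff P i $$ e * \<xi> powi e = coeff P i $$ e" by (metis rot_nth[OF nz])
      then show "\<xi> powi e = 1" using e by simp
    qed
  qed
  then obtain c where c: "\<And>i. coeff P i = fls_compose_power (c i) M" by metis
  define g where "g = (\<Sum>i\<le>M. monom (c i) i)"
  have "coeff g i = c i" for i
  proof -
    have "coeff g i = (\<Sum>j\<le>M. if j = i then c i else 0)"
      unfolding g_def coeff_sum by (rule sum.cong) auto
    also have "\<dots> = (if i \<le> M then c i else 0)" by simp
    also have "\<dots> = c i" using c[of i] degP M by (auto simp: coeff_eq_0)
    finally show ?thesis .
  qed
  then have Pg: "P = ramify M g" using c by (intro poly_eqI) (simp add: coeff_ramify)
  have degg: "degree g = M" using degP Pg M by simp
  have lcg: "lead_coeff g = 1"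
    using lcP Pg M by (metis lead_coeff_ramify fls_compose_power_1_left fls_compose_power_inj)
  have "f mod g = 0"
  proof (rule ccontr)
    assume r: "f mod g \<noteq> 0"
    have "ramify M f = P * ramify M (f div g) + ramify M (f mod g)"
      by (metis Pg mult_div_mod_eq ramify_add ramify_mult)
    then have "P dvd ramify M (f mod g)" using Pdvd by (metis dvd_add_right_iff dvd_triv_left)
    then have "M \<le> degree (f mod g)" using r M degP by (metis degree_ramify dvd_imp_degree_le ramify_eq_0_iff)
    then show False using degree_mod_less'[OF _ r] degg M by (metis degree_0 not_le less_numeral_extra(3))
  qed
  then obtain h where h: "f = g * h" by (metis dvdE mod_0_imp_dvd)
  have "\<not> is_unit g" using degg M by (metis is_unit_iff_degree less_numeral_extra(3) degree_0)
  then have "is_unit h" using f h unfolding Rnat_def by (metis irreducibleD mem_Collect_eq)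
  then have "degree h = 0" using f0 h is_unit_iff_degree[of h] by auto
  then obtain c where c: "h = [:c:]" by (rule degree_eq_zeroE)
  have "lead_coeff f = lead_coeff g * lead_coeff h" unfolding h by (rule lead_coeff_mult)
  then have "h = 1" using Rnat_monic[OF f] lcg c by simp
  then have "f = g" using h by simp
  then have "M = n" using degg n by simp
  then show ?thesis using Pg \<open>f = g\<close> G1 P_def by metis
qed

text \<open>
  Made by the same choice as in \<open>supp\<close>, so that its support is \<open>supp f\<close>.
\<close>
definition base_root :: "'a::field fls poly \<Rightarrow> 'a fls" where
  "base_root f = (SOME z. z \<in> newton_roots f)"

lemma supp_eq: "supp f = {e. base_root f $$ e \<noteq> 0}"
  by (simp add: supp_def base_root_def)

context
  fixes f :: "'a::{alg_closed_field, field_char_0} fls poly" and n :: nat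
  assumes f: "f \<in> Rnat" and n: "n = degree f"
begin

lemma base_root:
  "ramify n f = (\<Prod>\<zeta>\<in>unity n. [:- rot \<zeta> (base_root f), 1:])"
  "Gcd (insert (int n) (supp f)) = 1"
proof -
  have npos: "n > 0" using f n Rnat_degree_pos by blast
  have fin: "finite (unity n :: 'a set)" using card_unity npos by blast
  obtain z where z: "ramify n f = (\<Prod>\<zeta>\<in>unity n. [:- rot \<zeta> z, 1:])" "Gcd (insert (int n) {e. z $$ e \<noteq> 0}) = 1"
    using newton_theorem[OF f n] by blast
  have rz: "x \<in> newton_roots f \<longleftrightarrow> (\<exists>\<zeta>\<in>unity n. x = rot \<zeta> z)" for x
    using fin n z(1) by (auto simp: newton_roots_eq rts_def poly_prod)
  then have "rot 1 z \<in> newton_roots f" by (metis one_in_unity)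
  then have "base_root f \<in> newton_roots f" unfolding base_root_def by (rule someI)
  then obtain \<xi> where \<xi>: "\<xi> \<in> unity n" "base_root f = rot \<xi> z" using rz by blast
  have nz: "\<xi> \<noteq> 0" using \<xi> npos unity_nonzero by blast
  show "Gcd (insert (int n) (supp f)) = 1"
    using z(2) nz unfolding supp_eq \<xi>(2) by (simp add: rot_nth)
  have "ramify n f = (\<Prod>\<zeta>\<in>unity n. [:- rot (\<zeta> * \<xi>) z, 1:])"
    unfolding z(1)
    by (rule prod.reindex_bij_witness[of _ "\<lambda>\<zeta>. \<zeta> * \<xi>" "\<lambda>\<zeta>. \<zeta> / \<xi>"])
      (use \<xi> nz in \<open>auto simp: unity_def power_mult_distrib power_divide\<close>)
  then show "ramify n f = (\<Prod>\<zeta>\<in>unity n. [:- rot \<zeta> (base_root f), 1:])"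
    unfolding \<xi>(2) using nz npos by (simp add: rot_rot unity_nonzero cong: prod.cong)
qed

lemma rts_base: "rts n f = (\<lambda>\<zeta>. rot \<zeta> (base_root f)) ` unity n"
proof -
  have "finite (unity n :: 'a set)" using card_unity(1) Rnat_degree_pos[OF f] n by blast
  then show ?thesis by (auto simp: rts_def base_root(1) poly_prod)
qed

lemma inj_rot_base: "inj_on (\<lambda>\<zeta>. rot \<zeta> (base_root f)) (unity n)"
proof (rule Gcd_support_unit_inj)
  show "n > 0" using Rnat_degree_pos[OF f] n by simp
  show "Gcd (insert (int n) {e. base_root f $$ e \<noteq> 0}) = 1" using base_root(2) by (simp only: supp_eq)
qed

end

lemma rts_ramified:
  fixes f :: "'a::{alg_closed_field, field_char_0} fls poly"
  assumes f: "f \<in> Rnat" and N: "N > 0" "degree f dvd N"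
  shows "ramify N f = (\<Prod>z\<in>rts N f. [:-z, 1:])" "finite (rts N f)" "card (rts N f) = degree f"
    "rts N f = (\<lambda>\<zeta>. rot \<zeta> (fls_compose_power (base_root f) (N div degree f))) ` unity N"
proof -
  define n where "n = degree f"
  have npos: "n > 0" using f n_def Rnat_degree_pos by blast
  obtain k where k: "N = n * k" using N(2) n_def by auto
  have kpos: "k > 0" using N(1) k by (auto intro: Nat.gr0I)
  have kd: "N div degree f = k" using k n_def npos by simp
  let ?b = "base_root f" and ?\<phi> = "\<lambda>z::'a fls. fls_compose_power z k"
  have fin: "finite (unity n :: 'a set)" using card_unity npos by blast
  have ram: "ramify N f = (\<Prod>\<zeta>\<in>unity n. [:- ?\<phi> (rot \<zeta> ?b), 1:])"
  proof -
    have "ramify N f = ramify k (\<Prod>\<zeta>\<in>unity n. [:- rot \<zeta> ?b, 1:])"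
      unfolding k by (metis base_root(1)[OF f n_def] kpos npos ramify_ramify)
    also have "\<dots> = (\<Prod>\<zeta>\<in>unity n. [:- ?\<phi> (rot \<zeta> ?b), 1:])"
      using fin by (induction rule: finite_induct)
        (use kpos in \<open>simp_all add: ramify_mult ramify_pCons del: mult_pCons_left\<close>)
    finally show ?thesis .
  qed
  have r: "rts N f = (\<lambda>\<zeta>. ?\<phi> (rot \<zeta> ?b)) ` unity n"
    using fin by (auto simp: rts_def ram poly_prod)
  have inj: "inj_on (\<lambda>\<zeta>. ?\<phi> (rot \<zeta> ?b)) (unity n)"
    using inj_rot_base[OF f n_def] kpos by (simp add: inj_on_def fls_compose_power_inj)
  show "ramify N f = (\<Prod>z\<in>rts N f. [:-z, 1:])"
    unfolding r ram by (simp add: prod.reindex[OF inj])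
  show "finite (rts N f)" "card (rts N f) = degree f"
    unfolding r using fin card_unity(2)[OF npos, where 'a = 'a] by (simp_all add: card_image[OF inj] n_def[symmetric])
  have "unity n = (\<lambda>\<zeta>::'a. \<zeta> ^ k) ` unity N"
  proof (intro equalityI subsetI)
    fix x :: 'a assume x: "x \<in> unity n"
    obtain y where "y ^ k = x" using nth_root_exists[of k x] kpos by auto
    then show "x \<in> (\<lambda>\<zeta>. \<zeta> ^ k) ` unity N" using x unfolding unity_def k
      by (metis (mono_tags, lifting) imageI mem_Collect_eq mult.commute power_mult)
  qed (auto simp: unity_def k power_mult mult.commute)
  then have "rts N f = (\<lambda>\<zeta>. ?\<phi> (rot (\<zeta> ^ k) ?b)) ` unity N" using r by (simp add: image_image)
  also have "\<dots> = (\<lambda>\<zeta>. rot \<zeta> (?\<phi> ?b)) ` unity N"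
    by (rule image_cong) (use N(1) kpos in \<open>auto simp: rot_fls_compose_power unity_nonzero\<close>)
  finally show "rts N f = (\<lambda>\<zeta>. rot \<zeta> (fls_compose_power (base_root f) (N div degree f))) ` unity N"
    unfolding kd .
qed

lemma rts_transitive:
  fixes f :: "'a::{alg_closed_field, field_char_0} fls poly"
  assumes f: "f \<in> Rnat" and N: "N > 0" "degree f dvd N" and z: "z \<in> rts N f" "w \<in> rts N f"
  shows "\<exists>\<zeta>\<in>unity N. w = rot \<zeta> z"
proof -
  obtain a b where ab: "a \<in> unity N" "z = rot a (fls_compose_power (base_root f) (N div degree f))"
     "b \<in> unity N" "w = rot b (fls_compose_power (base_root f) (N div degree f))"
    using z rts_ramified(4)[OF f N] by auto
  then have "w = rot (b / a) z" using N(1) by (simp add: rot_rot unity_nonzero)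
  moreover have "b / a \<in> unity N" using ab by (simp add: unity_def power_divide)
  ultimately show ?thesis by blast
qed

lemma rts_nonempty:
  fixes f :: "'a::{alg_closed_field, field_char_0} fls poly"
  assumes "f \<in> Rnat" "N > 0" "degree f dvd N"
  shows "rts N f \<noteq> {}"
  using rts_ramified(3)[OF assms] Rnat_degree_pos[OF assms(1)] by auto

lemma rts_common_eq:
  fixes f g :: "'a::{alg_closed_field, field_char_0} fls poly"
  assumes "f \<in> Rnat" "g \<in> Rnat" "N > 0" "degree f dvd N" "degree g dvd N" "z \<in> rts N f" "z \<in> rts N g"
  shows "f = g"
proof -
  have orb: "rts N h = (\<lambda>\<zeta>. rot \<zeta> z) ` unity N" if "h \<in> Rnat" "degree h dvd N" "z \<in> rts N h" for h
    using rts_transitive[OF that(1) assms(3) that(2,3)] rts_rot[OF assms(3) _ that(3)] by auto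
  have "rts N f = rts N g" using orb[of f] orb[of g] assms by simp
  then have "ramify N f = ramify N g" using assms by (metis rts_ramified(1))
  then show ?thesis using assms by (simp add: ramify_eq_iff)
qed

lemma rts_compose_power:
  fixes f :: "'a::{alg_closed_field, field_char_0} fls poly"
  assumes "f \<in> Rnat" "N > 0" "degree f dvd N" "c > 0"
  shows "rts (N * c) f = (\<lambda>z. fls_compose_power z c) ` rts N f"
proof -
  have sub: "(\<lambda>z. fls_compose_power z c) ` rts N f \<subseteq> rts (N * c) f"
    using assms by (auto simp: rts_def ramify_ramify[symmetric] poly_ramify)
  have "card ((\<lambda>z. fls_compose_power z c) ` rts N f) = card (rts N f)"
    by (rule card_image) (use assms in \<open>simp add: inj_on_def fls_compose_power_inj\<close>)
  then have "card ((\<lambda>z. fls_compose_power z c) ` rts N f) = card (rts (N * c) f)"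
    using assms by (simp add: rts_ramified(3))
  then show ?thesis using sub assms by (metis card_subset_eq dvd_mult2 mult_pos_pos rts_ramified(2))
qed

section \<open>Contact\<close>

lemma fls_subdegree_compose_power:
  assumes "c > 0"
  shows "fls_subdegree (fls_compose_power z c) = int c * fls_subdegree z"
proof (cases "z = 0")
  case False
  show ?thesis
  proof (rule fls_subdegree_eqI)
    show "fls_compose_power z c $$ (int c * fls_subdegree z) \<noteq> 0"
      using assms False by (simp add: fls_compose_power_nth_mult)
    fix k assume k: "k < int c * fls_subdegree z"
    then show "fls_compose_power z c $$ k = 0"
      using assms by (auto simp: fls_nth_compose_power intro!: fls_eq0_below_subdegree elim!: dvdE)
  qed
qed simp

text \<open>
  The order in \<open>X\<close> of the difference of two series in
  \<open>X\<^bsup>1/N\<^esup>\<close>.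
\<close>
definition root_contact :: "nat \<Rightarrow> 'a::field fls \<Rightarrow> 'a fls \<Rightarrow> rat extended" where
  "root_contact N z w = map_extended (\<lambda>r. r / of_nat N) (ordX_fls (z - w))"

lemma root_contact_scale:
  assumes "c > 0"
  shows "root_contact (N * c) (fls_compose_power z c) (fls_compose_power w c) = root_contact N z w"
proof -
  have "ordX_fls (fls_compose_power (z - w) c) = map_extended (\<lambda>r. of_nat c * r) (ordX_fls (z - w))"
    using assms by (simp add: ordX_fls_def fls_subdegree_compose_power del: fls_compose_power_diff)
  then show ?thesis using assms by (simp add: root_contact_def extended.map_comp o_def)
qed

lemma root_contact_ge_iff:
  assumes "N > 0" "of_int l = (lam::rat) * of_nat N"
  shows "Fin lam \<le> root_contact N z w \<longleftrightarrow> near l z w"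
    and "Fin lam < root_contact N z w \<longleftrightarrow> near (l + 1) z w"
proof -
  have l: "lam = of_int l / of_nat N" using assms by simp
  show "Fin lam \<le> root_contact N z w \<longleftrightarrow> near l z w"
    using assms(1) unfolding l by (auto simp: root_contact_def ordX_fls_def near_iff_subdegree divide_le_cancel)
  show "Fin lam < root_contact N z w \<longleftrightarrow> near (l + 1) z w"
    using assms(1) unfolding l by (auto simp: root_contact_def ordX_fls_def near_iff_subdegree divide_less_cancel)
qed

lemma root_contact_eq_Pinf_iff: "root_contact N z w = Pinf \<longleftrightarrow> z = w"
  by (auto simp: root_contact_def ordX_fls_def)

lemma root_contact_not_Minf [simp]: "root_contact N z w \<noteq> Minf"
  by (auto simp: root_contact_def ordX_fls_def)

definition is_level :: "nat \<Rightarrow> 'a::field fls poly \<Rightarrow> bool" where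
  "is_level N f \<longleftrightarrow> f \<in> Rnat \<and> N > 0 \<and> degree f dvd N"

lemma root_contact_sym: "root_contact N z w = root_contact N w z"
  using fls_uminus_subdegree[of "z - w"] by (auto simp: root_contact_def ordX_fls_def)

lemma image_prod_images:
  "(\<lambda>(z, w). F z w) ` (p ` A \<times> q ` B) = {F (p z) (q w) | z w. z \<in> A \<and> w \<in> B}"
  by auto

lemma contact_image_scale:
  fixes f g :: "'a::{alg_closed_field, field_char_0} fls poly"
  assumes "is_level N f" "is_level N g" "c > 0"
  shows "(\<lambda>(z, w). root_contact (N * c) z w) ` (rts (N * c) f \<times> rts (N * c) g)
    = (\<lambda>(z, w). root_contact N z w) ` (rts N f \<times> rts N g)"
proof -
  let ?p = "\<lambda>z :: 'a fls. fls_compose_power z c"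
  have "(\<lambda>(z, w). root_contact (N * c) z w) ` (rts (N * c) f \<times> rts (N * c) g)
    = {root_contact (N * c) (?p z) (?p w) | z w. z \<in> rts N f \<and> w \<in> rts N g}"
    using assms by (simp only: rts_compose_power is_level_def image_prod_images)
  also have "\<dots> = {root_contact N z w | z w. z \<in> rts N f \<and> w \<in> rts N g}"
    by (simp only: root_contact_scale[OF assms(3)])
  finally show ?thesis by (simp only: image_prod_images[where p = id and q = id, simplified])
qed

text \<open>
  Distances of roots do not change under further ramification, and both the index \<open>n
  n'\<close> of the definition and the index \<open>N\<close> divide \<open>n n' N\<close>.
\<close>
lemma noc_eq_Max:
  fixes f g :: "'a::{alg_closed_field, field_char_0} fls poly"
  assumes f: "is_level N f" and g: "is_level N g"
  shows "noc f g = Max ((\<lambda>(z, w). root_contact N z w) ` (rts N f \<times> rts N g))"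
proof -
  define n n' where "n = degree f" and "n' = degree g"
  have pos: "n > 0" "n' > 0" "N > 0" "f \<in> Rnat" "g \<in> Rnat"
    using f g by (auto simp: n_def n'_def is_level_def Rnat_degree_pos)
  have lv: "is_level (n * n') f" "is_level (n * n') g" using pos by (auto simp: is_level_def n_def n'_def)
  have "noc f g = Max ((\<lambda>(z, w). root_contact (n * n') z w) ` (rts (n * n') f \<times> rts (n' * n) g))"
  proof -
    have "rts (n * n') f = (\<lambda>z. fls_compose_power z n') ` rts n f"
      "rts (n' * n) g = (\<lambda>z. fls_compose_power z n) ` rts n' g"
      using rts_compose_power[OF pos(4) pos(1) _ pos(2)] rts_compose_power[OF pos(5) pos(2) _ pos(1)]
      by (simp_all add: n_def n'_def)
    then have "(\<lambda>(z, w). root_contact (n * n') z w) ` (rts (n * n') f \<times> rts (n' * n) g)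
      = {root_contact (n * n') (fls_compose_power z n') (fls_compose_power w n) | z w. z \<in> rts n f \<and> w \<in> rts n' g}"
      by (simp only: image_prod_images)
    then show ?thesis unfolding noc_def newton_roots_eq by (simp add: root_contact_def n_def n'_def)
  qed
  also have "(\<lambda>(z, w). root_contact (n * n') z w) ` (rts (n * n') f \<times> rts (n' * n) g)
      = (\<lambda>(z, w). root_contact (n * n' * N) z w) ` (rts (n * n' * N) f \<times> rts (n * n' * N) g)"
    using contact_image_scale[OF lv pos(3)] by (simp add: mult.commute)
  also have "\<dots> = (\<lambda>(z, w). root_contact N z w) ` (rts N f \<times> rts N g)"
    using contact_image_scale[OF f g, of "n * n'"] pos by (simp add: mult.commute)
  finally show ?thesis .
qed

context
  fixes f g :: "'a::{alg_closed_field, field_char_0} fls poly" and N :: nat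
  assumes f: "is_level N f" and g: "is_level N g"
begin

private lemma fin: "finite ((\<lambda>(z, w). root_contact N z w) ` (rts N f \<times> rts N g))"
    "(\<lambda>(z, w). root_contact N z w) ` (rts N f \<times> rts N g) \<noteq> {}"
proof -
  have "finite (rts N f)" "finite (rts N g)" "rts N f \<noteq> {}" "rts N g \<noteq> {}"
    using f g by (simp_all add: is_level_def rts_ramified(2) rts_nonempty)
  then show "finite ((\<lambda>(z, w). root_contact N z w) ` (rts N f \<times> rts N g))"
    "(\<lambda>(z, w). root_contact N z w) ` (rts N f \<times> rts N g) \<noteq> {}" by auto
qed

lemma noc_ge_ex: "x \<le> noc f g \<longleftrightarrow> (\<exists>z\<in>rts N f. \<exists>w\<in>rts N g. x \<le> root_contact N z w)"
  unfolding noc_eq_Max[OF f g] Max_ge_iff[OF fin] by auto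

lemma noc_gr_ex: "x < noc f g \<longleftrightarrow> (\<exists>z\<in>rts N f. \<exists>w\<in>rts N g. x < root_contact N z w)"
  unfolding noc_eq_Max[OF f g] Max_gr_iff[OF fin] by auto

lemma near_ex_transfer:
  assumes "z \<in> rts N f" "z' \<in> rts N f" "\<exists>w\<in>rts N g. near l z w"
  shows "\<exists>w\<in>rts N g. near l z' w"
proof -
  obtain w where w: "w \<in> rts N g" "near l z w" using assms by blast
  obtain \<zeta> where z: "\<zeta> \<in> unity N" "z' = rot \<zeta> z"
    using rts_transitive[OF _ _ _ assms(1,2)] f unfolding is_level_def by blast
  have "rot \<zeta> w \<in> rts N g" using rts_rot[OF _ z(1) w(1)] f unfolding is_level_def by blast
  moreover have "near l z' (rot \<zeta> w)" using w z f by (auto simp: near_rot unity_nonzero is_level_def)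
  ultimately show ?thesis by blast
qed

text \<open>
  Rotations act transitively on the roots of \<open>f\<close>, so a single root \<open>z\<close>
  suffices to test the contact.
\<close>
lemma noc_ge_iff:
  assumes l: "of_int l = (lam::rat) * of_nat N" and z: "z \<in> rts N f"
  shows "Fin lam \<le> noc f g \<longleftrightarrow> (\<exists>w\<in>rts N g. near l z w)"
    and "Fin lam < noc f g \<longleftrightarrow> (\<exists>w\<in>rts N g. near (l + 1) z w)"
  using near_ex_transfer z root_contact_ge_iff[OF _ l] f
  unfolding noc_ge_ex noc_gr_ex is_level_def by blast+

lemma noc_eq_Pinf_iff: "noc f g = Pinf \<longleftrightarrow> f = g"
proof -
  have "noc f g = Pinf \<longleftrightarrow> Pinf \<le> noc f g" by simp
  also have "\<dots> \<longleftrightarrow> rts N f \<inter> rts N g \<noteq> {}"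
    unfolding noc_ge_ex Pinf_le root_contact_eq_Pinf_iff by auto
  also have "\<dots> \<longleftrightarrow> f = g"
    using f g rts_common_eq[of f g N] rts_nonempty[of f N] unfolding is_level_def by blast
  finally show ?thesis .
qed

lemma noc_neq_Minf: "noc f g \<noteq> Minf"
proof -
  obtain z w where zw: "z \<in> rts N f" "w \<in> rts N g"
    using f g rts_nonempty unfolding is_level_def by blast
  have "Minf < root_contact N z w" by (cases "root_contact N z w") simp_all
  then have "Minf < noc f g" unfolding noc_gr_ex using zw by blast
  then show ?thesis by auto
qed

end

lemma level_exists:
  fixes S :: "'a::{alg_closed_field, field_char_0} fls poly set"
  assumes "finite S" "S \<subseteq> Rnat"
  obtains N l where "\<And>f. f \<in> S \<Longrightarrow> is_level N f" "N > 0" "of_int l = (lam::rat) * of_nat N"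
proof -
  define b where "b = nat (snd (quotient_of lam))"
  define N where "N = b * (\<Prod>f\<in>S. degree f)"
  have b: "b > 0" "int b = snd (quotient_of lam)" using quotient_of_denom_pos'[of lam] by (auto simp: b_def)
  have "lam = of_int (fst (quotient_of lam)) / of_nat b"
    using quotient_of_div[of lam "fst (quotient_of lam)" "snd (quotient_of lam)"] b(2)
    by (metis of_int_of_nat_eq prod.collapse)
  then have "lam * of_nat N = of_int (fst (quotient_of lam) * int (\<Prod>f\<in>S. degree f))"
    using b(1) by (metis (no_types, lifting) N_def mult.assoc nonzero_eq_divide_eq of_int_mult of_int_of_nat_eq of_nat_0_less_iff of_nat_mult less_irrefl)
  moreover have "N > 0" using b assms by (auto simp: N_def prod_pos Rnat_degree_pos subset_eq)
  moreover have "is_level N f" if "f \<in> S" for f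
    using that assms \<open>N > 0\<close> by (auto simp: is_level_def N_def intro!: dvd_mult dvd_prodI)
  ultimately show ?thesis using that by metis
qed

lemma levels:
  fixes f g h :: "'a::{alg_closed_field, field_char_0} fls poly"
  assumes "f \<in> Rnat" "g \<in> Rnat" "h \<in> Rnat"
  obtains N l where "is_level N f" "is_level N g" "is_level N h" "N > 0" "of_int l = (lam::rat) * of_nat N"
proof -
  have "finite {f, g, h}" "{f, g, h} \<subseteq> Rnat" using assms by auto
  then obtain N l where "\<And>x. x \<in> {f, g, h} \<Longrightarrow> is_level N x" "N > 0" "of_int l = (lam::rat) * of_nat N"
    using level_exists[of "{f, g, h}" lam] by metis
  then show ?thesis by (intro that[of N l]) auto
qed

lemma noc_cases:
  fixes f g :: "'a::{alg_closed_field, field_char_0} fls poly"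
  assumes "f \<in> Rnat" "g \<in> Rnat"
  shows "noc f f = Pinf" "noc f g = Pinf \<longleftrightarrow> f = g" "noc f g \<noteq> Minf"
proof -
  obtain N and l where "is_level N f" "is_level N g" using levels[OF assms assms(1), of 0] by metis
  then show "noc f f = Pinf" "noc f g = Pinf \<longleftrightarrow> f = g" "noc f g \<noteq> Minf"
    using noc_eq_Pinf_iff noc_neq_Minf by blast+
qed

lemma noc_sym:
  fixes f g :: "'a::{alg_closed_field, field_char_0} fls poly"
  assumes "f \<in> Rnat" "g \<in> Rnat"
  shows "noc f g = noc g f"
proof -
  obtain N and l where N: "is_level N f" "is_level N g" using levels[OF assms assms(1), of 0] by metis
  have "x \<le> noc f g \<longleftrightarrow> x \<le> noc g f" for x
    unfolding noc_ge_ex[OF N] noc_ge_ex[OF N(2,1)] using root_contact_sym by metis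
  then show ?thesis by (metis order_antisym order_refl)
qed

lemma noc_ultra:
  fixes f g h :: "'a::{alg_closed_field, field_char_0} fls poly"
  assumes "f \<in> Rnat" "g \<in> Rnat" "h \<in> Rnat"
  shows "min (noc f g) (noc g h) \<le> noc f h"
proof (cases "min (noc f g) (noc g h)")
  case (Fin lam)
  obtain N l where N: "is_level N f" "is_level N g" "is_level N h" "N > 0" "of_int l = (lam::rat) * of_nat N"
    using levels[OF assms] by metis
  obtain z where z: "z \<in> rts N f" using rts_nonempty N unfolding is_level_def by blast
  have *: "Fin lam \<le> noc f g" "Fin lam \<le> noc g h" unfolding Fin[symmetric] by simp_all
  obtain w where w: "w \<in> rts N g" "near l z w" using noc_ge_iff(1)[OF N(1,2,5) z] * by blast
  obtain x where x: "x \<in> rts N h" "near l w x" using noc_ge_iff(1)[OF N(2,3,5) w(1)] * by blast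
  have "near l z x" using w x near_trans by blast
  then have "Fin lam \<le> noc f h" unfolding noc_ge_iff(1)[OF N(1,3,5) z] using x by blast
  then show ?thesis using Fin by simp
next
  case Pinf
  then have "noc f g = Pinf" "noc g h = Pinf" by (auto simp: min_def split: if_splits)
  then have "f = g" "g = h" using noc_cases(2) assms by blast+
  then show ?thesis using noc_cases(1) assms by simp
qed simp

lemma noc_trans:
  fixes f g h :: "'a::{alg_closed_field, field_char_0} fls poly"
  assumes "f \<in> Rnat" "g \<in> Rnat" "h \<in> Rnat"
  shows "x \<le> noc f g \<Longrightarrow> x \<le> noc g h \<Longrightarrow> x \<le> noc f h"
    and "x < noc f g \<Longrightarrow> x < noc g h \<Longrightarrow> x < noc f h"
  using noc_ultra[OF assms] by (meson min.boundedI order_trans, meson min_less_iff_conj less_le_trans)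

lemma noc_isosceles:
  fixes f g h :: "'a::{alg_closed_field, field_char_0} fls poly"
  assumes "f \<in> Rnat" "g \<in> Rnat" "h \<in> Rnat" "noc f g < noc g h"
  shows "noc f h = noc f g"
proof (rule order_antisym)
  show "noc f g \<le> noc f h" using noc_ultra[OF assms(1-3)] min_absorb1[OF less_imp_le[OF assms(4)]] by simp
  show "noc f h \<le> noc f g"
    using noc_ultra[OF assms(1,3,2)] noc_sym[OF assms(2,3)] assms(4) by (auto simp: min_def split: if_splits)
qed

section \<open>The characteristic sequence\<close>

text \<open>
  The number of conjugates of a root that agree with it below \<open>X\<^sup>t\<close>
  (\<open>card_near_base\<close>). The characteristic sequence lists the places where it drops,
  and its values there.
\<close>
definition support_gcd :: "'a::field fls poly \<Rightarrow> int \<Rightarrow> int" where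
  "support_gcd f t = Gcd (insert (int (degree f)) {e \<in> supp f. e < t})"

lemma support_gcd_dvd: "support_gcd f t dvd int (degree f)"
  unfolding support_gcd_def by (rule Gcd_dvd) simp

lemma support_gcd_pos: "f \<in> Rnat \<Longrightarrow> support_gcd f t > 0"
  using support_gcd_dvd[of f t] Rnat_degree_pos[of f]
  by (metis Gcd_int_greater_eq_0 dvd_0_left_iff of_nat_0_less_iff order_less_le support_gcd_def)

lemma less_floor_Suc_iff: "m < \<lfloor>x\<rfloor> + 1 \<longleftrightarrow> of_int m \<le> x"
  unfolding le_floor_iff[symmetric] by auto

lemma near_compose_power:
  assumes "k > 0" "\<And>e. e < t \<longleftrightarrow> int k * e < l"
  shows "near l (fls_compose_power z k) (fls_compose_power w k) \<longleftrightarrow> near t z w"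
proof
  assume a: "near l (fls_compose_power z k) (fls_compose_power w k)"
  show "near t z w" unfolding near_def
  proof (intro allI impI)
    fix e assume "e < t"
    then have "fls_compose_power z k $$ (int k * e) = fls_compose_power w k $$ (int k * e)"
      using a assms(2) unfolding near_def by blast
    then show "z $$ e = w $$ e" using assms(1) by (simp add: fls_compose_power_nth_mult)
  qed
next
  assume a: "near t z w"
  show "near l (fls_compose_power z k) (fls_compose_power w k)" unfolding near_def
    using a assms by (auto simp: near_def fls_nth_compose_power elim!: dvdE)
qed

context
  fixes f :: "'a::{alg_closed_field, field_char_0} fls poly"
  assumes f: "f \<in> Rnat"
begin

lemma near_rot_base_iff:
  assumes "\<zeta> \<in> unity (degree f)"
  shows "near t (rot \<zeta> (base_root f)) (base_root f) \<longleftrightarrow> \<zeta> \<in> unity (nat (support_gcd f t))"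
proof -
  have n: "degree f > 0" using Rnat_degree_pos[OF f] .
  have nz: "\<zeta> \<noteq> 0" using assms n unity_nonzero by blast
  have "near t (rot \<zeta> (base_root f)) (base_root f) \<longleftrightarrow> (\<forall>e\<in>{e \<in> supp f. e < t}. \<zeta> powi e = 1)"
    unfolding near_def supp_eq by (auto simp: rot_nth[OF nz])
  also have "\<dots> \<longleftrightarrow> \<zeta> \<in> unity (nat (support_gcd f t))"
    unfolding support_gcd_def by (rule unity_Gcd[OF n assms])
  finally show ?thesis .
qed

lemma card_near_base: "card {w \<in> rts (degree f) f. near t w (base_root f)} = nat (support_gcd f t)"
proof -
  let ?b = "base_root f" and ?u = "unity (nat (support_gcd f t)) :: 'a set"
  have pos: "nat (support_gcd f t) > 0" using support_gcd_pos[OF f] by simp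
  have "int (nat (support_gcd f t)) dvd int (degree f)" using support_gcd_dvd[of f t] support_gcd_pos[OF f, of t] by simp
  then have sub: "?u \<subseteq> unity (degree f)" by (intro unity_dvd_mono) (simp only: int_dvd_int_iff)
  have "{w \<in> rts (degree f) f. near t w ?b} = (\<lambda>\<zeta>. rot \<zeta> ?b) ` ?u"
    unfolding rts_base[OF f refl] using near_rot_base_iff sub by auto
  moreover have "inj_on (\<lambda>\<zeta>. rot \<zeta> ?b) ?u" using inj_rot_base[OF f refl] sub inj_on_subset by blast
  ultimately show ?thesis using card_unity(2)[OF pos, where 'a = 'a] by (simp add: card_image)
qed

lemma rts_shift_to_base:
  assumes N: "is_level N f" and z: "z \<in> rts N f" and k: "k = N div degree f"
  shows "\<exists>\<xi>\<in>unity N. z = rot \<xi> (fls_compose_power (base_root f) k)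
    \<and> bij_betw (\<lambda>w. rot \<xi> (fls_compose_power w k)) (rts (degree f) f) (rts N f)"
proof -
  define n where "n = degree f"
  have n: "n > 0" "N > 0" "n dvd N" using N Rnat_degree_pos[OF f] by (auto simp: is_level_def n_def)
  have Nk: "N = n * k" "k > 0" using n k n_def by (auto intro: Nat.gr0I)
  obtain \<xi> where \<xi>: "\<xi> \<in> unity N" "z = rot \<xi> (fls_compose_power (base_root f) k)"
    using rts_ramified(4)[OF f n(2)] n(3) z k n_def by auto
  have nz: "\<xi> \<noteq> 0" using \<xi>(1) n unity_nonzero by blast
  have inj: "inj_on (\<lambda>w. rot \<xi> (fls_compose_power w k)) (rts n f)"
    using nz Nk by (simp add: inj_on_def rot_eq_iff fls_compose_power_inj)
  have "(\<lambda>w. rot \<xi> (fls_compose_power w k)) ` rts n f \<subseteq> rts N f"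
  proof clarify
    fix w assume "w \<in> rts n f"
    then have "fls_compose_power w k \<in> rts N f"
      using rts_compose_power[OF f n(1) _ Nk(2)] Nk(1) n_def by simp
    then show "rot \<xi> (fls_compose_power w k) \<in> rts N f" by (rule rts_rot[OF n(2) \<xi>(1)])
  qed
  moreover have "card ((\<lambda>w. rot \<xi> (fls_compose_power w k)) ` rts n f) = card (rts N f)"
    using card_image[OF inj] rts_ramified(3)[OF f n(1)] rts_ramified(3)[OF f n(2)] n(3) n_def by simp
  ultimately have "(\<lambda>w. rot \<xi> (fls_compose_power w k)) ` rts n f = rts N f"
    using rts_ramified(2)[OF f n(2)] n(3) n_def by (metis card_subset_eq)
  then show ?thesis using \<xi> inj n_def by (auto simp: bij_betw_def)
qed

lemma card_near:
  assumes N: "is_level N f" and z: "z \<in> rts N f" and l: "of_int l = (lam::rat) * of_nat N"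
  shows "card {w \<in> rts N f. near l w z} = nat (support_gcd f \<lceil>lam * of_nat (degree f)\<rceil>)"
    and "card {w \<in> rts N f. near (l + 1) w z} = nat (support_gcd f (\<lfloor>lam * of_nat (degree f)\<rfloor> + 1))"
proof -
  define n k where "n = degree f" and "k = N div degree f"
  have n: "n > 0" "N > 0" "n dvd N" using N Rnat_degree_pos[OF f] by (auto simp: is_level_def n_def)
  have Nk: "N = n * k" "k > 0" using n k_def n_def by (auto intro: Nat.gr0I)
  obtain \<xi> where \<xi>: "\<xi> \<in> unity N" "z = rot \<xi> (fls_compose_power (base_root f) k)"
    and bij: "bij_betw (\<lambda>w. rot \<xi> (fls_compose_power w k)) (rts n f) (rts N f)"
    using rts_shift_to_base[OF N z k_def] n_def by blast
  have nz: "\<xi> \<noteq> 0" using \<xi>(1) n unity_nonzero by blast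
  have eq: "of_int l = of_nat k * (lam * of_nat n)" using l Nk by simp
  have cardt: "card {w \<in> rts N f. near l' w z} = nat (support_gcd f t)"
    if t: "\<And>e. e < t \<longleftrightarrow> int k * e < l'" for l' t
  proof -
    have "card {w \<in> rts N f. near l' w z} = card {w \<in> rts n f. near t w (base_root f)}"
    proof (rule sym, rule bij_betw_same_card, rule bij_betw_subset[OF bij])
      have "near l' (rot \<xi> (fls_compose_power w k)) z \<longleftrightarrow> near t w (base_root f)" for w
        unfolding \<xi>(2) near_rot[OF nz] by (rule near_compose_power[OF Nk(2) t])
      then show "(\<lambda>w. rot \<xi> (fls_compose_power w k)) ` {w \<in> rts n f. near t w (base_root f)}
          = {w \<in> rts N f. near l' w z}"
        unfolding bij_betw_imp_surj_on[OF bij, symmetric] by auto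
    qed auto
    then show ?thesis using card_near_base n_def by simp
  qed
  have key: "int k * e < l \<longleftrightarrow> of_int e < lam * of_nat n" "int k * e \<le> l \<longleftrightarrow> of_int e \<le> lam * of_nat n" for e
  proof -
    have "int k * e < l \<longleftrightarrow> (of_int (int k * e) :: rat) < of_int l" by (simp only: of_int_less_iff)
    then show "int k * e < l \<longleftrightarrow> of_int e < lam * of_nat n" unfolding eq using Nk by simp
    have "int k * e \<le> l \<longleftrightarrow> (of_int (int k * e) :: rat) \<le> of_int l" by (simp only: of_int_le_iff)
    then show "int k * e \<le> l \<longleftrightarrow> of_int e \<le> lam * of_nat n" unfolding eq using Nk by simp
  qed
  show "card {w \<in> rts N f. near l w z} = nat (support_gcd f \<lceil>lam * of_nat (degree f)\<rceil>)"
    by (rule cardt) (simp add: key less_ceiling_iff n_def)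
  show "card {w \<in> rts N f. near (l + 1) w z} = nat (support_gcd f (\<lfloor>lam * of_nat (degree f)\<rfloor> + 1))"
  proof (rule cardt)
    fix e show "e < \<lfloor>lam * of_nat (degree f)\<rfloor> + 1 \<longleftrightarrow> int k * e < l + 1"
      unfolding less_floor_Suc_iff using key(2)[of e] n_def by auto
  qed
qed

end

lemma downclosed_interval:
  assumes "\<And>i j. 1 \<le> i \<Longrightarrow> i \<le> j \<Longrightarrow> j \<le> h \<Longrightarrow> P j \<Longrightarrow> P i"
  shows "{i \<in> {1..h}. P i} = {1..card {i \<in> {1..(h::nat)}. P i}}"
  using assms
proof (induction h)
  case (Suc h)
  show ?case
  proof (cases "P (Suc h)")
    case True
    have "P i" if "1 \<le> i" "i \<le> Suc h" for i using Suc.prems[OF that order_refl True] .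
    then have "{i \<in> {1..Suc h}. P i} = {1..Suc h}" by auto
    then show ?thesis by simp
  next
    case False
    then have "{i \<in> {1..Suc h}. P i} = {i \<in> {1..h}. P i}" by (auto simp: le_Suc_eq)
    then show ?thesis using Suc.IH Suc.prems by (metis (mono_tags, lifting) le_Suc_eq)
  qed
qed simp

lemma int_Least:
  fixes P :: "int \<Rightarrow> bool"
  assumes "P x" "\<And>y. P y \<Longrightarrow> B \<le> y"
  shows "P (Least P)" "P y \<Longrightarrow> Least P \<le> y"
proof -
  obtain y0 where y0: "P y0" "\<And>y. P y \<Longrightarrow> nat (y0 - B) \<le> nat (y - B)"
    using ex_has_least_nat[of P x "\<lambda>y. nat (y - B)"] assms(1) by blast
  have min: "y0 \<le> y" if "P y" for y using y0(2)[OF that] assms(2)[OF that] assms(2)[OF y0(1)] by linarith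
  have "Least P = y0" by (rule Least_equality) (use y0 min in auto)
  then show "P (Least P)" "P y \<Longrightarrow> Least P \<le> y" using y0 min by auto
qed

text \<open>
  The sequence \<open>d\<close> with its index shifted by one: \<open>char_e f i\<close> is the
  greatest common divisor of \<open>n, m\<^sub>1, \<dots>, m\<^sub>i\<close>.
\<close>
definition char_e :: "'a::field fls poly \<Rightarrow> nat \<Rightarrow> int" where
  "char_e f i = char_d f (i + 1)"

lemma char_e_0 [simp]: "char_e f 0 = int (degree f)"
  by (simp add: char_e_def char_d_def)

lemma char_e_Suc: "char_e f (Suc i) = gcd (char_e f i) (char_m f (Suc i))"
  by (simp add: char_e_def char_d_def char_m_def Let_def)

lemma char_m_Suc: "char_m f (Suc i) = (LEAST e. e \<in> supp f \<and> (i = 0 \<or> \<not> char_e f i dvd e))"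
  by (simp add: char_e_def char_d_def char_m_def Let_def)

lemma char_e_dvd: "i \<le> j \<Longrightarrow> char_e f j dvd char_e f i"
  by (induction j rule: dec_induct) (auto simp: char_e_Suc intro: dvd_trans)

lemma char_e_dvd_m: "1 \<le> i \<Longrightarrow> i \<le> j \<Longrightarrow> char_e f j dvd char_m f i"
  using char_e_dvd[of i j f] char_e_Suc[of f "i - 1"] by (auto intro: dvd_trans)

lemma char_e_greatest:
  "x dvd int (degree f) \<Longrightarrow> (\<And>j. 1 \<le> j \<Longrightarrow> j \<le> i \<Longrightarrow> x dvd char_m f j) \<Longrightarrow> x dvd char_e f i"
  by (induction i) (auto simp: char_e_Suc)

context
  fixes f :: "'a::{alg_closed_field, field_char_0} fls poly"
  assumes f: "f \<in> Rnat"
begin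

lemma char_e_pos: "char_e f i > 0"
proof (induction i)
  case 0
  show ?case using Rnat_degree_pos[OF f] by simp
next
  case (Suc i)
  then have "gcd (char_e f i) (char_m f (Suc i)) \<noteq> 0" by auto
  then show ?case unfolding char_e_Suc by (metis gcd_ge_0_int order_less_le)
qed

lemma supp_empty_imp:
  assumes "supp f = {}"
  shows "f = [:0, 1:]"
proof -
  have b0: "base_root f = 0" using assms unfolding supp_eq by (auto simp: fls_eq_iff)
  have n: "degree f > 0" using Rnat_degree_pos[OF f] .
  have "Gcd (insert (int (degree f)) {}) = 1" using base_root(2)[OF f refl] assms by simp
  then have n1: "degree f = 1" by simp
  have "unity 1 = {1::'a}" by (auto simp: unity_def)
  then have "ramify 1 f = [:0, 1:]" using base_root(1)[OF f refl] b0 n1 by simp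
  then show ?thesis by simp
qed

lemma supp_bounded: "e \<in> supp f \<Longrightarrow> fls_subdegree (base_root f) \<le> e"
  by (rule ccontr) (auto simp: supp_eq)

text \<open>
  For \<open>i > 0\<close> the minimum is taken over a nonempty set because \<open>n\<close> and
  the exponents of a root have no common divisor, for \<open>i = 0\<close> because only
  \<open>Y\<close> has the root zero.
\<close>
lemma char_m_Least:
  assumes "f \<noteq> [:0, 1:]" "i = 0 \<or> char_e f i \<noteq> 1"
  shows "char_m f (Suc i) \<in> supp f" "i = 0 \<or> \<not> char_e f i dvd char_m f (Suc i)"
    and "e \<in> supp f \<Longrightarrow> i = 0 \<or> \<not> char_e f i dvd e \<Longrightarrow> char_m f (Suc i) \<le> e"
proof -
  let ?P = "\<lambda>e. e \<in> supp f \<and> (i = 0 \<or> \<not> char_e f i dvd e)"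
  have "\<exists>e. ?P e"
  proof (rule ccontr)
    assume no: "\<nexists>e. ?P e"
    then have "i \<noteq> 0" using supp_empty_imp assms(1) by auto
    have "char_e f i dvd Gcd (insert (int (degree f)) (supp f))"
      using no \<open>i \<noteq> 0\<close> char_e_dvd[of 0 i f] by (auto simp: dvd_Gcd_iff)
    then have "char_e f i dvd 1" by (simp only: base_root(2)[OF f refl])
    then have "char_e f i = 1" using char_e_pos[of i] by simp
    then show False using assms(2) \<open>i \<noteq> 0\<close> by simp
  qed
  then obtain x where x: "?P x" by blast
  have B: "?P y \<Longrightarrow> fls_subdegree (base_root f) \<le> y" for y using supp_bounded by blast
  have "?P (Least ?P)" by (rule int_Least(1)[of ?P, OF x B])
  then show "char_m f (Suc i) \<in> supp f" "i = 0 \<or> \<not> char_e f i dvd char_m f (Suc i)"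
    unfolding char_m_Suc by auto
  show "char_m f (Suc i) \<le> e" if "e \<in> supp f" "i = 0 \<or> \<not> char_e f i dvd e"
    unfolding char_m_Suc using that by (intro int_Least(2)[of ?P, OF x B]) auto
qed

lemma char_h_exists:
  assumes "f \<noteq> [:0, 1:]"
  shows "\<exists>i\<ge>1. char_e f i = 1"
proof (rule ccontr)
  assume no: "\<not> (\<exists>i\<ge>1. char_e f i = 1)"
  have dec: "char_e f (Suc i) < char_e f i" if "i \<ge> 1" for i
  proof -
    have "\<not> char_e f i dvd char_m f (Suc i)" using char_m_Least(2)[OF assms, of i] no that by auto
    then have "char_e f (Suc i) \<noteq> char_e f i" by (metis char_e_Suc gcd_dvd2)
    moreover have "char_e f (Suc i) \<le> char_e f i"
      using char_e_pos[of i] char_e_dvd[of i "Suc i" f] by (simp add: zdvd_imp_le)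
    ultimately show ?thesis by simp
  qed
  have "char_e f (Suc i) + int i \<le> char_e f 1" for i
  proof (induction i)
    case (Suc i)
    then show ?case using dec[of "Suc i"] by simp
  qed simp
  from this[of "nat (char_e f 1)"] show False using char_e_pos[of "Suc (nat (char_e f 1))"] char_e_pos[of 1] by simp
qed

lemma char_e_h: "char_e f (char_h f) = 1"
proof (cases "f = [:0, 1:]")
  case True
  then show ?thesis by (simp add: char_h_def)
next
  case False
  have "char_e f (LEAST i. 1 \<le> i \<and> char_e f i = 1) = 1"
    using LeastI_ex[of "\<lambda>i. 1 \<le> i \<and> char_e f i = 1"] char_h_exists[OF False] by blast
  then show ?thesis using False by (simp add: char_h_def char_e_def)
qed

lemma below_h:
  assumes "i < char_h f"
  shows "f \<noteq> [:0, 1:]" "i = 0 \<or> char_e f i \<noteq> 1"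
proof -
  show "f \<noteq> [:0, 1:]" using assms by (auto simp: char_h_def)
  then show "i = 0 \<or> char_e f i \<noteq> 1"
    using assms not_less_Least[of i "\<lambda>i. 1 \<le> i \<and> char_d f (i + 1) = 1"]
    by (auto simp: char_h_def char_e_def)
qed

lemma char_m_below_h:
  assumes "i < char_h f"
  shows "char_m f (Suc i) \<in> supp f" "i = 0 \<or> \<not> char_e f i dvd char_m f (Suc i)"
    and "e \<in> supp f \<Longrightarrow> i = 0 \<or> \<not> char_e f i dvd e \<Longrightarrow> char_m f (Suc i) \<le> e"
  using char_m_Least[OF below_h[OF assms]] by blast+

lemma char_m_increasing:
  assumes "Suc i < char_h f" shows "char_m f (Suc i) < char_m f (Suc (Suc i))"
proof -
  have i: "i < char_h f" using assms by simp
  have nd: "\<not> char_e f (Suc i) dvd char_m f (Suc (Suc i))"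
    using char_m_below_h(2)[OF assms] by simp
  have "\<not> char_e f i dvd char_m f (Suc (Suc i))"
    using nd char_e_dvd[of i "Suc i" f] by (meson dvd_trans le_SucI order_refl)
  then have "char_m f (Suc i) \<le> char_m f (Suc (Suc i))"
    using char_m_below_h(3)[OF i char_m_below_h(1)[OF assms]] by blast
  moreover have "char_m f (Suc i) \<noteq> char_m f (Suc (Suc i))"
    using nd char_e_dvd_m[of "Suc i" "Suc i" f] by auto
  ultimately show ?thesis by simp
qed

lemma char_m_mono: "i \<le> j \<Longrightarrow> 1 \<le> i \<Longrightarrow> j \<le> char_h f \<Longrightarrow> char_m f i \<le> char_m f j"
proof (induction j rule: dec_induct)
  case (step k)
  then show ?case using char_m_increasing[of "k - 1"] by (cases k) auto
qed simp

text \<open>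
  Exponents of the support below \<open>m\<^sub>i\<^sub>+\<^sub>1\<close> are multiples of
  \<open>d\<^sub>i\<^sub>+\<^sub>1\<close>, so between \<open>m\<^sub>i\<close> and
  \<open>m\<^sub>i\<^sub>+\<^sub>1\<close> nothing changes.
\<close>
lemma char_e_eq_support_gcd:
  assumes "i \<le> char_h f" "i = 0 \<or> char_m f i < t" "i < char_h f \<Longrightarrow> t \<le> char_m f (Suc i)"
  shows "char_e f i = support_gcd f t"
proof (rule zdvd_antisym_nonneg)
  show "char_e f i \<ge> 0" "support_gcd f t \<ge> 0"
    using char_e_pos[of i] support_gcd_pos[OF f, of t] by simp_all
  show "support_gcd f t dvd char_e f i"
  proof (rule char_e_greatest[OF support_gcd_dvd])
    fix j assume j: "1 \<le> j" "j \<le> i"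
    then obtain j' where j': "j = Suc j'" by (cases j) auto
    have "char_m f j \<in> supp f" unfolding j' using j j' assms(1) by (intro char_m_below_h(1)) auto
    moreover have "char_m f j < t" using char_m_mono[of j i] j assms by auto
    ultimately show "support_gcd f t dvd char_m f j" unfolding support_gcd_def by (intro Gcd_dvd) auto
  qed
  have "char_e f i dvd e" if e: "e \<in> supp f" "e < t" for e
  proof (cases "i = char_h f")
    case True
    then show ?thesis using char_e_h by simp
  next
    case False
    then have i: "i < char_h f" using assms(1) by simp
    then have "\<not> char_m f (Suc i) \<le> e" using assms(3) e by auto
    then show ?thesis using char_m_below_h(3)[OF i e(1)] by auto
  qed
  then show "char_e f i dvd support_gcd f t"
    using char_e_dvd[of 0 i f] by (auto simp: support_gcd_def dvd_Gcd_iff)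
qed

lemma char_threshold:
  assumes p: "p = card {i \<in> {1..char_h f}. char_m f i < t}"
  shows "p \<le> char_h f" "p = 0 \<or> char_m f p < t" "p < char_h f \<Longrightarrow> t \<le> char_m f (Suc p)" "char_e f p = support_gcd f t"
proof -
  have eq: "{i \<in> {1..char_h f}. char_m f i < t} = {1..p}"
    unfolding p by (rule downclosed_interval) (use char_m_mono in fastforce)
  have "card {1..p} \<le> card {1..char_h f}" unfolding eq[symmetric] by (rule card_mono) auto
  then show 1: "p \<le> char_h f" by simp
  have "p \<in> {1..p} \<or> p = 0" by auto
  then show 2: "p = 0 \<or> char_m f p < t" unfolding eq[symmetric] by auto
  have "Suc p \<notin> {1..p}" by simp
  then show 3: "p < char_h f \<Longrightarrow> t \<le> char_m f (Suc p)" unfolding eq[symmetric] by auto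
  show "char_e f p = support_gcd f t" by (rule char_e_eq_support_gcd[OF 1 2 3])
qed

lemma char_p_eq: "char_p f lam = card {i \<in> {1..char_h f}. char_m f i < \<lceil>lam * of_nat (degree f)\<rceil>}"
  using Rnat_degree_pos[OF f] by (simp add: char_p_def char_c_def less_ceiling_iff field_simps)

lemma char_p_star_eq: "char_p_star f lam = card {i \<in> {1..char_h f}. char_m f i < \<lfloor>lam * of_nat (degree f)\<rfloor> + 1}"
  using Rnat_degree_pos[OF f] unfolding less_floor_Suc_iff by (simp add: char_p_star_def char_c_def field_simps)

lemma Dval_eq: "Dval f lam = of_nat (degree f) / of_int (support_gcd f \<lceil>lam * of_nat (degree f)\<rceil>)"
  using char_threshold(4)[OF char_p_eq[of lam]] by (simp add: Dval_def char_e_def)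

lemma Dval_star_eq: "Dval_star f lam = of_nat (degree f) / of_int (support_gcd f (\<lfloor>lam * of_nat (degree f)\<rfloor> + 1))"
  using char_threshold(4)[OF char_p_star_eq[of lam]] by (simp add: Dval_star_def char_e_def)

lemma Dval_count:
  assumes "is_level N f" "z \<in> rts N f" "of_int l = (lam::rat) * of_nat N"
  shows "Dval f lam * of_nat (card {w \<in> rts N f. near l w z}) = of_nat (degree f)"
    and "Dval_star f lam * of_nat (card {w \<in> rts N f. near (l + 1) w z}) = of_nat (degree f)"
proof -
  have "of_nat (nat (support_gcd f t)) = (of_int (support_gcd f t) :: rat)" "of_int (support_gcd f t) \<noteq> (0::rat)" for t
    using support_gcd_pos[OF f, of t] by simp_all
  then show "Dval f lam * of_nat (card {w \<in> rts N f. near l w z}) = of_nat (degree f)"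
    "Dval_star f lam * of_nat (card {w \<in> rts N f. near (l + 1) w z}) = of_nat (degree f)"
    unfolding card_near[OF f assms] Dval_eq Dval_star_eq by simp_all
qed

text \<open>
  All exponents below \<open>m = char_m f (p + 1)\<close> are multiples of \<open>char_e f
  p\<close> and so are killed by \<open>\<zeta>\<close>, but \<open>m\<close> is not.
\<close>
lemma subdegree_on_layer:
  assumes p: "p < char_h f" and z: "\<zeta> \<in> unity (nat (char_e f p))" "\<zeta> \<notin> unity (nat (char_e f (Suc p)))"
  shows "fls_subdegree (rot \<zeta> (base_root f) - base_root f) = char_m f (Suc p)"
proof (rule fls_subdegree_eqI)
  let ?m = "char_m f (Suc p)"
  have pos: "nat (char_e f p) > 0" using char_e_pos[of p] by simp
  have nz: "\<zeta> \<noteq> 0" using unity_nonzero[OF pos z(1)] .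
  have "int (nat (char_e f p)) dvd int (degree f)" using char_e_dvd[of 0 p f] char_e_pos[of p] by simp
  then have zn: "\<zeta> \<in> unity (degree f)" using z(1) unity_dvd_mono[of "nat (char_e f p)" "degree f"] unfolding int_dvd_int_iff by blast
  have "\<zeta> powi ?m \<noteq> 1"
    using unity_Gcd[OF pos z(1), of "{?m}"] z(2) char_e_pos[of p] by (simp add: char_e_Suc)
  moreover have "base_root f $$ ?m \<noteq> 0" using char_m_below_h(1)[OF p] by (simp add: supp_eq)
  ultimately show "(rot \<zeta> (base_root f) - base_root f) $$ ?m \<noteq> 0" by (simp add: rot_nth[OF nz])
  have "char_e f p = support_gcd f ?m"
  proof (rule char_e_eq_support_gcd)
    show "p = 0 \<or> char_m f p < ?m" using char_m_increasing[of "p - 1"] p by (cases p) auto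
  qed (use p in auto)
  then have "near ?m (rot \<zeta> (base_root f)) (base_root f)" using near_rot_base_iff[OF f zn] z(1) by simp
  then show "(rot \<zeta> (base_root f) - base_root f) $$ k = 0" if "k < ?m" for k
    using that by (simp add: near_def)
qed

text \<open>
  The sum of the distances of a root from those conjugates that differ from it at one of the first
  \<open>p\<close> characteristic exponents (\<open>sum_subdegree_layers\<close>).
\<close>
definition char_W :: "nat \<Rightarrow> int" where
  "char_W p = (\<Sum>i<p. (char_e f i - char_e f (Suc i)) * char_m f (Suc i))"

lemma sum_subdegree_layers:
  "p \<le> char_h f \<Longrightarrow>
    (\<Sum>\<zeta>\<in>unity (degree f) - unity (nat (char_e f p)). fls_subdegree (rot \<zeta> (base_root f) - base_root f)) = char_W p"
proof (induction p)
  case (Suc p)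
  let ?u = "\<lambda>i. unity (nat (char_e f i)) :: 'a set" and ?s = "\<lambda>\<zeta>. fls_subdegree (rot \<zeta> (base_root f) - base_root f)"
  have p: "p < char_h f" using Suc.prems by simp
  have un: "unity (degree f) = ?u 0" by simp
  have fin: "finite (?u i)" for i using card_unity(1) char_e_pos[of i] by (metis zero_less_nat_eq)
  have sub: "?u j \<subseteq> ?u i" if "i \<le> j" for i j
  proof (rule unity_dvd_mono)
    have "int (nat (char_e f j)) dvd int (nat (char_e f i))"
      using char_e_dvd[OF that, of f] char_e_pos[of i] char_e_pos[of j] by simp
    then show "nat (char_e f j) dvd nat (char_e f i)" by (simp only: int_dvd_int_iff)
  qed
  have "unity (degree f) - ?u (Suc p) = (unity (degree f) - ?u p) \<union> (?u p - ?u (Suc p))"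
    using sub[of p "Suc p", OF le_SucI[OF order_refl]] sub[of 0 p, OF le0] unfolding un by blast
  moreover have "sum ?s ((unity (degree f) - ?u p) \<union> (?u p - ?u (Suc p)))
     = sum ?s (unity (degree f) - ?u p) + sum ?s (?u p - ?u (Suc p))"
    by (rule sum.union_disjoint) (use fin[of 0] fin[of p] in auto)
  moreover have "sum ?s (?u p - ?u (Suc p)) = (\<Sum>\<zeta>\<in>?u p - ?u (Suc p). char_m f (Suc p))"
    by (rule sum.cong) (use subdegree_on_layer[OF p] in auto)
  moreover have "int (card (?u p - ?u (Suc p))) = char_e f p - char_e f (Suc p)"
  proof -
    have c: "card (?u i) = nat (char_e f i)" for i using card_unity(2) char_e_pos[of i] by (metis zero_less_nat_eq)
    have "card (?u (Suc p)) \<le> card (?u p)" using sub[of p "Suc p"] fin by (intro card_mono) auto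
    then show ?thesis using char_e_pos[of p] char_e_pos[of "Suc p"] sub[of p "Suc p"] fin
      by (simp add: card_Diff_subset c)
  qed
  ultimately show ?case using Suc.IH p by (simp add: char_W_def)
qed (simp add: char_W_def)

text \<open>
  Summation by parts.
\<close>
lemma char_s_eq: "p \<ge> 1 \<Longrightarrow> char_s f p = char_W p + char_m f p * char_e f p"
proof (induction p rule: dec_induct)
  case base
  show ?case by (simp add: char_s_def char_W_def char_q_def char_e_def algebra_simps)
next
  case (step p)
  have "char_s f (Suc p) = char_s f p + char_q f (Suc p) * char_e f p"
    by (simp add: char_s_def char_e_def)
  then show ?case using step by (simp add: char_q_def char_W_def algebra_simps)
qed

text \<open>
  The minimum of \<open>t\<close> and \<open>ord (z - w)\<close>, with the value \<open>t\<close>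
  for \<open>z = w\<close>.
\<close>
definition contact_trunc :: "rat \<Rightarrow> 'a fls \<Rightarrow> 'a fls \<Rightarrow> rat" where
  "contact_trunc t z w = (if near \<lceil>t\<rceil> z w then t else of_int (fls_subdegree (z - w)))"

text \<open>
  Let \<open>p = char_p f \<lambda>\<close>. The conjugates that part from the root before
  \<open>n\<lambda>\<close> contribute \<open>char_W p\<close>, the other \<open>char_e f
  p\<close> ones contribute \<open>n\<lambda>\<close> each.
\<close>
lemma sum_trunc_base:
  "(\<Sum>w\<in>rts (degree f) f. contact_trunc (lam * of_nat (degree f)) w (base_root f)) = (of_nat (degree f))\<^sup>2 * Sval f lam"
proof -
  define n p t where "n = degree f" and "p = char_p f lam" and "t = \<lceil>lam * of_nat n\<rceil>"
  let ?b = "base_root f" and ?u = "unity (nat (char_e f p)) :: 'a set"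
  have n: "n > 0" using Rnat_degree_pos[OF f] n_def by simp
  note th = char_threshold[OF char_p_eq, of lam, folded p_def n_def, folded t_def]
  have epos: "char_e f p > 0" by (rule char_e_pos)
  have "int (nat (char_e f p)) dvd int n" using char_e_dvd[of 0 p f] epos n_def by simp
  then have sub: "?u \<subseteq> unity n" by (intro unity_dvd_mono) (simp only: int_dvd_int_iff)
  have fin: "finite (unity n :: 'a set)" using card_unity(1)[OF n] .
  have near: "near t (rot \<zeta> ?b) ?b \<longleftrightarrow> \<zeta> \<in> ?u" if "\<zeta> \<in> unity n" for \<zeta>
    using near_rot_base_iff[OF f, of \<zeta> t] that th(4) n_def by simp
  have "(\<Sum>w\<in>rts n f. contact_trunc (lam * of_nat n) w ?b) = (\<Sum>\<zeta>\<in>unity n. contact_trunc (lam * of_nat n) (rot \<zeta> ?b) ?b)"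
    unfolding rts_base[OF f n_def] by (simp add: sum.reindex[OF inj_rot_base[OF f n_def]])
  also have "\<dots> = (\<Sum>\<zeta>\<in>?u. contact_trunc (lam * of_nat n) (rot \<zeta> ?b) ?b)
      + (\<Sum>\<zeta>\<in>unity n - ?u. contact_trunc (lam * of_nat n) (rot \<zeta> ?b) ?b)"
    using sum.subset_diff[OF sub fin] by (simp add: add.commute)
  also have "(\<Sum>\<zeta>\<in>?u. contact_trunc (lam * of_nat n) (rot \<zeta> ?b) ?b) = (\<Sum>\<zeta>\<in>?u. lam * of_nat n)"
    by (rule sum.cong) (use near sub in \<open>auto simp: contact_trunc_def t_def\<close>)
  also have "\<dots> = of_int (char_e f p) * (lam * of_nat n)"
    using card_unity(2)[of "nat (char_e f p)", where 'a = 'a] epos by simp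
  also have "(\<Sum>\<zeta>\<in>unity n - ?u. contact_trunc (lam * of_nat n) (rot \<zeta> ?b) ?b)
      = (\<Sum>\<zeta>\<in>unity n - ?u. of_int (fls_subdegree (rot \<zeta> ?b - ?b)))"
    by (rule sum.cong) (use near in \<open>auto simp: contact_trunc_def t_def\<close>)
  also have "\<dots> = of_int (char_W p)"
    using sum_subdegree_layers[OF th(1)] n_def by (simp flip: of_int_sum)
  also have "of_int (char_e f p) * (lam * of_nat n) + of_int (char_W p) = (of_nat n)\<^sup>2 * Sval f lam"
  proof (cases "p = 0")
    case True
    then show ?thesis by (simp add: Sval_def char_W_def p_def[symmetric] n_def power2_eq_square)
  next
    case False
    then have "char_s f p = char_W p + char_m f p * char_e f p"
      using char_s_eq[of p] by (simp add: algebra_simps)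
    then show ?thesis using False n
      by (simp add: Sval_def p_def[symmetric] n_def[symmetric] char_e_def[symmetric, simplified] Let_def field_simps)
  qed
  finally show ?thesis unfolding n_def .
qed

lemma sum_trunc:
  assumes N: "is_level N f" and z: "z \<in> rts N f" and l: "of_int l = lam * of_nat N"
  shows "(\<Sum>w\<in>rts N f. contact_trunc (of_int l) w z) = of_nat N * of_nat (degree f) * Sval f lam"
proof -
  define n k where "n = degree f" and "k = N div degree f"
  have n: "n > 0" "N > 0" "n dvd N" using N Rnat_degree_pos[OF f] by (auto simp: is_level_def n_def)
  have Nk: "N = n * k" "k > 0" using n k_def n_def by (auto intro: Nat.gr0I)
  obtain \<xi> where \<xi>: "\<xi> \<in> unity N" "z = rot \<xi> (fls_compose_power (base_root f) k)"
    and bij: "bij_betw (\<lambda>w. rot \<xi> (fls_compose_power w k)) (rts n f) (rts N f)"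
    using rts_shift_to_base[OF f N z k_def] n_def by blast
  have nz: "\<xi> \<noteq> 0" using \<xi>(1) n unity_nonzero by blast
  have eq: "of_int l = of_nat k * (lam * of_nat n)" using l Nk by simp
  have key: "e < \<lceil>lam * of_nat n\<rceil> \<longleftrightarrow> int k * e < l" for e
  proof -
    have "int k * e < l \<longleftrightarrow> (of_int (int k * e) :: rat) < of_int l" by (simp only: of_int_less_iff)
    then show ?thesis unfolding eq less_ceiling_iff using Nk by simp
  qed
  have sd: "fls_subdegree (rot \<xi> x) = fls_subdegree x" for x
  proof (cases "x = 0")
    case False
    then show ?thesis by (intro fls_subdegree_eqI) (auto simp: rot_nth[OF nz] nz)
  qed (simp add: nz)
  have "contact_trunc (of_int l) (rot \<xi> (fls_compose_power w k)) z
      = of_nat k * contact_trunc (lam * of_nat n) w (base_root f)" for w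
  proof -
    have "near l (rot \<xi> (fls_compose_power w k)) z \<longleftrightarrow> near \<lceil>lam * of_nat n\<rceil> w (base_root f)"
      unfolding \<xi>(2) near_rot[OF nz] by (rule near_compose_power[OF Nk(2) key])
    moreover have "fls_subdegree (rot \<xi> (fls_compose_power w k) - z) = int k * fls_subdegree (w - base_root f)"
      unfolding \<xi>(2) rot_diff[OF nz, symmetric] sd fls_compose_power_diff[symmetric]
      by (rule fls_subdegree_compose_power[OF Nk(2)])
    ultimately show ?thesis unfolding contact_trunc_def ceiling_of_int using eq by simp
  qed
  then have "(\<Sum>w\<in>rts N f. contact_trunc (of_int l) w z)
     = of_nat k * (\<Sum>w\<in>rts n f. contact_trunc (lam * of_nat n) w (base_root f))"
    by (simp add: sum.reindex_bij_betw[OF bij, symmetric] sum_distrib_left)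
  then show ?thesis using sum_trunc_base[of lam] Nk n_def by (simp add: power2_eq_square)
qed

text \<open>
  The number \<open>Sval f \<lambda>\<close> measures the order of \<open>f\<close> at a series
  whose contact with \<open>f\<close> is \<open>\<lambda>\<close>: if \<open>w1\<close> is a root
  nearest to \<open>x\<close>, then by the ultrametric inequality \<open>ord (x - w)\<close> is
  the minimum of \<open>l\<close> and \<open>ord (w - w1)\<close>.
\<close>
lemma sum_subdegree_far:
  assumes N: "is_level N f" and l: "of_int l = lam * of_nat N"
    and w1: "w1 \<in> rts N f" "near l x w1" and far: "\<And>w. w \<in> rts N f \<Longrightarrow> \<not> near (l + 1) x w"
  shows "(\<Sum>w\<in>rts N f. of_int (fls_subdegree (x - w))) = of_nat N * of_nat (degree f) * Sval f lam"
proof -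
  have "of_int (fls_subdegree (x - w)) = contact_trunc (of_int l) w w1" if w: "w \<in> rts N f" for w
  proof (cases "near l w w1")
    case True
    then have "near l x w" using w1(2) near_trans near_sym by blast
    then have "fls_subdegree (x - w) = l"
      using far[OF w] by (auto simp: near_iff_subdegree)
    then show ?thesis using True by (simp add: contact_trunc_def)
  next
    case False
    have "fls_subdegree (x - w) = fls_subdegree (w - w1)"
    proof -
      define v where "v = w - w1"
      have d: "v \<noteq> 0" "fls_subdegree v < l" using not_near_subdegree[OF False] by (auto simp: v_def)
      have e: "(x - w) $$ e = - (v $$ e)" if "e < l" for e using w1(2) that by (simp add: near_def v_def)
      have "fls_subdegree (x - w) = fls_subdegree v"
      proof (rule fls_subdegree_eqI)
        show "(x - w) $$ fls_subdegree v \<noteq> 0" unfolding e[OF d(2)] using d(1) by simp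
        show "(x - w) $$ k = 0" if "k < fls_subdegree v" for k
          using e[of k] that d(2) by simp
      qed
      then show ?thesis by (simp add: v_def)
    qed
    then show ?thesis using False by (simp add: contact_trunc_def)
  qed
  then show ?thesis using sum_trunc[OF N w1(1) l] by simp
qed

end

section \<open>Factorization into monic irreducible polynomials\<close>

lemma Rnat_prime: "f \<in> Rnat \<Longrightarrow> prime_elem f"
  unfolding Rnat_def using field_poly_irreducible_imp_prime by blast

lemma prime_elem_dvd_prod_mset: "prime_elem (p::'a::algebraic_semidom) \<Longrightarrow> p dvd prod_mset M \<Longrightarrow> \<exists>g\<in>#M. p dvd g"
  using prime_elem_dvd_prod_msetE[of p M] by blast

lemma Rnat_dvd_eq:
  assumes "f \<in> Rnat" "g \<in> Rnat" "f dvd g"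
  shows "f = g"
proof -
  obtain h where h: "g = f * h" using assms(3) by blast
  have "\<not> is_unit f" using assms(1) unfolding Rnat_def by (auto simp: irreducible_not_unit)
  then have "is_unit h" using assms(2) h unfolding Rnat_def by (metis irreducibleD mem_Collect_eq)
  then have "degree h = 0" by (metis Rnat_nonzero assms(2) h is_unit_iff_degree mult_zero_right)
  then obtain c where c: "h = [:c:]" by (rule degree_eq_zeroE)
  have "lead_coeff g = lead_coeff f * lead_coeff h" unfolding h by (rule lead_coeff_mult)
  then have "lead_coeff h = 1" using Rnat_monic[OF assms(1)] Rnat_monic[OF assms(2)] by simp
  then have "c = 1" using c by simp
  then show ?thesis using h c by simp
qed

lemma monic_prod_mset: "set_mset M \<subseteq> Rnat \<Longrightarrow> lead_coeff (prod_mset M) = 1"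
  by (induction M) (auto simp: lead_coeff_mult Rnat_monic)

lemma Rnat_prod_mset_unique:
  assumes "set_mset M \<subseteq> Rnat" "set_mset M' \<subseteq> Rnat" "prod_mset M = prod_mset M'"
  shows "M = M'"
  using assms
proof (induction M arbitrary: M')
  case empty
  show ?case
  proof (rule ccontr)
    assume "{#} \<noteq> M'"
    then obtain f where "f \<in># M'" by auto
    then have "f dvd 1" "f \<in> Rnat" using empty dvd_prod_mset[of f M'] by auto
    then show False using Rnat_prime prime_elem_not_unit by blast
  qed
next
  case (add f M)
  have f: "f \<in> Rnat" using add.prems by simp
  have "f dvd prod_mset M'" using add.prems(3) by (metis dvd_triv_left prod_mset.add_mset)
  then obtain g where g: "g \<in># M'" "f dvd g"
    using prime_elem_dvd_prod_mset[OF Rnat_prime[OF f]] by blast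
  then have "f = g" using Rnat_dvd_eq f add.prems(2) by blast
  then have M': "M' = add_mset f (M' - {#f#})" using g by simp
  have "f * prod_mset M = f * prod_mset (M' - {#f#})"
    using add.prems(3) M' by (metis prod_mset.add_mset)
  then have "prod_mset M = prod_mset (M' - {#f#})" using Rnat_nonzero[OF f] by simp
  moreover have "set_mset M \<subseteq> Rnat" using add.prems(1) by simp
  moreover have "set_mset (M' - {#f#}) \<subseteq> Rnat" using add.prems(2) in_diffD by (metis subset_iff)
  ultimately have "M = M' - {#f#}" by (rule add.IH[rotated 2])
  then show ?case using M' by simp
qed

lemma Rnat_factorization_exists:
  fixes H :: "'a::field fls poly"
  assumes "H \<noteq> 0"
  shows "\<exists>M c. set_mset M \<subseteq> Rnat \<and> H = smult c (prod_mset M)"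
  using assms
proof (induction "degree H" arbitrary: H rule: less_induct)
  case less
  show ?case
  proof (cases "degree H = 0")
    case True
    then obtain c where "H = [:c:]" by (rule degree_eq_zeroE)
    then show ?thesis by (intro exI[of _ "{#}"] exI[of _ c]) auto
  next
    case False
    show ?thesis
    proof (cases "irreducible H")
      case True
      define f where "f = smult (inverse (lead_coeff H)) H"
      have "irreducible f"
        using irreducible_mult_unit_left[of "[:inverse (lead_coeff H):]" H] True less.prems
        by (simp add: f_def is_unit_const_poly_iff dvd_field_iff)
      moreover have "lead_coeff f = 1" using less.prems by (simp add: f_def)
      ultimately have "f \<in> Rnat" by (simp add: Rnat_def)
      moreover have "H = smult (lead_coeff H) f" using less.prems by (simp add: f_def)
      ultimately show ?thesis by (intro exI[of _ "{#f#}"] exI[of _ "lead_coeff H"]) auto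
    next
      case nir: False
      have "\<not> is_unit H" using False is_unit_iff_degree[OF less.prems] by simp
      then obtain A B where AB: "H = A * B" "\<not> is_unit A" "\<not> is_unit B"
        using nir less.prems unfolding irreducible_def by blast
      then have nz: "A \<noteq> 0" "B \<noteq> 0" using less.prems by auto
      then have "degree A > 0" "degree B > 0" using AB is_unit_iff_degree[OF nz(1)] is_unit_iff_degree[OF nz(2)] by simp_all
      then have d: "degree A < degree H" "degree B < degree H"
        using AB nz by (auto simp: degree_mult_eq)
      obtain M c M' c' where "set_mset M \<subseteq> Rnat" "A = smult c (prod_mset M)" "set_mset M' \<subseteq> Rnat" "B = smult c' (prod_mset M')"
        using less.hyps[OF d(1) nz(1)] less.hyps[OF d(2) nz(2)] by blast
      then show ?thesis using AB by (intro exI[of _ "M + M'"] exI[of _ "c * c'"]) (auto simp: mult.commute)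
    qed
  qed
qed

lemma Rfactors_eqI:
  assumes "set_mset M \<subseteq> Rnat" "H = smult c (prod_mset M)" "H \<noteq> 0"
  shows "Rfactors H = M"
proof -
  have "(THE M. set_mset M \<subseteq> Rnat \<and> (\<exists>c. H = smult c (prod_mset M))) = M"
  proof (rule the_equality)
    fix M' assume "set_mset M' \<subseteq> Rnat \<and> (\<exists>c. H = smult c (prod_mset M'))"
    then obtain c' where M': "set_mset M' \<subseteq> Rnat" "H = smult c' (prod_mset M')" by blast
    have "c = lead_coeff H" "c' = lead_coeff H"
      using monic_prod_mset[OF assms(1)] monic_prod_mset[OF M'(1)] assms(2) M'(2) by (metis lead_coeff_smult mult.right_neutral)+
    then have "smult (lead_coeff H) (prod_mset M') = smult (lead_coeff H) (prod_mset M)" using assms M' by metis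
    then have "prod_mset M' = prod_mset M" by (rule smult_cancel[rotated]) (use assms(3) in simp)
    then show "M' = M" using Rnat_prod_mset_unique M' assms by blast
  qed (use assms in auto)
  then show ?thesis using assms(3) by (simp add: Rfactors_def)
qed

lemma Rfactors:
  assumes "H \<noteq> 0"
  shows "set_mset (Rfactors H) \<subseteq> Rnat" "H = smult (lead_coeff H) (prod_mset (Rfactors H))"
proof -
  obtain M c where M: "set_mset M \<subseteq> Rnat" "H = smult c (prod_mset M)"
    using Rnat_factorization_exists[OF assms] by blast
  then have "Rfactors H = M" "lead_coeff H = c"
    using Rfactors_eqI assms monic_prod_mset[OF M(1)] by (blast, metis lead_coeff_smult mult.right_neutral)
  then show "set_mset (Rfactors H) \<subseteq> Rnat" "H = smult (lead_coeff H) (prod_mset (Rfactors H))"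
    using M by auto
qed

lemma Rfactors_mult:
  assumes "H \<noteq> 0" "K \<noteq> 0"
  shows "Rfactors (H * K) = Rfactors H + Rfactors K"
proof (rule Rfactors_eqI)
  have "H * K = smult (lead_coeff H) (prod_mset (Rfactors H)) * smult (lead_coeff K) (prod_mset (Rfactors K))"
    using Rfactors(2)[OF assms(1)] Rfactors(2)[OF assms(2)] by argo
  then show "H * K = smult (lead_coeff K * lead_coeff H) (prod_mset (Rfactors H + Rfactors K))" by simp
qed (use assms Rfactors in auto)

lemma degree_prod_mset_Rnat: "set_mset M \<subseteq> Rnat \<Longrightarrow> degree (prod_mset M) = (\<Sum>f\<in>#M. degree f)"
proof (induction M)
  case (add f M)
  have "f \<noteq> 0" "prod_mset M \<noteq> 0" using add.prems Rnat_nonzero by (auto simp: prod_mset_zero_iff)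
  then show ?case using add by (simp add: degree_mult_eq)
qed simp

lemma degree_eq_sum_Rfactors: "H \<noteq> 0 \<Longrightarrow> degree H = (\<Sum>f\<in>#Rfactors H. degree f)"
  using Rfactors[of H] degree_prod_mset_Rnat[of "Rfactors H"] by (metis degree_smult_eq leading_coeff_0_iff)

text \<open>
  If \<open>f\<^sup>2\<close> divides \<open>F\<close>, then \<open>F\<close> divides
  \<open>(F/f)\<^sup>2\<close> but not \<open>F/f\<close>.
\<close>
lemma no_multiple_factors_count:
  assumes "no_multiple_factors F" "f \<in># Rfactors F"
  shows "count (Rfactors F) f = 1"
proof (rule ccontr)
  assume ne: "count (Rfactors F) f \<noteq> 1"
  have F: "F \<noteq> 0" "\<And>A n. n > 0 \<Longrightarrow> F dvd A ^ n \<Longrightarrow> F dvd A"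
    using assms(1) unfolding no_multiple_factors_def by blast+
  have f: "f \<in> Rnat" using assms(2) Rfactors(1)[OF F(1)] by blast
  define M where "M = Rfactors F - {#f#}"
  have M: "Rfactors F = add_mset f M" using assms(2) by (simp add: M_def)
  have "f \<in># M" using ne assms(2) by (metis M add_mset_add_single count_add_mset count_eq_zero_iff One_nat_def)
  define P where "P = smult (lead_coeff F) (prod_mset M)"
  have FP: "F = P * f" using Rfactors(2)[OF F(1)] unfolding M P_def by (simp add: mult.commute)
  have "f dvd P" using \<open>f \<in># M\<close> unfolding P_def by (intro dvd_smult dvd_prod_mset)
  then have "F dvd P ^ 2" unfolding FP power2_eq_square by (rule mult_dvd_mono[OF dvd_refl])
  then have "P * f dvd P * 1" using F(2)[of 2 P] FP by simp
  moreover have "P \<noteq> 0" using FP F(1) by auto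
  ultimately have "f dvd 1" unfolding dvd_mult_cancel_left by simp
  then show False using Rnat_prime[OF f] prime_elem_not_unit by blast
qed

lemma degree_Omega:
  assumes "H \<noteq> 0"
  shows "degree (Omega B H) = (\<Sum>f\<in>#{#f \<in># Rfactors H. f \<in> tau B#}. degree f)"
    and "degree (Omega_prime B H) = (\<Sum>f\<in>#{#f \<in># Rfactors H. f \<in> tau_prime B#}. degree f)"
  unfolding Omega_def Omega_prime_def using Rfactors(1)[OF assms]
  by (intro degree_prod_mset_Rnat; auto)+

lemma Omega_eq_1_iff:
  assumes "H \<noteq> 0"
  shows "Omega B H = 1 \<longleftrightarrow> (\<forall>f\<in>#Rfactors H. f \<notin> tau B)"
proof
  assume "Omega B H = 1"
  then have 0: "{#f \<in># Rfactors H. f \<in> tau B#} = {#}"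
    unfolding Omega_def using Rfactors(1)[OF assms] by (intro Rnat_prod_mset_unique) auto
  then show "\<forall>f\<in>#Rfactors H. f \<notin> tau B" by simp
next
  assume "\<forall>f\<in>#Rfactors H. f \<notin> tau B"
  then have "{#f \<in># Rfactors H. f \<in> tau B#} = {#}" by simp
  then show "Omega B H = 1" by (simp only: Omega_def prod_mset_empty)
qed

section \<open>Leading forms on a ball\<close>

text \<open>
  The substitution \<open>Y = z + X\<^sup>l Y'\<close>, which turns the ball of the series near
  \<open>z\<close> to order \<open>l\<close> into the ball of integral series.
\<close>
definition loc :: "'a::field fls \<Rightarrow> int \<Rightarrow> 'a fls poly \<Rightarrow> 'a fls poly" where
  "loc z l P = pcompose P [:z, fls_X_intpow l:]"

lemma fls_X_intpow_times: "fls_X_intpow k * f = fls_shift (-k) (f :: 'a::field fls)"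
  by (simp add: fls_X_intpow_times_conv_shift)

lemma lform_shift: "lform (s + k) (smult (fls_X_intpow k) P) q \<longleftrightarrow> lform s P q"
proof -
  have *: "coeff (smult (fls_X_intpow k) P) i $$ e = coeff P i $$ (e - k)" for i e
    unfolding coeff_smult fls_X_intpow_times by simp
  have "(\<forall>e<s + k. coeff P i $$ (e - k) = 0) \<longleftrightarrow> (\<forall>e<s. coeff P i $$ e = 0)" for i
    by (metis add_diff_cancel_right' diff_less_eq add_strict_right_mono)
  then show ?thesis unfolding lform_def * by simp
qed

text \<open>
  The order of \<open>z + X\<^sup>l Y' - w\<close> for generic \<open>Y'\<close>.
\<close>
definition ball_ord :: "'a::field fls \<Rightarrow> int \<Rightarrow> 'a fls \<Rightarrow> int" where
  "ball_ord z l w = (if near l w z then l else fls_subdegree (z - w))"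

lemma lform_loc_linear:
  "\<exists>K. K \<noteq> 0 \<and> lform (ball_ord z l w) (loc z l [:-w, 1:]) (smult K (if near l w z then [:- ((w - z) $$ l), 1:] else 1))"
proof -
  have L: "loc z l [:-w, 1:] = [:z - w, fls_X_intpow l:]" by (simp add: loc_def pcompose_pCons)
  show ?thesis
  proof (cases "near l w z")
    case True
    have "lform l [:z - w, fls_X_intpow l:] [:(z - w) $$ l, fls_X_intpow l $$ l:]"
      by (rule lform_linear) (use True in \<open>auto simp: near_def\<close>)
    then show ?thesis using True by (intro exI[of _ 1]) (simp add: L ball_ord_def)
  next
    case False
    then have d: "z \<noteq> w" "fls_subdegree (z - w) < l" using not_near_subdegree[of l z w] near_sym by blast+
    have "lform (fls_subdegree (z - w)) [:z - w, fls_X_intpow l:]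
        [:(z - w) $$ fls_subdegree (z - w), fls_X_intpow l $$ fls_subdegree (z - w):]"
      by (rule lform_linear) (use d in \<open>auto simp del: fls_minus_nth\<close>)
    moreover have "fls_X_intpow l $$ fls_subdegree (z - w) = (0::'a)" using d by simp
    ultimately show ?thesis using False d
      by (intro exI[of _ "(z - w) $$ fls_subdegree (z - w)"]) (simp add: L ball_ord_def del: fls_minus_nth)
  qed
qed

lemma loc_mult: "loc z l (P * Q) = loc z l P * loc z l Q"
  by (simp add: loc_def pcompose_mult)

lemma loc_smult: "loc z l (smult c P) = smult c (loc z l P)"
  by (simp add: loc_def pcompose_smult)

lemma loc_add: "loc z l (P + Q) = loc z l P + loc z l Q"
  by (simp add: loc_def pcompose_add)

lemma loc_diff: "loc z l (P - Q) = loc z l P - loc z l Q"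
  by (simp add: loc_def pcompose_diff)

text \<open>
  The leading form on the ball has these as its roots; roots of the polynomial outside the ball
  only contribute a constant to it (\<open>lform_loc_prod\<close>).
\<close>
definition ball_residues :: "'a::field fls \<Rightarrow> int \<Rightarrow> 'a fls multiset \<Rightarrow> 'a multiset" where
  "ball_residues z l Z = image_mset (\<lambda>w. (w - z) $$ l) {#w \<in># Z. near l w z#}"

lemma lform_loc_prod:
  "\<exists>K. K \<noteq> 0 \<and> lform (\<Sum>w\<in>#Z. ball_ord z l w) (loc z l (\<Prod>w\<in>#Z. [:-w, 1:]))
     (smult K (\<Prod>u\<in>#ball_residues z l Z. [:-u, 1:]))"
proof (induction Z)
  case empty
  have "lform 0 [:1:] [:1 $$ 0:]" by (rule lform_const) simp
  then show ?case by (intro exI[of _ 1]) (simp add: ball_residues_def loc_def pcompose_1 flip: one_pCons)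
next
  case (add w Z)
  obtain K where K: "K \<noteq> 0" "lform (\<Sum>w\<in>#Z. ball_ord z l w) (loc z l (\<Prod>w\<in>#Z. [:-w, 1:]))
     (smult K (\<Prod>u\<in>#ball_residues z l Z. [:-u, 1:]))" using add by blast
  obtain L where L: "L \<noteq> 0" "lform (ball_ord z l w) (loc z l [:-w, 1:]) (smult L (if near l w z then [:- ((w - z) $$ l), 1:] else 1))"
    using lform_loc_linear by blast
  have "smult L (if near l w z then [:- ((w - z) $$ l), 1:] else 1) * smult K (\<Prod>u\<in>#ball_residues z l Z. [:-u, 1:])
    = smult (L * K) (\<Prod>u\<in>#ball_residues z l (add_mset w Z). [:-u, 1:])"
    by (simp add: ball_residues_def mult.commute del: mult_pCons_left mult_pCons_right)
  then have "lform (\<Sum>w\<in>#add_mset w Z. ball_ord z l w) (loc z l (\<Prod>w\<in>#add_mset w Z. [:-w, 1:]))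
     (smult (L * K) (\<Prod>u\<in>#ball_residues z l (add_mset w Z). [:-u, 1:]))"
    using lform_mult[OF L(2) K(2)] by (simp add: loc_mult del: mult_pCons_left mult_pCons_right)
  then show ?case using K(1) L(1) by (intro exI[of _ "L * K"]) simp
qed

lemma lform_loc_split:
  assumes "c \<noteq> 0" "P = smult c (\<Prod>w\<in>#Z. [:-w, 1:])"
  shows "\<exists>K. K \<noteq> 0 \<and> lform (fls_subdegree c + (\<Sum>w\<in>#Z. ball_ord z l w)) (loc z l P)
     (smult K (\<Prod>u\<in>#ball_residues z l Z. [:-u, 1:]))"
proof -
  obtain K where K: "K \<noteq> 0" "lform (\<Sum>w\<in>#Z. ball_ord z l w) (loc z l (\<Prod>w\<in>#Z. [:-w, 1:]))
     (smult K (\<Prod>u\<in>#ball_residues z l Z. [:-u, 1:]))" using lform_loc_prod by blast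
  have "lform (fls_subdegree c) [:c:] [:c $$ fls_subdegree c:]" by (rule lform_const) simp
  from lform_mult[OF this K(2)] show ?thesis
    using K(1) assms by (intro exI[of _ "c $$ fls_subdegree c * K"]) (simp add: loc_smult mult.commute)
qed

text \<open>
  Leading forms are unique, so one that is found without knowing the roots, for instance by
  differentiation, counts the roots in the ball.
\<close>
lemma ball_residues_count:
  assumes c: "c \<noteq> 0" "P = smult c (\<Prod>w\<in>#Z. [:-w, 1:])" and q: "lform s (loc z l P) q" "q \<noteq> 0"
  shows "size (ball_residues z l Z) = degree q" "count (ball_residues z l Z) u = order u q"
proof -
  obtain K where K: "K \<noteq> 0" "lform (fls_subdegree c + (\<Sum>w\<in>#Z. ball_ord z l w)) (loc z l P)
     (smult K (\<Prod>u\<in>#ball_residues z l Z. [:-u, 1:]))" using lform_loc_split[OF c] by blast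
  have "smult K (\<Prod>u\<in>#ball_residues z l Z. [:-u, 1:]) \<noteq> 0" using K(1) by (auto simp: prod_mset_zero_iff)
  then have "q = smult K (\<Prod>u\<in>#ball_residues z l Z. [:-u, 1:])" using lform_unique(2)[OF q(1) K(2) q(2)] by blast
  then show "size (ball_residues z l Z) = degree q" "count (ball_residues z l Z) u = order u q"
    using K(1) by (simp_all add: degree_prod_linear order_smult order_prod_linear)
qed

text \<open>
  In characteristic zero differentiation lowers the degree by one, and the multiplicity of each
  root as well. The roots of the derivative that are not in \<open>U\<close> are what remains.
\<close>
lemma ball_residues_pderiv:
  fixes z :: "'a::{alg_closed_field, field_char_0} fls"
  assumes U: "U \<noteq> {#}" and k: "\<kappa> \<noteq> 0"
    and c: "c \<noteq> 0" "P = smult c (\<Prod>w\<in>#Z. [:-w, 1:])"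
    and q: "lform s (loc z l P) (smult \<kappa> (pderiv (\<Prod>u\<in>#U. [:-u, 1:])))"
  shows "size (ball_residues z l Z) + 1 = size U"
    and "size (filter_mset (\<lambda>u. u \<notin># U) (ball_residues z l Z)) + 1 = card (set_mset U)"
proof -
  define f where "f = (\<Prod>u\<in>#U. [:-u, 1:])"
  let ?R = "ball_residues z l Z"
  have df: "degree f = size U" by (simp add: f_def degree_prod_linear)
  then have "degree f \<noteq> 0" using U by simp
  then have p0: "pderiv f \<noteq> 0" by (simp add: pderiv_eq_0_iff)
  then have q0: "smult \<kappa> (pderiv f) \<noteq> 0" using k by simp
  note cnt = ball_residues_count[OF c q[folded f_def] q0]
  show sz: "size ?R + 1 = size U"
    using cnt(1) k df U by (simp add: degree_pderiv) (metis One_nat_def Suc_pred nonempty_has_size)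
  have cu: "count ?R u = order u (pderiv f)" for u using cnt(2) k by (simp add: order_smult)
  have ord: "count U u = Suc (count ?R u)" if "u \<in># U" for u
    using order_pderiv[of f u] p0 that cu[of u] by (auto simp: f_def order_prod_linear poly_prod_linear_eq_0_iff image_iff)
  have "size U = (\<Sum>u\<in>set_mset U. Suc (count ?R u))" by (simp add: size_multiset_overloaded_eq ord)
  also have "\<dots> = (\<Sum>u\<in>set_mset U. count ?R u) + card (set_mset U)" by (simp add: sum.distrib sum_Suc)
  also have "(\<Sum>u\<in>set_mset U. count ?R u) = size (filter_mset (\<lambda>u. u \<in># U) ?R)"
  proof -
    have "size (filter_mset (\<lambda>u. u \<in># U) ?R) = (\<Sum>u\<in>set_mset (filter_mset (\<lambda>u. u \<in># U) ?R). count ?R u)"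
      unfolding size_multiset_overloaded_eq by (rule sum.cong) auto
    also have "\<dots> = (\<Sum>u\<in>set_mset U. count ?R u)"
      by (rule sum.mono_neutral_left) (auto simp: count_eq_zero_iff)
    finally show ?thesis by simp
  qed
  finally have "size U = size (filter_mset (\<lambda>u. u \<in># U) ?R) + card (set_mset U)" .
  moreover have "size ?R = size (filter_mset (\<lambda>u. u \<in># U) ?R) + size (filter_mset (\<lambda>u. u \<notin># U) ?R)"
    by (metis multiset_partition size_union)
  ultimately show "size (filter_mset (\<lambda>u. u \<notin># U) ?R) + 1 = card (set_mset U)" using sz by simp
qed

section \<open>The Jacobian on a ball\<close>

text \<open>
  The Euler derivation \<open>X d/dX\<close>, which does not move the exponent of a leading form.
\<close>
definition theta :: "'a::field_char_0 fls poly \<Rightarrow> 'a fls poly" where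
  "theta P = smult fls_X (DX P)"

lemma coeff_DX: "coeff (DX P) i = fls_deriv (coeff P i)"
  by (simp add: DX_def coeff_map_poly)

lemma theta_add: "theta (P + Q) = theta P + theta Q"
  by (rule poly_eqI) (simp add: theta_def coeff_DX algebra_simps)

lemma theta_pCons: "theta (pCons a P) = pCons (fls_X * fls_deriv a) (theta P)"
  by (rule poly_eqI) (simp add: theta_def coeff_DX coeff_pCons split: nat.splits)

lemma DX_mult: "DX (P * Q) = DX P * Q + P * DX Q"
  by (rule poly_eqI) (simp add: coeff_DX coeff_mult fls_deriv_sum sum.distrib add.commute)

lemma theta_mult: "theta (P * Q) = theta P * Q + P * theta Q"
  by (simp add: theta_def DX_mult smult_add_right)

lemma theta_ramify:
  assumes "N > 0"
  shows "theta (ramify N P) = smult (of_nat N * fls_X_intpow (int N)) (ramify N (DX P))"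
proof (rule poly_eqI)
  fix i
  have "fls_X * fls_deriv (fls_compose_power c N) = of_nat N * (fls_X_intpow (int N) * fls_compose_power (fls_deriv c) N)"
    for c :: "'a fls"
  proof (rule fls_eqI)
    fix e
    have "(fls_X * fls_deriv (fls_compose_power c N)) $$ e = of_int e * fls_compose_power c N $$ e"
      by (simp add: fls_X_times_conv_shift)
    also have "\<dots> = of_nat N * fls_compose_power (fls_deriv c) N $$ (e - int N)"
    proof (cases "int N dvd e")
      case True
      then obtain k where k: "e = int N * k" by blast
      have "e - int N = int N * (k - 1)" by (simp add: k algebra_simps)
      then have "fls_compose_power (fls_deriv c) N $$ (e - int N) = fls_deriv c $$ (k - 1)"
        using assms by (simp add: fls_compose_power_nth_mult)
      then show ?thesis using assms by (simp add: k fls_compose_power_nth_mult)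
    next
      case False
      then have "\<not> int N dvd e - int N" by (metis dvd_add_left_iff diff_add_cancel dvd_refl)
      then show ?thesis using False assms by (simp add: fls_nth_compose_power)
    qed
    also have "\<dots> = (of_nat N * (fls_X_intpow (int N) * fls_compose_power (fls_deriv c) N)) $$ e"
      unfolding fls_X_intpow_times by (simp add: fls_of_nat)
    finally show "(fls_X * fls_deriv (fls_compose_power c N)) $$ e = (of_nat N * (fls_X_intpow (int N) * fls_compose_power (fls_deriv c) N)) $$ e" .
  qed
  then show "coeff (theta (ramify N P)) i = coeff (smult (of_nat N * fls_X_intpow (int N)) (ramify N (DX P))) i"
    by (simp only: theta_def coeff_smult coeff_DX coeff_ramify mult.assoc)
qed

text \<open>
  The chain rule; the second term arises because the substituted value of \<open>Y\<close>
  involves \<open>X\<close>.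
\<close>
lemma theta_loc:
  "theta (loc z l P) = loc z l (theta P) + loc z l (DY P) * theta [:z, fls_X_intpow l:]"
proof (induction P)
  case 0
  show ?case by (simp add: loc_def theta_def DX_def)
next
  case (pCons a P)
  let ?L = "[:z, fls_X_intpow l:]"
  have p: "loc z l (pCons c Q) = [:c:] + ?L * loc z l Q" for c Q
    by (simp add: loc_def pcompose_pCons)
  have "theta (loc z l (pCons a P)) = theta [:a:] + theta ?L * loc z l P + ?L * theta (loc z l P)"
    unfolding p theta_add theta_mult by (simp only: add.assoc)
  also have "theta [:a:] = [:fls_X * fls_deriv a:]" by (simp add: theta_pCons) (simp add: theta_def DX_def)
  finally show ?case
    unfolding pCons.IH theta_pCons pderiv_pCons loc_add p by (simp add: algebra_simps del: mult_pCons_left mult_pCons_right)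
qed

lemma DY_loc: "DY (loc z l P) = smult (fls_X_intpow l) (loc z l (DY P))"
  unfolding loc_def pderiv_pcompose by (simp add: pderiv_pCons)

text \<open>
  The correction terms of the chain rule are proportional to the \<open>Y\<close>-derivatives and
  cancel.
\<close>
lemma jac_loc:
  "theta (loc z l F) * DY (loc z l G) - DY (loc z l F) * theta (loc z l G)
    = smult (fls_X_intpow l) (loc z l (theta F * DY G - DY F * theta G))"
  unfolding theta_loc DY_loc loc_diff loc_mult
  by (simp add: algebra_simps smult_diff_right smult_add_right del: mult_pCons_left mult_pCons_right)

lemma jac_ramify:
  assumes "N > 0"
  shows "theta (ramify N F) * DY (ramify N G) - DY (ramify N F) * theta (ramify N G)
    = smult (of_nat N * fls_X_intpow (int N)) (ramify N (jac F G))"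
  unfolding theta_ramify[OF assms] ramify_pderiv[OF assms, symmetric] jac_def ramify_diff ramify_mult
  by (simp add: smult_diff_right)

lemma lform_DY:
  assumes "N > 0" "lform s (loc z l (ramify N F)) q"
  shows "lform (s - l) (loc z l (ramify N (DY F))) (pderiv q)"
proof -
  have "lform (s - l + l) (smult (fls_X_intpow l) (loc z l (ramify N (DY F)))) (pderiv q)"
    using lform_pderiv[OF assms(2)] unfolding DY_loc ramify_pderiv[OF assms(1)] by simp
  then show ?thesis by (simp only: lform_shift)
qed

text \<open>
  The leading form \<open>c\<close> of \<open>G\<close> is free of \<open>Y\<close>, so that its
  \<open>Y\<close>-derivative vanishes, and \<open>X d/dX\<close> multiplies it by
  \<open>t\<close>. Only the second product of the Jacobian contributes, and it does so if
  \<open>t \<noteq> 0\<close>.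
\<close>
lemma lform_jac:
  fixes F G :: "'a::field_char_0 fls poly"
  assumes N: "N > 0" and F: "lform s (loc z l (ramify N F)) q" and G: "lform t (loc z l (ramify N G)) [:c:]"
  shows "lform (s + t - l - int N) (loc z l (ramify N (jac F G))) (smult (- (of_int t * c) / of_nat N) (pderiv q))"
proof -
  let ?J = "loc z l (ramify N (jac F G))"
  let ?T = "theta (loc z l (ramify N F)) * DY (loc z l (ramify N G)) - DY (loc z l (ramify N F)) * theta (loc z l (ramify N G))"
  have th: "lform s (theta P) (smult (of_int s) p)" if "lform s P p" for s P and p :: "'a poly"
    using lform_X_DX[OF that] by (simp add: theta_def)
  have "lform (s + t) ?T (smult (of_int s) q * pderiv [:c:] - pderiv q * smult (of_int t) [:c:])"
    by (intro lform_diff lform_mult th lform_pderiv F G)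
  moreover have "smult (of_int s) q * pderiv [:c:] - pderiv q * smult (of_int t) [:c:] = smult (- (of_int t * c)) (pderiv q)"
    by simp
  ultimately have a: "lform (s + t) ?T (smult (- (of_int t * c)) (pderiv q))" by simp
  have "?T = smult (fls_X_intpow l) (smult (of_nat N * fls_X_intpow (int N)) ?J)"
    unfolding jac_loc jac_ramify[OF N] loc_smult ..
  also have "\<dots> = smult (fls_X_intpow l) (smult (fls_X_intpow (int N)) (smult (fls_const (of_nat N)) ?J))"
    unfolding fls_of_nat smult_smult by (simp only: mult.commute mult.left_commute mult.assoc)
  finally have T: "?T = \<dots>" .
  have "lform (s + t - l - int N + int N + l) ?T (smult (- (of_int t * c)) (pderiv q))" using a by simp
  then have "lform (s + t - l - int N) (smult (fls_const (of_nat N)) ?J) (smult (- (of_int t * c)) (pderiv q))"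
    unfolding T lform_shift .
  note lform_smult[OF this, of "1 / of_nat N"]
  moreover have "fls_const (1 / of_nat N) * fls_const (of_nat N) = (1 :: 'a fls)"
    using N by (simp add: fls_const_mult_const)
  ultimately show ?thesis using N by simp
qed

section \<open>All roots of a polynomial\<close>

definition roots_mset :: "nat \<Rightarrow> 'a::field fls poly multiset \<Rightarrow> 'a fls multiset" where
  "roots_mset N M = (\<Sum>f\<in>#M. mset_set (rts N f))"

lemma ramify_split:
  fixes H :: "'a::{alg_closed_field, field_char_0} fls poly"
  assumes "H \<noteq> 0" "N > 0" "\<And>f. f \<in># Rfactors H \<Longrightarrow> is_level N f"
  shows "ramify N H = smult (fls_compose_power (lead_coeff H) N) (\<Prod>w\<in>#roots_mset N (Rfactors H). [:-w, 1:])"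
proof -
  have *: "ramify N (prod_mset M) = (\<Prod>w\<in>#roots_mset N M. [:-w, 1:])" if "\<And>f. f \<in># M \<Longrightarrow> is_level N f" for M :: "'a fls poly multiset"
    using that
  proof (induction M)
    case (add f M)
    have "is_level N f" using add.prems by simp
    then have "ramify N f = (\<Prod>w\<in>#mset_set (rts N f). [:-w, 1:])"
      unfolding is_level_def by (simp add: rts_ramified(1) prod_unfold_prod_mset[symmetric])
    then show ?case using add by (simp add: ramify_mult roots_mset_def)
  qed (use assms(2) in \<open>simp add: roots_mset_def\<close>)
  have "ramify N H = ramify N (smult (lead_coeff H) (prod_mset (Rfactors H)))"
    using Rfactors(2)[OF assms(1)] by simp
  then show ?thesis using *[of "Rfactors H"] assms(3) by (simp add: ramify_smult)
qed

section \<open>The number of conjugates of a ball\<close>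

definition trunc_series :: "int \<Rightarrow> 'a::zero fls \<Rightarrow> int \<Rightarrow> 'a" where
  "trunc_series l z = (\<lambda>e. if e < l then z $$ e else 0)"

lemma trunc_series_eq_iff: "trunc_series l z = trunc_series l w \<longleftrightarrow> near l z w"
  unfolding trunc_series_def near_def fun_eq_iff by metis

lemma card_fibers:
  assumes "finite A" "\<And>a. a \<in> A \<Longrightarrow> card {b \<in> A. h b = h a} = m"
  shows "card A = card (h ` A) * m"
proof -
  have "card A = (\<Sum>y\<in>h ` A. card {b \<in> A. h b = y})"
    using sum.image_gen[OF assms(1), of "\<lambda>_. 1::nat" h] by simp
  also have "\<dots> = (\<Sum>y\<in>h ` A. m)" by (rule sum.cong) (use assms(2) in auto)
  finally show ?thesis by simp
qed

text \<open>
  The balls conjugate to the one of order \<open>l\<close> about \<open>z\<close>, each given by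
  the common truncation of its elements.
\<close>
definition ball_orbit :: "nat \<Rightarrow> int \<Rightarrow> 'a::field fls \<Rightarrow> (int \<Rightarrow> 'a) set" where
  "ball_orbit N l z = (\<lambda>\<zeta>. trunc_series l (rot \<zeta> z)) ` unity N"

lemma ball_orbit_cong: "N > 0 \<Longrightarrow> near l z w \<Longrightarrow> ball_orbit N l z = ball_orbit N l w"
  unfolding ball_orbit_def by (rule image_cong) (auto simp: trunc_series_eq_iff near_rot unity_nonzero)

text \<open>
  Rotations permute the balls transitively, hence distribute the roots of \<open>f\<close> evenly.
\<close>
lemma card_ball_orbit:
  fixes f :: "'a::{alg_closed_field, field_char_0} fls poly"
  assumes "is_level N f" "z \<in> rts N f"
  shows "degree f = card (ball_orbit N l z) * card {w \<in> rts N f. near l w z}"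
proof -
  have f: "f \<in> Rnat" "N > 0" "degree f dvd N" using assms(1) by (auto simp: is_level_def)
  define lam where "lam = (of_int l / of_nat N :: rat)"
  have l: "of_int l = lam * of_nat N" using f by (simp add: lam_def)
  have "trunc_series l ` rts N f = ball_orbit N l z"
  proof -
    have "rts N f = (\<lambda>\<zeta>. rot \<zeta> z) ` unity N"
      using rts_transitive[OF f assms(2)] rts_rot[OF f(2) _ assms(2)] by auto
    then show ?thesis by (simp add: ball_orbit_def image_image)
  qed
  moreover have "card (rts N f) = card (trunc_series l ` rts N f) * card {w \<in> rts N f. near l w z}"
    by (rule card_fibers)
      (use rts_ramified(2)[OF f] assms card_near(1)[OF f(1) assms(1) _ l] in \<open>simp_all add: trunc_series_eq_iff\<close>)
  ultimately show ?thesis using rts_ramified(3)[OF f] by simp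
qed

lemma card_near_pos:
  fixes f :: "'a::{alg_closed_field, field_char_0} fls poly"
  assumes "is_level N f" "z \<in> rts N f"
  shows "card {w \<in> rts N f. near l w z} > 0"
proof -
  have "finite (rts N f)" using assms by (simp add: is_level_def rts_ramified(2))
  then show ?thesis using assms(2) by (auto simp: card_gt_0_iff)
qed

lemma Dval_ball_orbit:
  fixes f :: "'a::{alg_closed_field, field_char_0} fls poly"
  assumes "is_level N f" "z \<in> rts N f" "of_int l = (lam::rat) * of_nat N"
  shows "Dval f lam = of_nat (card (ball_orbit N l z))"
    and "Dval_star f lam = of_nat (card (ball_orbit N (l + 1) z))"
proof -
  have f: "f \<in> Rnat" using assms(1) by (simp add: is_level_def)
  have "Dval f lam * of_nat (card {w \<in> rts N f. near l w z}) = of_nat (card (ball_orbit N l z)) * of_nat (card {w \<in> rts N f. near l w z})"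
    using Dval_count(1)[OF f assms] card_ball_orbit[OF assms(1,2), of l] by (metis of_nat_mult)
  then show "Dval f lam = of_nat (card (ball_orbit N l z))"
    using card_near_pos[OF assms(1,2), of l] by simp
  have "Dval_star f lam * of_nat (card {w \<in> rts N f. near (l + 1) w z}) = of_nat (card (ball_orbit N (l + 1) z)) * of_nat (card {w \<in> rts N f. near (l + 1) w z})"
    using Dval_count(2)[OF f assms] card_ball_orbit[OF assms(1,2), of "l + 1"] by (metis of_nat_mult)
  then show "Dval_star f lam = of_nat (card (ball_orbit N (l + 1) z))"
    using card_near_pos[OF assms(1,2), of "l + 1"] by simp
qed

text \<open>
  Both sides count the conjugates of one and the same ball.
\<close>
lemma Dval_cong:
  fixes f g :: "'a::{alg_closed_field, field_char_0} fls poly"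
  assumes fg: "f \<in> Rnat" "g \<in> Rnat"
  shows "Fin lam \<le> noc f g \<Longrightarrow> Dval f lam = Dval g lam"
    and "Fin lam < noc f g \<Longrightarrow> Dval_star f lam = Dval_star g lam"
proof -
  obtain N l where N: "is_level N f" "is_level N g" "N > 0" "of_int l = lam * of_nat N"
    using levels[OF fg fg(2), of lam] by metis
  obtain z where z: "z \<in> rts N f" using rts_nonempty N unfolding is_level_def by blast
  show "Dval f lam = Dval g lam" if le: "Fin lam \<le> noc f g"
  proof -
    obtain w where w: "w \<in> rts N g" "near l z w" using le noc_ge_iff(1)[OF N(1,2,4) z] by blast
    then show ?thesis
      using Dval_ball_orbit(1)[OF N(1) z N(4)] Dval_ball_orbit(1)[OF N(2) w(1) N(4)] ball_orbit_cong[OF N(3) w(2)] by simp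
  qed
  show "Dval_star f lam = Dval_star g lam" if le: "Fin lam < noc f g"
  proof -
    obtain w where w: "w \<in> rts N g" "near (l + 1) z w" using le noc_ge_iff(2)[OF N(1,2,4) z] by blast
    then show ?thesis
      using Dval_ball_orbit(2)[OF N(1) z N(4)] Dval_ball_orbit(2)[OF N(2) w(1) N(4)] ball_orbit_cong[OF N(3) w(2)] by simp
  qed
qed

section \<open>Buds and balls\<close>

lemma noc_self: "f \<in> Rnat \<Longrightarrow> noc f f = (Pinf :: rat extended)" for f :: "'a::{alg_closed_field, field_char_0} fls poly"
  using noc_cases(1) by blast

lemma ball_residues_union: "ball_residues z l (A + B) = ball_residues z l A + ball_residues z l B"
  by (simp add: ball_residues_def)

lemma size_ball_residues_set:
  "finite A \<Longrightarrow> size (ball_residues z l (mset_set A)) = card {w \<in> A. near l w z}"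
  by (simp add: ball_residues_def filter_mset_mset_set)

text \<open>
  The residues of the roots of \<open>f\<close> in the ball, that is, its open sub-balls that
  contain such a root.
\<close>
definition directions :: "nat \<Rightarrow> 'a::field fls \<Rightarrow> int \<Rightarrow> 'a fls poly \<Rightarrow> 'a set" where
  "directions N z l f = (\<lambda>w. (w - z) $$ l) ` {w \<in> rts N f. near l w z}"

context
  fixes B :: "'a::{alg_closed_field, field_char_0} gbud" and lam :: rat and N :: nat and l :: int
    and z :: "'a fls" and g :: "'a fls poly"
  assumes B: "bud B" "level B = Fin lam" and l: "of_int l = lam * of_nat N"
    and g: "g \<in> stem B" "is_level N g" "z \<in> rts N g"
begin

lemma stem_Rnat: "f \<in> stem B \<Longrightarrow> f \<in> Rnat"
  using B(1) unfolding bud_def by blast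

lemma stem_noc: "f \<in> stem B \<Longrightarrow> f' \<in> stem B \<Longrightarrow> Fin lam \<le> noc f f'"
  using B unfolding bud_def by simp

lemma in_tau_iff: "f \<in> tau B \<longleftrightarrow> f \<in> Rnat \<and> Fin lam \<le> noc f g"
proof
  assume f: "f \<in> Rnat \<and> Fin lam \<le> noc f g"
  then have "Fin lam \<le> noc f f'" if "f' \<in> stem B" for f'
    using noc_trans(1)[of f g f'] stem_noc[OF g(1) that] stem_Rnat that g(1) by blast
  then show "f \<in> tau B" using f B(2) by (simp add: tau_def)
qed (use g(1) B(2) in \<open>auto simp: tau_def\<close>)

lemma tau_noc: "f \<in> tau B \<Longrightarrow> f' \<in> tau B \<Longrightarrow> Fin lam \<le> noc f f'"
  using noc_trans(1)[of f g f'] noc_sym[of f' g] stem_Rnat[OF g(1)] by (simp add: in_tau_iff)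

lemma stem_tau: "stem B \<subseteq> tau B"
  using stem_noc[OF _ g(1)] stem_Rnat by (auto simp: in_tau_iff)

lemma tau_iff_near:
  assumes "is_level N f"
  shows "f \<in> tau B \<longleftrightarrow> (\<exists>w\<in>rts N f. near l w z)"
proof -
  have f: "f \<in> Rnat" using assms by (simp add: is_level_def)
  have "f \<in> tau B \<longleftrightarrow> Fin lam \<le> noc g f" unfolding in_tau_iff using f noc_sym[OF f stem_Rnat[OF g(1)]] by simp
  then show ?thesis unfolding noc_ge_iff(1)[OF g(2) assms l g(3)] using near_sym by blast
qed

lemma D_bud_eq:
  assumes "f \<in> tau B"
  shows "D_bud B = Dval f lam"
proof -
  have "\<forall>f'\<in>tau B. Dval f' lam = Dval f lam"
  proof
    fix f' assume f': "f' \<in> tau B"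
    show "Dval f' lam = Dval f lam"
      by (rule Dval_cong(1)[OF _ _ tau_noc[OF f' assms]]) (use f' assms in \<open>auto simp: in_tau_iff\<close>)
  qed
  then have "(THE d. \<forall>f'\<in>tau B. Dval f' lam = d) = Dval f lam"
    using assms by (intro the_equality) (blast, metis)
  then show ?thesis by (simp only: D_bud_def B(2) finval_def extended.case)
qed

lemma D_bud_count:
  assumes f: "is_level N f" "f \<in> tau B"
  shows "of_nat (degree f) = D_bud B * of_nat (card {w \<in> rts N f. near l w z})"
proof -
  obtain w where w: "w \<in> rts N f" "near l w z" using f tau_iff_near by blast
  have "{x \<in> rts N f. near l x z} = {x \<in> rts N f. near l x w}"
    using near_trans[OF _ w(2)] near_trans[OF _ w(2)[unfolded near_sym[of _ w]]] by blast
  then show ?thesis using Dval_count(1)[OF _ f(1) w(1) l] f(1) D_bud_eq[OF f(2)] by (simp add: is_level_def)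
qed

text \<open>
  By the even distribution of roots over conjugate balls, it suffices to count in one of the
  \<open>D_bud B\<close> balls.
\<close>
lemma sum_degree_tau:
  assumes "\<And>f. f \<in># M \<Longrightarrow> is_level N f"
  shows "of_nat (\<Sum>f\<in>#{#f \<in># M. f \<in> tau B#}. degree f) = D_bud B * of_nat (size (ball_residues z l (roots_mset N M)))"
  using assms
proof (induction M)
  case (add f M)
  have f: "is_level N f" using add.prems by simp
  have fin: "finite (rts N f)" using f by (simp add: is_level_def rts_ramified(2))
  have sz: "size (ball_residues z l (roots_mset N (add_mset f M)))
      = card {w \<in> rts N f. near l w z} + size (ball_residues z l (roots_mset N M))"
    by (simp add: roots_mset_def ball_residues_union size_ball_residues_set[OF fin])
  have IH: "of_nat (\<Sum>f\<in>#{#f \<in># M. f \<in> tau B#}. degree f) = D_bud B * of_nat (size (ball_residues z l (roots_mset N M)))"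
    using add by simp
  show ?case
  proof (cases "f \<in> tau B")
    case True
    then show ?thesis using IH D_bud_count[OF f True] unfolding sz by (simp add: algebra_simps)
  next
    case False
    then have "{w \<in> rts N f. near l w z} = {}" using tau_iff_near[OF f] by auto
    then have "card {w \<in> rts N f. near l w z} = 0" by (metis card.empty)
    then show ?thesis using IH False unfolding sz by simp
  qed
qed (simp add: roots_mset_def ball_residues_def)

context
  assumes stem_level: "\<And>f. f \<in> stem B \<Longrightarrow> is_level N f"
begin

text \<open>
  Membership in \<open>tau_star B\<close> is decided by the residue of any one root in the ball,
  because contact above the level means lying in a common open sub-ball, up to rotation.
\<close>
lemma tau_star_iff:
  assumes f: "is_level N f" and w: "w \<in> rts N f" "near l w z"
  shows "f \<in> tau_star B \<longleftrightarrow> (w - z) $$ l \<in> (\<Union>f\<in>stem B. directions N z l f)"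
proof -
  have "f \<in> tau B" using tau_iff_near[OF f] w by blast
  then have "f \<in> tau_star B \<longleftrightarrow> (\<exists>f'\<in>stem B. Fin lam < noc f f')" by (simp add: tau_star_def B(2))
  also have "\<dots> \<longleftrightarrow> (\<exists>f'\<in>stem B. \<exists>v\<in>rts N f'. near (l + 1) w v)"
    using noc_ge_iff(2)[OF f stem_level l w(1)] by blast
  also have "\<dots> \<longleftrightarrow> (\<exists>f'\<in>stem B. \<exists>v\<in>rts N f'. near l v z \<and> (v - z) $$ l = (w - z) $$ l)"
  proof -
    have "near (l + 1) w v \<longleftrightarrow> near l v z \<and> (v - z) $$ l = (w - z) $$ l" for v
      unfolding near_Suc using w(2) near_trans near_sym by (metis diff_left_imp_eq fls_minus_nth eq_iff_diff_eq_0 add_diff_cancel diff_add_cancel)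
    then show ?thesis by simp
  qed
  also have "\<dots> \<longleftrightarrow> (w - z) $$ l \<in> (\<Union>f\<in>stem B. directions N z l f)"
  proof -
    have "u \<in> (\<Union>f\<in>stem B. directions N z l f) \<longleftrightarrow> (\<exists>f'\<in>stem B. \<exists>v\<in>rts N f'. near l v z \<and> (v - z) $$ l = u)" for u
      unfolding directions_def by blast
    then show ?thesis by blast
  qed
  finally show ?thesis .
qed

lemma sum_degree_tau_prime:
  assumes "\<And>f. f \<in># M \<Longrightarrow> is_level N f"
  shows "of_nat (\<Sum>f\<in>#{#f \<in># M. f \<in> tau_prime B#}. degree f)
    = D_bud B * of_nat (size (filter_mset (\<lambda>u. u \<notin> (\<Union>f\<in>stem B. directions N z l f)) (ball_residues z l (roots_mset N M))))"
  using assms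
proof (induction M)
  case (add f M)
  let ?K = "\<Union>f\<in>stem B. directions N z l f"
  have f: "is_level N f" using add.prems by simp
  have fin: "finite (rts N f)" using f by (simp add: is_level_def rts_ramified(2))
  have sz: "size (filter_mset (\<lambda>u. u \<notin> ?K) (ball_residues z l (roots_mset N (add_mset f M))))
      = size (filter_mset (\<lambda>u. u \<notin> ?K) (ball_residues z l (mset_set (rts N f))))
       + size (filter_mset (\<lambda>u. u \<notin> ?K) (ball_residues z l (roots_mset N M)))"
    by (simp add: roots_mset_def ball_residues_union)
  have IH: "of_nat (\<Sum>f\<in>#{#f \<in># M. f \<in> tau_prime B#}. degree f)
    = D_bud B * of_nat (size (filter_mset (\<lambda>u. u \<notin> ?K) (ball_residues z l (roots_mset N M))))"
    using add by simp
  have set: "u \<in># ball_residues z l (mset_set (rts N f)) \<longleftrightarrow> (\<exists>w\<in>rts N f. near l w z \<and> u = (w - z) $$ l)" for u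
    using fin by (auto simp: ball_residues_def)
  show ?case
  proof (cases "f \<in> tau_prime B")
    case True
    then have t: "f \<in> tau B" "f \<notin> tau_star B" by (auto simp: tau_prime_def)
    have "filter_mset (\<lambda>u. u \<notin> ?K) (ball_residues z l (mset_set (rts N f))) = ball_residues z l (mset_set (rts N f))"
      unfolding filter_mset_eq_conv using set tau_star_iff[OF f] t(2) by auto
    then show ?thesis using IH True D_bud_count[OF f t(1)] unfolding sz
      by (simp add: algebra_simps size_ball_residues_set[OF fin])
  next
    case False
    have "u \<in> ?K" if "u \<in># ball_residues z l (mset_set (rts N f))" for u
    proof -
      obtain w where w: "w \<in> rts N f" "near l w z" "u = (w - z) $$ l" using \<open>u \<in># _\<close> set by blast
      then have "f \<in> tau B" using tau_iff_near[OF f] by blast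
      then have "f \<in> tau_star B" using False by (simp add: tau_prime_def)
      then show ?thesis using tau_star_iff[OF f w(1,2)] w(3) by simp
    qed
    then have "filter_mset (\<lambda>u. u \<notin> ?K) (ball_residues z l (mset_set (rts N f))) = {#}"
      unfolding filter_mset_eq_mempty_iff by blast
    then show ?thesis using IH False unfolding sz by simp
  qed
qed (simp add: roots_mset_def ball_residues_def)

lemma directions_cong:
  assumes "f \<in> stem B" "f' \<in> stem B" "Fin lam < noc f f'"
  shows "directions N z l f = directions N z l f'"
proof -
  have "directions N z l f \<subseteq> directions N z l f'" if ff: "f \<in> stem B" "f' \<in> stem B" "Fin lam < noc f f'" for f f'
  proof
    fix u assume "u \<in> directions N z l f"
    then obtain w where w: "w \<in> rts N f" "near l w z" "u = (w - z) $$ l" by (auto simp: directions_def)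
    obtain v where v: "v \<in> rts N f'" "near (l + 1) w v"
      using noc_ge_iff(2)[OF stem_level stem_level l w(1)] ff by blast
    have "near l v z" "(v - z) $$ l = u" using v(2) w near_trans near_sym unfolding near_Suc by (blast, simp)
    then show "u \<in> directions N z l f'" using v(1) by (auto simp: directions_def)
  qed
  from this[OF assms] this[OF assms(2,1)] show ?thesis
    using assms noc_sym[of f f'] stem_Rnat by auto
qed

lemma directions_disjoint:
  assumes "f \<in> stem B" "f' \<in> stem B" "directions N z l f \<inter> directions N z l f' \<noteq> {}"
  shows "Fin lam < noc f f'"
proof -
  obtain w v where w: "w \<in> rts N f" "near l w z" and v: "v \<in> rts N f'" "near l v z" and eq: "(w - z) $$ l = (v - z) $$ l"
    using assms(3) by (auto simp: directions_def)
  have "near (l + 1) w v" unfolding near_Suc using w(2) v(2) eq near_trans near_sym by (metis diff_add_cancel fls_minus_nth)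
  then show ?thesis using noc_ge_iff(2)[OF stem_level stem_level l w(1)] assms v(1) by blast
qed

lemma finite_directions: "f \<in> stem B \<Longrightarrow> finite (directions N z l f)"
  using stem_level[of f] by (auto simp: directions_def is_level_def rts_ramified(2))

text \<open>
  The roots of \<open>f\<close> in the ball are counted once directly and once by residues; each
  residue occurs equally often.
\<close>
lemma card_directions:
  assumes f: "f \<in> stem B"
  shows "Dval_star f lam = D_bud B * of_nat (card (directions N z l f))"
proof -
  note lf = stem_level[OF f]
  have Rf: "f \<in> Rnat" using stem_Rnat[OF f] .
  have fin: "finite (rts N f)" using lf by (simp add: is_level_def rts_ramified(2))
  let ?A = "{w \<in> rts N f. near l w z}"
  have ft: "f \<in> tau B" using stem_tau f by blast
  obtain w0 where w0: "w0 \<in> rts N f" "near l w0 z" using ft tau_iff_near[OF lf] by blast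
  define m where "m = card {b \<in> rts N f. near (l + 1) b w0}"
  have "card ?A = card (directions N z l f) * m"
    unfolding directions_def
  proof (rule card_fibers)
    fix a assume a: "a \<in> ?A"
    have "{b \<in> ?A. (b - z) $$ l = (a - z) $$ l} = {b \<in> rts N f. near (l + 1) b a}"
      unfolding near_Suc using a near_trans near_sym by (auto, blast+)
    then show "card {b \<in> ?A. (b - z) $$ l = (a - z) $$ l} = m"
      unfolding m_def using card_near(2)[OF Rf lf _ l] a w0(1) by simp
  qed (use fin in simp)
  moreover have "Dval_star f lam * of_nat m = of_nat (degree f)"
    unfolding m_def by (rule Dval_count(2)[OF Rf lf w0(1) l])
  moreover have "of_nat (degree f) = D_bud B * of_nat (card ?A)" by (rule D_bud_count[OF lf ft])
  moreover have "m > 0" unfolding m_def by (rule card_near_pos[OF lf w0(1)])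
  ultimately show ?thesis by (simp add: algebra_simps)
qed

text \<open>
  The members of \<open>R_star B\<close> are the classes of the stem under contact above the
  level. Elements of the stem in one class have the same residues, elements of different classes
  share none.
\<close>
lemma R_star_sum:
  assumes fin: "finite (stem B)"
  shows "(\<Sum>B'\<in>R_star B. D_star_bud B') = D_bud B * of_nat (card (\<Union>f\<in>stem B. directions N z l f))"
proof -
  define E where "E = {(f, f'). f \<in> stem B \<and> f' \<in> stem B \<and> Fin lam < noc f f'}"
  have E: "equiv (stem B) E"
  proof (rule equivI)
    show "E \<subseteq> stem B \<times> stem B" by (auto simp: E_def)
    show "refl_on (stem B) E" by (auto simp: refl_on_def E_def noc_self[OF stem_Rnat])
    show "sym E"
    proof (rule symI)
      fix x y assume "(x, y) \<in> E"
      then show "(y, x) \<in> E" using noc_sym[of x y] stem_Rnat[of x] stem_Rnat[of y] by (auto simp: E_def)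
    qed
    show "trans E" using noc_trans(2) stem_Rnat unfolding trans_def E_def by blast
  qed
  have cls: "f' \<in> E `` {f} \<longleftrightarrow> f' \<in> stem B \<and> Fin lam < noc f f'" if "f \<in> stem B" for f f'
    using that by (auto simp: E_def)
  have close: "Fin lam < noc x y" if "f \<in> stem B" "x \<in> E `` {f}" "y \<in> E `` {f}" for f x y
    using that noc_trans(2)[of x f y] noc_sym[of x f] stem_Rnat[of x] stem_Rnat[of y] stem_Rnat[of f] by (simp add: cls del: Image_singleton_iff)
  have ts: "tau_star (E `` {f}, Fin lam) = {x \<in> Rnat. Fin lam < noc x f}" if f: "f \<in> stem B" for f
  proof -
    have ff: "f \<in> E `` {f}" using f E by (meson equiv_class_self)
    have "Fin lam < noc x y" if "x \<in> Rnat" "Fin lam < noc x f" "y \<in> E `` {f}" for x y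
      using that noc_trans(2)[of x f y] f stem_Rnat[of y] stem_Rnat[of f] by (simp add: cls del: Image_singleton_iff)
    moreover have "Fin lam < noc x f" if "x \<in> Rnat" "Fin lam < noc x y" "y \<in> E `` {f}" for x y
      using that noc_trans(2)[of x y f] noc_sym[of y f] f stem_Rnat[of y] stem_Rnat[of f] by (simp add: cls del: Image_singleton_iff)
    ultimately show ?thesis using ff unfolding tau_star_def tau_def
      by (auto intro: less_imp_le)
  qed
  have R: "R_star B = (\<lambda>C. (C, Fin lam)) ` (stem B // E)"
  proof (intro equalityI subsetI)
    fix B' assume "B' \<in> R_star B"
    then have B': "strict_bud B' \<or> improper_bud B'" "level B' = Fin lam" "stem B' = tau_star B' \<inter> stem B"
      using B(2) by (auto simp: R_star_def)
    then have s: "strict_bud B'" by (auto simp: improper_bud_def)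
    then obtain f where f: "f \<in> stem B'" by (auto simp: strict_bud_def bud_def)
    then have fB: "f \<in> stem B" using B'(3) by blast
    have "stem B' = E `` {f}"
    proof (intro equalityI subsetI)
      fix x assume "x \<in> stem B'"
      then show "x \<in> E `` {f}" using s f B' by (auto simp: cls[OF fB] strict_bud_def simp del: Image_singleton_iff)
    next
      fix x assume x: "x \<in> E `` {f}"
      then have xR: "x \<in> Rnat" "x \<in> stem B" "Fin lam < noc x f"
        using stem_Rnat[of x] stem_Rnat[OF fB] noc_sym[of x f] fB by (auto simp: cls[OF fB] simp del: Image_singleton_iff)
      have "Fin lam < noc x y" if "y \<in> stem B'" for y
      proof -
        have "Fin lam < noc f y" "y \<in> Rnat" using s f that B'(2) by (auto simp: strict_bud_def bud_def)
        then show ?thesis using noc_trans(2)[of x f y] xR stem_Rnat[OF fB] by blast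
      qed
      then have "x \<in> tau_star B'" using xR f B'(2) unfolding tau_star_def tau_def by (auto intro: less_imp_le)
      then show "x \<in> stem B'" using B'(3) xR by blast
    qed
    then have "B' = (E `` {f}, Fin lam)" using B'(2) by (metis prod.collapse)
    then show "B' \<in> (\<lambda>C. (C, Fin lam)) ` (stem B // E)" using fB by (auto intro: quotientI)
  next
    fix B' assume "B' \<in> (\<lambda>C. (C, Fin lam)) ` (stem B // E)"
    then obtain f where f: "f \<in> stem B" "B' = (E `` {f}, Fin lam)" by (auto elim: quotientE)
    have ff: "f \<in> E `` {f}" using f E by (meson equiv_class_self)
    have sub: "E `` {f} \<subseteq> Rnat" using cls[OF f(1)] stem_Rnat by blast
    have gt: "\<forall>x\<in>E `` {f}. \<forall>y\<in>E `` {f}. Fin lam < noc x y" using close[OF f(1)] by blast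
    then have ge: "\<forall>x\<in>E `` {f}. \<forall>y\<in>E `` {f}. Fin lam \<le> noc x y" by (meson less_imp_le)
    have ne: "E `` {f} \<noteq> {}" using ff by blast
    have "strict_bud B'" unfolding strict_bud_def bud_def f(2) fst_conv snd_conv
      using sub gt ge ne by blast
    moreover have "stem B' = tau_star B' \<inter> stem B"
    proof -
      have "x \<in> E `` {f} \<longleftrightarrow> x \<in> {x \<in> Rnat. Fin lam < noc x f} \<inter> stem B" for x
        unfolding cls[OF f(1)] using stem_Rnat noc_sym[of f x] stem_Rnat[OF f(1)] by auto
      then show ?thesis unfolding f(2) fst_conv ts[OF f(1)] by blast
    qed
    ultimately show "B' \<in> R_star B" using f(2) B(2) by (simp add: R_star_def)
  qed
  define K where "K C = (\<Union>f\<in>C. directions N z l f)" for C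
  have KC: "K (E `` {f}) = directions N z l f" if f: "f \<in> stem B" for f
  proof -
    have "directions N z l x = directions N z l f" if "x \<in> E `` {f}" for x
      using that directions_cong[OF f, of x] by (simp add: cls[OF f] del: Image_singleton_iff)
    moreover have "f \<in> E `` {f}" using f E by (meson equiv_class_self)
    ultimately show ?thesis unfolding K_def by blast
  qed
  have Dst: "D_star_bud (C, Fin lam) = D_bud B * of_nat (card (K C))" if C: "C \<in> stem B // E" for C
  proof -
    obtain f where f: "f \<in> stem B" "C = E `` {f}" using C by (auto elim: quotientE)
    have m: "f \<in> tau_star (C, Fin lam)" unfolding f(2) ts[OF f(1)] using stem_Rnat[OF f(1)] noc_self[OF stem_Rnat[OF f(1)]] by simp
    have c: "Dval_star x lam = Dval_star f lam" if "x \<in> tau_star (C, Fin lam)" for x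
      by (rule Dval_cong(2)) (use that stem_Rnat[OF f(1)] in \<open>auto simp: f(2) ts[OF f(1)]\<close>)
    have "D_star_bud (C, Fin lam) = Dval_star f lam"
    proof -
    have "(THE d. \<forall>x\<in>tau_star (C, Fin lam). Dval_star x lam = d) = Dval_star f lam"
      using m c by (intro the_equality) (blast, metis)
    then show ?thesis by (simp only: D_star_bud_def finval_def extended.case snd_conv)
  qed
    then show ?thesis using card_directions[OF f(1)] KC[OF f(1)] f(2) by simp
  qed
  have finE: "finite (stem B // E)" using fin E by (simp add: finite_quotient equiv_def)
  have "(\<Sum>B'\<in>R_star B. D_star_bud B') = (\<Sum>C\<in>stem B // E. D_star_bud (C, Fin lam))"
    unfolding R by (subst sum.reindex) (auto simp: inj_on_def)
  also have "\<dots> = D_bud B * of_nat (\<Sum>C\<in>stem B // E. card (K C))"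
    by (simp add: Dst sum_distrib_left)
  also have "(\<Sum>C\<in>stem B // E. card (K C)) = card (\<Union>C\<in>stem B // E. K C)"
  proof (rule card_UN_disjoint[symmetric, OF finE])
    show "\<forall>C\<in>stem B // E. finite (K C)" using KC finite_directions by (auto elim!: quotientE)
    show "\<forall>C\<in>stem B // E. \<forall>C'\<in>stem B // E. C \<noteq> C' \<longrightarrow> K C \<inter> K C' = {}"
    proof (intro ballI impI, rule ccontr)
      fix C C' assume C: "C \<in> stem B // E" "C' \<in> stem B // E" "C \<noteq> C'" "K C \<inter> K C' \<noteq> {}"
      obtain f f' where f: "f \<in> stem B" "C = E `` {f}" "f' \<in> stem B" "C' = E `` {f'}" using C by (auto elim!: quotientE)
      then have "Fin lam < noc f f'" using C(4) directions_disjoint KC by simp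
      then have "(f, f') \<in> E" using f by (simp add: E_def)
      then show False using f C(3) equiv_class_eq[OF E] by blast
    qed
  qed
  also have "(\<Union>C\<in>stem B // E. K C) = (\<Union>f\<in>stem B. directions N z l f)"
    using Union_quotient[OF E] unfolding K_def by blast
  finally show ?thesis .
qed

end

end

section \<open>Strength\<close>

lemma sum_mset_Fin: "(\<Sum>f\<in>#M. Fin (h f)) = Fin (\<Sum>f\<in>#M. h f :: rat)"
  by (induction M) (simp_all add: zero_extended_def)

lemma noc_bud_eq:
  fixes B :: "'a::{alg_closed_field, field_char_0} gbud"
  assumes B: "bud B" and h: "h \<in> Rnat" "h \<notin> tau B" and f: "f \<in> tau B"
  shows "noc_bud h B = noc h f" "noc h f < level B"
proof -
  obtain lam g where lam: "level B = Fin lam" and g: "g \<in> stem B" using B by (auto simp: bud_def)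
  obtain N l where N: "is_level N g" "N > 0" "of_int l = lam * of_nat N"
    using levels[of g g g lam] g B by (metis bud_def subsetD)
  obtain z where z: "z \<in> rts N g" using rts_nonempty N unfolding is_level_def by blast
  note it = in_tau_iff[OF B lam N(3) g N(1) z]
  have gR: "g \<in> Rnat" using N(1) by (simp add: is_level_def)
  have cst: "noc h f' = noc h g" if "f' \<in> tau B" for f'
  proof -
    have f': "f' \<in> Rnat" "Fin lam \<le> noc g f'" using that it[of f'] noc_sym[OF gR, of f'] by simp_all
    have "\<not> Fin lam \<le> noc h g" using h it by blast
    then have "noc h g < noc g f'" using f'(2) by (meson not_le less_le_trans)
    then show ?thesis using noc_isosceles[OF h(1) gR f'(1)] by simp
  qed
  then have *: "noc h f' = noc h f" if "f' \<in> tau B" for f' using cst[OF that] cst[OF f] by simp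
  have "noc h ` tau B = (\<lambda>_. noc h f) ` tau B" by (rule image_cong[OF refl *])
  then have "noc h ` tau B = {noc h f}" using f by (simp add: image_constant_conv, blast)
  then show "noc_bud h B = noc h f" unfolding noc_bud_def by (simp add: Least_equality)
  have "g \<in> tau B" using stem_tau[OF B lam N(3) g N(1) z] g by blast
  then have "noc h f = noc h g" using *[of g] by simp
  then show "noc h f < level B" using h it[of h] lam by (simp add: not_le)
qed

text \<open>
  A factor \<open>h\<close> of \<open>G\<close> outside \<open>tau B\<close> has a root at
  normalized distance \<open>noc_bud h B\<close> from \<open>z\<close> and none nearer, so
  \<open>sum_subdegree_far\<close> evaluates its part of the order of \<open>G\<close> on the
  ball.
\<close>
lemma strength_bud:
  fixes B :: "'a::{alg_closed_field, field_char_0} gbud" and G :: "'a fls poly"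
  assumes B: "bud B" "level B = Fin lam" and l: "of_int l = lam * of_nat N"
    and g: "g \<in> stem B" "is_level N g" "z \<in> rts N g"
    and G: "G \<noteq> 0" "\<And>h. h \<in># Rfactors G \<Longrightarrow> is_level N h" "\<And>h. h \<in># Rfactors G \<Longrightarrow> h \<notin> tau B"
  shows "strength G B = Fin (of_int (fls_subdegree (fls_compose_power (lead_coeff G) N)
      + (\<Sum>w\<in>#roots_mset N (Rfactors G). ball_ord z l w)) / of_nat N)"
proof -
  have Np: "N > 0" using g(2) by (simp add: is_level_def)
  have gt: "g \<in> tau B" using stem_tau[OF B l g] g(1) by blast
  have one: "(\<Sum>w\<in>rts N h. of_int (ball_ord z l w)) = of_nat N * (of_nat (degree h) * Sval h (finval (noc_bud h B)))"
    if h: "is_level N h" "h \<notin> tau B" for h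
  proof -
    have hR: "h \<in> Rnat" "degree h dvd N" using h by (auto simp: is_level_def)
    note nb = noc_bud_eq[OF B(1) hR(1) h(2) gt]
    have fin: "finite ((\<lambda>(z, w). root_contact N z w) ` (rts N h \<times> rts N g))"
      "(\<lambda>(z, w). root_contact N z w) ` (rts N h \<times> rts N g) \<noteq> {}"
      using h(1) g(2,3) rts_nonempty[OF hR(1) Np hR(2)] by (auto simp: is_level_def rts_ramified(2))
    have "noc h g \<in> (\<lambda>(z, w). root_contact N z w) ` (rts N h \<times> rts N g)"
      unfolding noc_eq_Max[OF h(1) g(2)] by (rule Max_in[OF fin])
    then obtain u v :: "'a fls" where uv: "noc h g = root_contact N u v" by auto
    obtain l' where l': "noc h g = Fin (of_int l' / of_nat N)"
      using nb(2) B(2) uv by (auto simp: root_contact_def ordX_fls_def split: if_splits)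
    define \<nu> where "\<nu> = (of_int l' / of_nat N :: rat)"
    have nu: "noc h g = Fin \<nu>" "of_int l' = \<nu> * of_nat N" using l' Np by (simp_all add: \<nu>_def)
    have sy: "noc g h = Fin \<nu>" using nu(1) noc_sym[OF hR(1)] g(2) by (simp add: is_level_def)
    obtain w1 where w1: "w1 \<in> rts N h" "near l' z w1"
      using noc_ge_iff(1)[OF g(2) h(1) nu(2) g(3)] sy by auto
    have far: "\<not> near (l' + 1) z w" if "w \<in> rts N h" for w
      using noc_ge_iff(2)[OF g(2) h(1) nu(2) g(3)] sy that by auto
    have "\<not> near l w z" if "w \<in> rts N h" for w using tau_iff_near[OF B l g h(1)] h(2) that by blast
    then have "(\<Sum>w\<in>rts N h. of_int (ball_ord z l w)) = (\<Sum>w\<in>rts N h. of_int (fls_subdegree (z - w)) :: rat)"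
      by (intro sum.cong refl) (simp add: ball_ord_def)
    also have "\<dots> = of_nat N * of_nat (degree h) * Sval h \<nu>"
      by (rule sum_subdegree_far[OF hR(1) h(1) nu(2) w1 far])
    finally show ?thesis using nb(1) nu(1) by (simp add: finval_def)
  qed
  have many: "of_int (\<Sum>w\<in>#roots_mset N M. ball_ord z l w)
      = of_nat N * (\<Sum>f\<in>#M. of_nat (degree f) * Sval f (finval (noc_bud f B)))"
    if "\<And>h. h \<in># M \<Longrightarrow> is_level N h \<and> h \<notin> tau B" for M
    using that
  proof (induction M)
    case (add h M)
    have "(\<Sum>w\<in>#mset_set (rts N h). ball_ord z l w) = (\<Sum>w\<in>rts N h. ball_ord z l w)"
      by (simp add: sum_unfold_sum_mset)
    then show ?case using add one[of h] by (simp add: roots_mset_def algebra_simps)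
  qed (simp add: roots_mset_def)
  have "lead_coeff G \<noteq> 0" using G(1) by simp
  then have "strength G B = Fin (of_int (fls_subdegree (lead_coeff G))
      + (\<Sum>f\<in>#Rfactors G. of_nat (degree f) * Sval f (finval (noc_bud f B))))"
    unfolding strength_def B(2) by (simp add: ordX_fls_def sum_mset_Fin)
  also have "(\<Sum>f\<in>#Rfactors G. of_nat (degree f) * Sval f (finval (noc_bud f B)))
    = of_int (\<Sum>w\<in>#roots_mset N (Rfactors G). ball_ord z l w) / of_nat N"
    using many[of "Rfactors G"] G(2,3) Np by simp
  also have "of_int (fls_subdegree (lead_coeff G)) = (of_int (fls_subdegree (fls_compose_power (lead_coeff G) N)) / of_nat N :: rat)"
    using Np by (simp add: fls_subdegree_compose_power)
  finally show ?thesis by (simp add: add_divide_distrib)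
qed

text \<open>
  Passing to a smaller ball does not change the contact with polynomials outside the larger one.
\<close>
lemma strength_mono:
  fixes B B' :: "'a::{alg_closed_field, field_char_0} gbud"
  assumes B: "bud B \<or> improper_bud B" and B': "bud B'" and sub: "tau B' \<subseteq> tau B"
    and G: "G \<noteq> 0" "Omega B G = 1"
  shows "Omega B' G = 1" "strength G B' = strength G B"
proof -
  have out: "\<forall>f\<in>#Rfactors G. f \<notin> tau B" using G Omega_eq_1_iff by blast
  then show "Omega B' G = 1" using Omega_eq_1_iff[OF G(1)] sub by blast
  obtain lam' where lam': "level B' = Fin lam'" using B' by (auto simp: bud_def)
  obtain f where f: "f \<in> tau B'"
  proof -
    obtain f where f: "f \<in> stem B'" using B' by (auto simp: bud_def)
    then have fR: "f \<in> Rnat" using B' by (auto simp: bud_def)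
    have "f \<in> tau B'" unfolding tau_def using f fR B' by (auto simp: bud_def)
    then show ?thesis using that by blast
  qed
  show "strength G B' = strength G B"
  proof (cases "improper_bud B")
    case True
    then have "tau B = Rnat" by (auto simp: tau_def improper_bud_def)
    then have "Rfactors G = {#}" using out Rfactors(1)[OF G(1)] by (metis multiset_nonemptyE subsetD)
    then show ?thesis using True lam' by (simp add: strength_def improper_bud_def)
  next
    case False
    then have B: "bud B" using B by blast
    obtain lam where lam: "level B = Fin lam" using B by (auto simp: bud_def)
    have "noc_bud h B' = noc_bud h B" if "h \<in># Rfactors G" for h
    proof -
      have h: "h \<in> Rnat" "h \<notin> tau B" "h \<notin> tau B'" using that out sub Rfactors(1)[OF G(1)] by auto
      show ?thesis using noc_bud_eq(1)[OF B h(1,2)] noc_bud_eq(1)[OF B' h(1,3) f] f sub by auto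
    qed
    then have "image_mset (\<lambda>h. Fin (of_nat (degree h) * Sval h (finval (noc_bud h B')))) (Rfactors G)
      = image_mset (\<lambda>h. Fin (of_nat (degree h) * Sval h (finval (noc_bud h B)))) (Rfactors G)"
      by (intro image_mset_cong) simp
    then show ?thesis using lam lam' by (simp add: strength_def)
  qed
qed

section \<open>Degrees of the slices of a bud\<close>

text \<open>
  On a ball without roots of \<open>G\<close>, the leading form of each of these is, up to a
  constant factor, the derivative of the leading form of \<open>F\<close>. For the Jacobian this
  requires a nonzero strength.
\<close>
definition derived :: "'a::{alg_closed_field, field_char_0} fls poly \<Rightarrow> 'a fls poly \<Rightarrow> 'a gbud \<Rightarrow> 'a fls poly set" where
  "derived F G B = {DY F, DY (F * G)} \<union> (if strength G B \<noteq> 0 then {jac F G} else {})"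

text \<open>
  The proof also uses buds outside the tree: small ones that isolate a single root of
  \<open>F\<close>, and candidates for members of the tree.
\<close>
definition adapted :: "'a::{alg_closed_field, field_char_0} fls poly \<Rightarrow> 'a fls poly \<Rightarrow> 'a gbud \<Rightarrow> bool" where
  "adapted F G B \<longleftrightarrow> bud B \<and> stem B = {f. f \<in># Rfactors F \<and> f \<in> tau B} \<and> Omega B G = 1"

text \<open>
  With \<open>m = size U\<close> roots of \<open>F\<close> in the ball, having \<open>r\<close>
  distinct residues, the derivative of the leading form shows \<open>m - 1\<close> roots of
  \<open>H\<close> in the ball, of which \<open>r - 1\<close> lie in no open sub-ball with a root
  of \<open>F\<close>.
\<close>
lemma adapted_degrees:
  fixes F G H :: "'a::{alg_closed_field, field_char_0} fls poly"
  assumes F: "F \<noteq> 0" "\<And>f. f \<in># Rfactors F \<Longrightarrow> count (Rfactors F) f = 1"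
    and G: "G \<noteq> 0" and B: "adapted F G B" and H: "H \<in> derived F G B"
    and lam: "level B = Fin lam" and l: "of_int l = lam * of_nat N"
    and g: "g \<in> stem B" "z \<in> rts N g"
    and lv: "\<And>f. f \<in># Rfactors F \<Longrightarrow> is_level N f" "\<And>f. f \<in># Rfactors G \<Longrightarrow> is_level N f"
      "\<And>f. f \<in># Rfactors H \<Longrightarrow> is_level N f"
  defines "U \<equiv> ball_residues z l (roots_mset N (Rfactors F))"
  shows "H \<noteq> 0" "of_nat (degree (Omega B H)) = D_pprime B" "of_nat (degree (Omega_prime B H)) = D_prime B"
    "U \<noteq> {#}" "D_pprime B = D_bud B * (of_nat (size U) - 1)" "D_prime B = D_bud B * (of_nat (card (set_mset U)) - 1)"
proof -
  have bud: "bud B" and st: "stem B = {f. f \<in># Rfactors F \<and> f \<in> tau B}" and OG: "Omega B G = 1"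
    using B by (auto simp: adapted_def)
  have gl: "is_level N g" using g(1) st lv(1) by blast
  have Np: "N > 0" using gl by (simp add: is_level_def)
  note ctx = bud lam l g(1) gl g(2)
  have outG: "\<And>f. f \<in># Rfactors G \<Longrightarrow> f \<notin> tau B" using OG Omega_eq_1_iff[OF G] by blast
  have sl: "\<And>f. f \<in> stem B \<Longrightarrow> is_level N f" using st lv(1) by blast
  define q where "q = (\<Prod>u\<in>#U. [:-u, 1:])"
  let ?c = "\<lambda>P::'a fls poly. fls_compose_power (lead_coeff P) N"
  have cnz: "?c P \<noteq> 0" if "P \<noteq> 0" for P using that Np by simp
  obtain KF where KF: "KF \<noteq> 0" "lform (fls_subdegree (?c F) + (\<Sum>w\<in>#roots_mset N (Rfactors F). ball_ord z l w)) (loc z l (ramify N F)) (smult KF q)"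
    using lform_loc_split[OF cnz[OF F(1)] ramify_split[OF F(1) Np lv(1)]] unfolding U_def q_def by blast
  define s where "s = fls_subdegree (?c F) + (\<Sum>w\<in>#roots_mset N (Rfactors F). ball_ord z l w)"
  define t where "t = fls_subdegree (?c G) + (\<Sum>w\<in>#roots_mset N (Rfactors G). ball_ord z l w)"
  obtain KG where KG: "KG \<noteq> 0" "lform t (loc z l (ramify N G)) (smult KG (\<Prod>u\<in>#ball_residues z l (roots_mset N (Rfactors G)). [:-u, 1:]))"
    using lform_loc_split[OF cnz[OF G] ramify_split[OF G Np lv(2)]] unfolding t_def by blast
  have "ball_residues z l (roots_mset N (Rfactors G)) = {#}"
  proof -
    have "\<not> near l w z" if "w \<in># roots_mset N (Rfactors G)" for w
    proof -
      obtain f where f: "f \<in># Rfactors G" "w \<in># mset_set (rts N f)"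
        using \<open>w \<in># roots_mset N (Rfactors G)\<close> by (auto simp: roots_mset_def)
      then have "w \<in> rts N f" by (metis count_eq_zero_iff count_mset_set(3) finite_set_mset_mset_set mset_set.infinite)
      then show ?thesis using tau_iff_near[OF ctx lv(2)[OF f(1)]] outG[OF f(1)] by blast
    qed
    then show ?thesis by (simp add: ball_residues_def)
  qed
  then have Gf: "lform t (loc z l (ramify N G)) [:KG:]" using KG(2) by simp
  have Ff: "lform s (loc z l (ramify N F)) (smult KF q)" using KF(2) s_def by simp
  have str: "strength G B = Fin (of_int t / of_nat N)"
    unfolding t_def by (rule strength_bud[OF ctx G lv(2) outG])
  have "\<exists>s' \<kappa>. \<kappa> \<noteq> 0 \<and> lform s' (loc z l (ramify N H)) (smult \<kappa> (pderiv q))"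
  proof -
    consider "H = DY F" | "H = DY (F * G)" | "H = jac F G" "strength G B \<noteq> 0"
      using H by (auto simp: derived_def split: if_splits)
    then show ?thesis
    proof cases
      case 1
      then show ?thesis using lform_DY[OF Np Ff] KF(1) by (auto simp: pderiv_smult)
    next
      case 2
      have "lform (s + t) (loc z l (ramify N (F * G))) (smult KF q * [:KG:])"
        unfolding ramify_mult loc_mult by (rule lform_mult[OF Ff Gf])
      from lform_DY[OF Np this] have "lform (s + t - l) (loc z l (ramify N H)) (smult (KG * KF) (pderiv q))"
        by (simp add: 2 pderiv_smult)
      then show ?thesis using KF(1) KG(1) by (metis mult_eq_0_iff)
    next
      case 3
      have "t \<noteq> 0" using 3(2) str by (auto simp: zero_extended_def)
      then have "- (of_int t * KG) / of_nat N * KF \<noteq> 0" using KF(1) KG(1) Np by simp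
      moreover have "lform (s + t - l - int N) (loc z l (ramify N H)) (smult (- (of_int t * KG) / of_nat N * KF) (pderiv q))"
        using lform_jac[OF Np Ff Gf] 3(1) by (simp add: pderiv_smult)
      ultimately show ?thesis by blast
    qed
  qed
  then obtain s' \<kappa> where lf: "\<kappa> \<noteq> 0" "lform s' (loc z l (ramify N H)) (smult \<kappa> (pderiv q))" by blast
  let ?D = "\<Union>f\<in>stem B. directions N z l f"
  have KU: "set_mset U = ?D"
  proof -
    have fin: "finite (rts N f)" if "f \<in># Rfactors F" for f using lv(1)[OF that] by (simp add: is_level_def rts_ramified(2))
    have "w \<in># roots_mset N (Rfactors F) \<and> near l w z \<longleftrightarrow> (\<exists>f\<in>stem B. w \<in> rts N f \<and> near l w z)" for w
    proof -
      have "w \<in># roots_mset N (Rfactors F) \<longleftrightarrow> (\<exists>f\<in>#Rfactors F. w \<in> rts N f)"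
        using fin by (auto simp: roots_mset_def)
      then show ?thesis unfolding st using tau_iff_near[OF ctx lv(1)] by blast
    qed
    then show ?thesis unfolding U_def ball_residues_def directions_def by auto
  qed
  have "z \<in> {w \<in> rts N g. near l w z}" using g(2) by simp
  then have "?D \<noteq> {}" using g(1) unfolding directions_def by blast
  then show U0: "U \<noteq> {#}" using KU by auto
  have df: "degree q \<noteq> 0" using U0 by (simp add: q_def degree_prod_linear)
  then have "pderiv q \<noteq> 0" by (simp add: pderiv_eq_0_iff)
  then have "ramify N H \<noteq> 0" using lform_nonzero[OF lf(2)] lf(1) by (auto simp: loc_def)
  then show H0: "H \<noteq> 0" by auto
  note cnt = ball_residues_pderiv[OF U0 lf(1) cnz[OF H0] ramify_split[OF H0 Np lv(3)] lf(2)[unfolded q_def]]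
  let ?R = "ball_residues z l (roots_mset N (Rfactors H))"
  have finst: "finite (stem B)" unfolding st by simp
  have "{#f \<in># Rfactors F. f \<in> tau B#} = mset_set (stem B)"
    
  proof (rule multiset_eqI)
    fix f show "count {#f \<in># Rfactors F. f \<in> tau B#} f = count (mset_set (stem B)) f"
      using F(2)[of f] finst by (cases "f \<in> stem B") (auto simp: st not_in_iff)
  qed
  moreover have "of_nat (\<Sum>f\<in>#{#f \<in># Rfactors F. f \<in> tau B#}. degree f) = D_bud B * of_nat (size U)"
    unfolding U_def by (rule sum_degree_tau[OF ctx lv(1)])
  ultimately have "of_nat (\<Sum>f\<in>stem B. degree f) = D_bud B * of_nat (size U)"
    by (simp only: sum_unfold_sum_mset)
  then show pp: "D_pprime B = D_bud B * (of_nat (size U) - 1)"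
    unfolding D_pprime_def using lam by (simp add: algebra_simps)
  show pr: "D_prime B = D_bud B * (of_nat (card (set_mset U)) - 1)"
    unfolding D_prime_def KU using lam R_star_sum[OF ctx sl finst] by (simp add: algebra_simps)
  have "of_nat (degree (Omega B H)) = D_bud B * of_nat (size ?R)"
    unfolding degree_Omega(1)[OF H0] by (rule sum_degree_tau[OF ctx lv(3)])
  also have "of_nat (size ?R) = (of_nat (size U) - 1 :: rat)"
    using cnt(1) by (metis add_diff_cancel_right' of_nat_1 of_nat_add)
  finally show "of_nat (degree (Omega B H)) = D_pprime B" using pp by simp
  have "of_nat (degree (Omega_prime B H)) = D_bud B * of_nat (size (filter_mset (\<lambda>u. u \<notin># U) ?R))"
    unfolding degree_Omega(2)[OF H0] KU by (rule sum_degree_tau_prime[OF ctx sl lv(3)])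
  also have "of_nat (size (filter_mset (\<lambda>u. u \<notin># U) ?R)) = (of_nat (card (set_mset U)) - 1 :: rat)"
    using cnt(2) by (metis add_diff_cancel_right' of_nat_1 of_nat_add)
  finally show "of_nat (degree (Omega_prime B H)) = D_prime B" using pr by simp
qed

section \<open>Characteristic exponents as contacts of conjugates\<close>

text \<open>
  The groups of \<open>char_e f i\<close>-th roots of unity form a descending chain from all
  rotations to the trivial one. The rotation between the two roots leaves it at some step, and the
  roots part at the corresponding exponent. Were the exponent integral after normalization,
  \<open>char_e\<close> would not drop there.
\<close>
lemma conjugates_contact_char:
  fixes f :: "'a::{alg_closed_field, field_char_0} fls poly"
  assumes N: "is_level N f" and l: "of_int l = (lam::rat) * of_nat N"
    and w: "w \<in> rts N f" "w' \<in> rts N f" "near l w w'" "\<not> near (l + 1) w w'"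
  shows "\<exists>i. 1 \<le> i \<and> i \<le> char_h f \<and> char_c f i = lam \<and> lam \<notin> \<int>"
proof -
  define n k where "n = degree f" and "k = N div degree f"
  have f: "f \<in> Rnat" using N by (simp add: is_level_def)
  have n: "n > 0" "N > 0" "n dvd N" using N Rnat_degree_pos[OF f] by (auto simp: is_level_def n_def)
  have Nk: "N = n * k" "k > 0" using n k_def n_def by (auto intro: Nat.gr0I)
  obtain \<xi> where \<xi>: "\<xi> \<in> unity N" "w' = rot \<xi> (fls_compose_power (base_root f) k)"
    and bij: "bij_betw (\<lambda>w. rot \<xi> (fls_compose_power w k)) (rts n f) (rts N f)"
    using rts_shift_to_base[OF f N w(2) k_def] n_def by blast
  have nz: "\<xi> \<noteq> 0" using \<xi>(1) n unity_nonzero by blast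
  obtain w0 where w0: "w0 \<in> rts n f" "w = rot \<xi> (fls_compose_power w0 k)"
    using w(1) bij_betw_imp_surj_on[OF bij] by blast
  obtain \<zeta> where z: "\<zeta> \<in> unity n" "w0 = rot \<zeta> (base_root f)" using w0(1) rts_base[OF f n_def] by blast
  define e where "e = fls_subdegree (w0 - base_root f)"
  have ne: "w0 \<noteq> base_root f" using w(4) w0(2) \<xi>(2) by auto
  have nr: "near l' w w' \<longleftrightarrow> l' \<le> int k * e" for l'
  proof -
    have "near l' w w' \<longleftrightarrow> near l' (fls_compose_power w0 k) (fls_compose_power (base_root f) k)"
      unfolding w0(2) \<xi>(2) by (rule near_rot[OF nz])
    also have "\<dots> \<longleftrightarrow> l' \<le> fls_subdegree (fls_compose_power (w0 - base_root f) k)"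
      unfolding near_iff_subdegree using ne Nk(2) by (simp add: fls_compose_power_inj)
    also have "\<dots> \<longleftrightarrow> l' \<le> int k * e" unfolding fls_subdegree_compose_power[OF Nk(2)] e_def ..
    finally show ?thesis .
  qed
  have le: "l = int k * e" using w(3,4) unfolding nr by simp
  have "of_nat k * of_int e = lam * (of_nat n * of_nat k)" using l le Nk(1) by (metis of_int_mult of_int_of_nat_eq of_nat_mult)
  then have lam: "lam = of_int e / of_nat n" using Nk n by (simp add: field_simps)
  have "\<zeta> \<notin> unity 1" using ne z(2) by (auto simp: unity_def)
  then have last: "\<zeta> \<notin> unity (nat (char_e f (char_h f)))" using char_e_h[OF f] by simp
  define j where "j = (LEAST j. \<zeta> \<notin> unity (nat (char_e f j)))"
  have j: "\<zeta> \<notin> unity (nat (char_e f j))" "j \<le> char_h f"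
    unfolding j_def using LeastI[of "\<lambda>j. \<zeta> \<notin> unity (nat (char_e f j))", OF last] Least_le[of "\<lambda>j. \<zeta> \<notin> unity (nat (char_e f j))", OF last] by auto
  have "j \<noteq> 0"
  proof
    assume "j = 0"
    then show False using j(1) z(1) n_def by simp
  qed
  then obtain p where p: "j = Suc p" by (cases j) auto
  have zp: "\<zeta> \<in> unity (nat (char_e f p))"
    using not_less_Least[of p "\<lambda>j. \<zeta> \<notin> unity (nat (char_e f j))"] p j_def by auto
  have ph: "p < char_h f" using j(2) p by simp
  have e: "e = char_m f (Suc p)"
    unfolding e_def z(2) using subdegree_on_layer[OF f ph zp] j(1) p by blast
  have c: "char_c f (Suc p) = lam" unfolding char_c_def lam e n_def ..
  have "lam \<notin> \<int>"
  proof
    assume "lam \<in> \<int>"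
    then obtain i where "lam = of_int i" by (auto elim: Ints_cases)
    then have "(of_int e :: rat) = of_int (i * int n)" using lam n by (simp add: field_simps)
    then have "int n dvd e" unfolding of_int_eq_iff by simp
    then have "char_e f p dvd char_m f (Suc p)" using char_e_dvd[of 0 p f] e n_def by (auto intro: dvd_trans)
    then have "char_e f (Suc p) = char_e f p" using char_e_pos[OF f, of p] by (simp add: char_e_Suc gcd_proj1_if_dvd_int)
    then show False using zp j(1) p by simp
  qed
  then show ?thesis using c ph by (intro exI[of _ "Suc p"]) auto
qed

text \<open>
  Suppose that the contact of \<open>f\<close> and \<open>f'\<close> exceeds the distance of
  \<open>w\<close> and \<open>v\<close>. Then \<open>f\<close> has another root closer to
  \<open>v\<close>, whose distance from its conjugate \<open>w\<close> is the same, hence a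
  characteristic exponent.
\<close>
lemma contact_setI:
  fixes f f' :: "'a::{alg_closed_field, field_char_0} fls poly"
  assumes N: "is_level N f" "is_level N f'" and l: "of_int l = (lam::rat) * of_nat N"
    and w: "w \<in> rts N f" "v \<in> rts N f'" "near l w v" "\<not> near (l + 1) w v"
    and H: "f \<in># Rfactors H" "f' \<in># Rfactors H"
  shows "lam \<in> contact_set H"
proof (cases "noc f f' = Fin lam")
  case True
  have "f \<noteq> f'" using True noc_self[of f] N(1) by (auto simp: is_level_def)
  then show ?thesis using True H unfolding contact_set_def by blast
next
  case False
  have "Fin lam \<le> noc f f'" using noc_ge_iff(1)[OF N l w(1)] w by blast
  then have "Fin lam < noc f f'" using False by simp
  then have "Fin lam < noc f' f" using noc_sym[of f f'] N by (simp add: is_level_def)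
  then obtain w' where w': "w' \<in> rts N f" "near (l + 1) v w'" using noc_ge_iff(2)[OF N(2,1) l w(2)] by blast
  have "near l w w'" using w(3) w'(2) near_trans unfolding near_Suc by blast
  moreover have "\<not> near (l + 1) w w'" using w(4) w'(2) near_trans near_sym by blast
  ultimately obtain i where "1 \<le> i" "i \<le> char_h f" "char_c f i = lam" "lam \<notin> \<int>"
    using conjugates_contact_char[OF N(1) l w(1) w'(1)] by blast
  then show ?thesis using H(1) unfolding contact_set_def by blast
qed

section \<open>The theorem for a single bud\<close>

lemma Rfactors_subset: "set_mset (Rfactors H) \<subseteq> Rnat"
  using Rfactors(1)[of H] by (cases "H = 0") (auto simp: Rfactors_def)

lemma mset_prod_partition:
  fixes M :: "'b::comm_monoid_mult multiset"
  assumes "finite P" "\<And>f. f \<in># M \<Longrightarrow> Q f \<Longrightarrow> \<exists>!B. B \<in> P \<and> R B f"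
    "\<And>f B. f \<in># M \<Longrightarrow> B \<in> P \<Longrightarrow> R B f \<Longrightarrow> Q f"
  shows "prod_mset (filter_mset Q M) = (\<Prod>B\<in>P. prod_mset (filter_mset (R B) M))"
  using assms(2,3)
proof (induction M)
  case (add f M)
  have IH: "prod_mset (filter_mset Q M) = (\<Prod>B\<in>P. prod_mset (filter_mset (R B) M))"
    using add.prems by (intro add.IH) auto
  have "(\<Prod>B\<in>P. prod_mset (filter_mset (R B) (add_mset f M)))
      = (\<Prod>B\<in>P. (if R B f then f else 1) * prod_mset (filter_mset (R B) M))"
    by (rule prod.cong) auto
  also have "\<dots> = (\<Prod>B\<in>P. if R B f then f else 1) * prod_mset (filter_mset Q M)"
    unfolding prod.distrib IH ..
  also have "(\<Prod>B\<in>P. if R B f then f else 1) = (if Q f then f else 1)"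
  proof (cases "Q f")
    case True
    then obtain B0 where B0: "B0 \<in> P" "R B0 f" "\<And>B. B \<in> P \<Longrightarrow> R B f \<Longrightarrow> B = B0"
      using add.prems(1)[of f] by auto
    have "(\<Prod>B\<in>P. if R B f then f else 1) = (\<Prod>B\<in>P. if B = B0 then f else 1)"
    proof (rule prod.cong[OF refl])
      fix B assume "B \<in> P"
      then have "R B f \<longleftrightarrow> B = B0" using B0 by blast
      then show "(if R B f then f else 1) = (if B = B0 then f else 1)" by (simp only:)
    qed
    then show ?thesis using True B0(1) assms(1) by simp
  next
    case False
    then have "(\<Prod>B\<in>P. if R B f then f else 1) = (\<Prod>B\<in>P. 1)"
      using add.prems(2)[of f] by (intro prod.cong) auto
    then show ?thesis using False by simp
  qed
  finally show ?case by simp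
qed simp

lemma bud_tau:
  fixes B :: "'a::{alg_closed_field, field_char_0} gbud"
  assumes B: "bud B" "level B = Fin lam" and x: "x \<in> tau B"
  shows "tau B = {y \<in> Rnat. Fin lam \<le> noc y x}"
proof -
  obtain g where g: "g \<in> stem B" using B(1) by (auto simp: bud_def)
  have gR: "g \<in> Rnat" using g B(1) by (auto simp: bud_def)
  obtain N l where N: "is_level N g" "N > 0" "of_int l = lam * of_nat N" using levels[OF gR gR gR, of lam] by metis
  obtain z where z: "z \<in> rts N g" using rts_nonempty N unfolding is_level_def by blast
  note it = in_tau_iff[OF B N(3) g N(1) z]
  have xR: "x \<in> Rnat" "Fin lam \<le> noc x g" "Fin lam \<le> noc g x" using x it[of x] noc_sym[OF gR, of x] by auto
  have "y \<in> tau B \<longleftrightarrow> y \<in> Rnat \<and> Fin lam \<le> noc y x" for y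
    unfolding it using noc_trans(1)[of y g x] noc_trans(1)[of y x g] xR gR by blast
  then show ?thesis by blast
qed

lemma stem_subset_tau:
  assumes "bud B \<or> improper_bud B" shows "stem B \<subseteq> tau B"
  using assms by (auto simp: bud_def improper_bud_def tau_def)

lemma improper_tau: "improper_bud B \<Longrightarrow> tau B = Rnat"
  by (auto simp: improper_bud_def tau_def)

lemma sub_bud_tau:
  fixes B B' :: "'a::{alg_closed_field, field_char_0} gbud"
  assumes B: "bud B \<or> improper_bud B" and B': "bud B'" "level B \<le> level B'" and f: "f \<in> tau B" "f \<in> tau B'"
  shows "tau B' \<subseteq> tau B"
proof (cases "improper_bud B")
  case True
  show ?thesis unfolding improper_tau[OF True] by (auto simp: tau_def)
next
  case False
  then have b: "bud B" using B by blast
  obtain lam lam' where l: "level B = Fin lam" "level B' = Fin lam'" using b B'(1) by (auto simp: bud_def)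
  have "Fin lam \<le> Fin lam'" using B'(2) l by simp
  then show ?thesis unfolding bud_tau[OF b l(1) f(1)] bud_tau[OF B'(1) l(2) f(2)]
    by (auto intro: order_trans simp del: less_eq_extended.simps)
qed

lemma isolating_level:
  assumes "finite A"
  shows "\<exists>l\<ge>l0. \<forall>w\<in>A. near l w (z :: 'a::ab_group_add fls) \<longrightarrow> w = z"
  using assms
proof induction
  case (insert w A)
  then obtain l where l: "l \<ge> l0" "\<forall>w\<in>A. near l w z \<longrightarrow> w = z" by blast
  have "\<exists>l'. near l' w z \<longrightarrow> w = z"
    by (rule exI[of _ "fls_subdegree (w - z) + 1"]) (auto simp: near_iff_subdegree)
  then obtain l' where l': "near l' w z \<longrightarrow> w = z" by blast
  show ?case using l l' near_mono[of "max l l'" _ z]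
    by (intro exI[of _ "max l l'"]) (metis insert_iff max.cobounded1 max.cobounded2 order_trans)
qed auto

context
  fixes F G :: "'a::{alg_closed_field, field_char_0} fls poly"
  assumes F0: "F \<noteq> 0" and Fs: "\<And>f. f \<in># Rfactors F \<Longrightarrow> count (Rfactors F) f = 1" and G0: "G \<noteq> 0"
begin

lemma adapted_level:
  fixes H :: "'a fls poly"
  assumes "adapted F G B" "level B = Fin lam"
  obtains N l g z where "of_int l = lam * of_nat N" "N > 0" "g \<in> stem B" "z \<in> rts N g"
      "\<And>f. f \<in># Rfactors F \<Longrightarrow> is_level N f" "\<And>f. f \<in># Rfactors G \<Longrightarrow> is_level N f"
      "\<And>f. f \<in># Rfactors H \<Longrightarrow> is_level N f"
proof -
  have "set_mset (Rfactors F) \<union> set_mset (Rfactors G) \<union> set_mset (Rfactors H) \<subseteq> Rnat"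
    using Rfactors_subset by blast
  then obtain N l where N: "\<And>f. f \<in> set_mset (Rfactors F) \<union> set_mset (Rfactors G) \<union> set_mset (Rfactors H) \<Longrightarrow> is_level N f" "N > 0" "of_int l = lam * of_nat N"
    using level_exists[of "set_mset (Rfactors F) \<union> set_mset (Rfactors G) \<union> set_mset (Rfactors H)" lam]
    by (metis finite_UnI finite_set_mset)
  obtain g where g: "g \<in> stem B" using assms(1) unfolding adapted_def bud_def by blast
  then have "is_level N g" using N(1) assms(1) by (auto simp: adapted_def)
  then obtain z where "z \<in> rts N g" using rts_nonempty unfolding is_level_def by blast
  then show ?thesis using that[OF N(3,2) g] N(1) by blast
qed

lemma adapted_main:
  assumes B: "adapted F G B" and H: "H \<in> derived F G B"
  shows "H \<noteq> 0" "of_nat (degree (Omega B H)) = D_pprime B" "of_nat (degree (Omega_prime B H)) = D_prime B"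
    and "D_prime B \<noteq> 0 \<Longrightarrow> level B = Fin lam \<Longrightarrow> lam \<in> contact_set F"
proof -
  obtain mu where mu: "level B = Fin mu" using B by (auto simp: adapted_def bud_def)
  obtain N l g z where N: "of_int l = mu * of_nat N" "N > 0" and g: "g \<in> stem B" "z \<in> rts N g"
    and lv: "\<And>f. f \<in># Rfactors F \<Longrightarrow> is_level N f" "\<And>f. f \<in># Rfactors G \<Longrightarrow> is_level N f"
      "\<And>f. f \<in># Rfactors H \<Longrightarrow> is_level N f"
    by (rule adapted_level[OF B mu, where H = H]) blast
  note ad = adapted_degrees[OF F0 Fs G0 B H mu N(1) g lv]
  show "H \<noteq> 0" "of_nat (degree (Omega B H)) = D_pprime B" "of_nat (degree (Omega_prime B H)) = D_prime B"
    by (rule ad; assumption)+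
  let ?U = "ball_residues z l (roots_mset N (Rfactors F))"
  assume "D_prime B \<noteq> 0" and lam: "level B = Fin lam"
  then have "card (set_mset ?U) \<noteq> 1" using ad(6) by auto
  obtain u1 where u1: "u1 \<in># ?U" using ad(4) by (meson multiset_nonemptyE)
  have "set_mset ?U \<noteq> {u1}" using \<open>card (set_mset ?U) \<noteq> 1\<close> by auto
  then obtain u2 where u2: "u2 \<in># ?U" "u1 \<noteq> u2" using u1 by blast
  have ex: "\<exists>f w. f \<in># Rfactors F \<and> w \<in> rts N f \<and> near l w z \<and> (w - z) $$ l = u" if "u \<in># ?U" for u
  proof -
    obtain w where w: "w \<in># roots_mset N (Rfactors F)" "near l w z" "(w - z) $$ l = u"
      using \<open>u \<in># ?U\<close> unfolding ball_residues_def by auto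
    then obtain f where f: "f \<in># Rfactors F" "w \<in># mset_set (rts N f)" by (auto simp: roots_mset_def)
    have "finite (rts N f)" using lv(1)[OF f(1)] by (simp add: is_level_def rts_ramified(2))
    then show ?thesis using f w by auto
  qed
  obtain f1 w1 where 1: "f1 \<in># Rfactors F" "w1 \<in> rts N f1" "near l w1 z" "(w1 - z) $$ l = u1" using ex[OF u1] by blast
  obtain f2 w2 where 2: "f2 \<in># Rfactors F" "w2 \<in> rts N f2" "near l w2 z" "(w2 - z) $$ l = u2" using ex[OF u2(1)] by blast
  have "near l w1 w2" using 1(3) 2(3) near_trans near_sym by blast
  moreover have "\<not> near (l + 1) w1 w2" using 1(4) 2(4) u2(2) unfolding near_Suc by auto
  moreover have "lam = mu" using lam mu by simp
  ultimately show "lam \<in> contact_set F"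
    using contact_setI[OF lv(1)[OF 1(1)] lv(1)[OF 2(1)] N(1) 1(2) 2(2) _ _ 1(1) 2(1)] by simp
qed

lemma derived_mono:
  assumes "bud B \<or> improper_bud B" "bud B'" "tau B' \<subseteq> tau B" "Omega B G = 1"
  shows "derived F G B' = derived F G B"
  using strength_mono(2)[OF assms(1-3) G0 assms(4)] by (simp add: derived_def)

text \<open>
  On a ball that isolates one root of \<open>f\<close> from all other roots of \<open>F\<close>,
  the polynomial \<open>H\<close> has no root, since the leading form of \<open>F\<close> is
  linear there.
\<close>
lemma derived_no_common_factor:
  assumes B: "bud B \<or> improper_bud B" and OG: "Omega B G = 1" and f: "f \<in># Rfactors F" "f \<in> stem B"
    and H: "H \<in> derived F G B"
  shows "f \<notin># Rfactors H"
proof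
  assume fH: "f \<in># Rfactors H"
  have "set_mset (Rfactors F) \<union> set_mset (Rfactors G) \<union> set_mset (Rfactors H) \<subseteq> Rnat"
    using Rfactors_subset by blast
  then obtain N where N: "\<And>f. f \<in> set_mset (Rfactors F) \<union> set_mset (Rfactors G) \<union> set_mset (Rfactors H) \<Longrightarrow> is_level N f" "N > 0"
    using level_exists[of "set_mset (Rfactors F) \<union> set_mset (Rfactors G) \<union> set_mset (Rfactors H)" 0]
    by (metis finite_UnI finite_set_mset)
  have lf: "is_level N f" using N f by blast
  then have fR: "f \<in> Rnat" by (simp add: is_level_def)
  obtain z where z: "z \<in> rts N f" using lf rts_nonempty unfolding is_level_def by blast
  \<comment> \<open>any bound from below by the level of \<open>B\<close>, if there is one, keeps the small ball inside \<open>B\<close>\<close>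
  define l0 where "l0 = (case level B of Fin lam \<Rightarrow> \<lceil>lam * of_nat N\<rceil> | _ \<Rightarrow> 0)"
  have fin: "finite (rts N f')" if "f' \<in># Rfactors F" for f' using N(1)[of f'] that by (auto simp: is_level_def rts_ramified(2))
  have "finite (\<Union>f\<in>set_mset (Rfactors F). rts N f)" using fin by auto
  from isolating_level[OF this] obtain l where l: "l \<ge> l0" "\<And>w f'. f' \<in># Rfactors F \<Longrightarrow> w \<in> rts N f' \<Longrightarrow> near l w z \<Longrightarrow> w = z"
    by (metis (no_types, lifting) UN_I)
  define mu where "mu = (of_int l / of_nat N :: rat)"
  have mu: "of_int l = mu * of_nat N" using N(2) by (simp add: mu_def)
  define B1 where "B1 = ({f}, Fin mu :: rat extended)"
  have B1: "bud B1" "level B1 = Fin mu" "stem B1 = {f}" using fR noc_self[OF fR] by (auto simp: B1_def bud_def)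
  have fB1: "f \<in> stem B1" using B1(3) by simp
  have tau1: "f \<in> tau B1" using stem_subset_tau B1 by blast
  have lev: "level B \<le> level B1"
  proof (cases "level B")
    case (Fin lam)
    then have "lam * of_nat N \<le> of_int l" using l(1) by (simp add: l0_def ceiling_le_iff)
    then have "lam \<le> mu" using N(2) by (simp add: mu_def field_simps)
    then show ?thesis using Fin B1(2) by simp
  qed (use B in \<open>auto simp: bud_def improper_bud_def\<close>)
  have sub: "tau B1 \<subseteq> tau B"
    using sub_bud_tau[OF B B1(1) lev _ tau1] f(2) stem_subset_tau[OF B] by blast
  have sole: "f' = f" if f': "f' \<in># Rfactors F" "f' \<in> tau B1" for f'
  proof -
    have lf': "is_level N f'" using N(1) f'(1) by blast
    obtain w where "w \<in> rts N f'" "near l w z"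
      using tau_iff_near[OF B1(1,2) mu fB1 lf z lf'] f'(2) by blast
    then have "w = z" "w \<in> rts N f'" using l(2)[OF f'(1)] by blast+
    then have "z \<in> rts N f'" by simp
    then show ?thesis using rts_common_eq[of f f' N z] lf lf' z by (auto simp: is_level_def)
  qed
  have "stem B1 = {f'. f' \<in># Rfactors F \<and> f' \<in> tau B1}"
    unfolding B1(3) using sole f(1) tau1 by blast
  then have ad: "adapted F G B1"
    unfolding adapted_def using B1(1) strength_mono(1)[OF B B1(1) sub G0 OG] by blast
  have HB1: "H \<in> derived F G B1" using H derived_mono[OF B B1(1) sub OG] by simp
  have "of_nat (degree f) = D_bud B1 * of_nat (card {w \<in> rts N f. near l w z})"
    by (rule D_bud_count[OF B1(1,2) mu fB1 lf z lf tau1])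
  moreover have "{w \<in> rts N f. near l w z} = {z}" using l(2)[OF f(1)] z by auto
  ultimately have "D_pprime B1 = 0" using B1 by (simp add: D_pprime_def)
  then have "degree (Omega B1 H) = 0" using adapted_main(2)[OF ad HB1] by simp
  moreover have "degree (Omega B1 H) \<ge> degree f"
  proof -
    have "f \<in># {#f \<in># Rfactors H. f \<in> tau B1#}" using fH tau1 by simp
    then obtain M where "{#f \<in># Rfactors H. f \<in> tau B1#} = add_mset f M" by (meson multi_member_split)
    then show ?thesis unfolding degree_Omega(1)[OF adapted_main(1)[OF ad HB1]] by simp
  qed
  ultimately show False using Rnat_degree_pos[OF fR] by simp
qed

end

section \<open>Trees\<close>

lemma finite_contact_set: "finite (contact_set H)"
proof -
  have "contact_set H \<subseteq> (\<lambda>(f, i). char_c f i) ` (SIGMA f:set_mset (Rfactors H). {1..char_h f})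
      \<union> (\<lambda>(f, g). finval (noc f g)) ` (set_mset (Rfactors H) \<times> set_mset (Rfactors H))"
    unfolding contact_set_def by (force simp: finval_def image_iff)
  then show ?thesis by (rule finite_subset) auto
qed

context
  fixes F G :: "'a::{alg_closed_field, field_char_0} fls poly"
  assumes F: "degree F > 0" "no_multiple_factors F" and G0: "G \<noteq> 0"
begin

lemma F_nonzero: "F \<noteq> 0"
  using F(1) by auto

lemma F_simple: "f \<in># Rfactors F \<Longrightarrow> count (Rfactors F) f = 1"
  using no_multiple_factors_count[OF F(2)] .

lemma Rfactors_FG: "Rfactors (F * G) = Rfactors F + Rfactors G"
  using Rfactors_mult[OF F_nonzero G0] .

lemma root_stem_FG: "root_stem (F * G) = set_mset (Rfactors F) \<union> set_mset (Rfactors G)"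
proof -
  have "Rfactors F \<noteq> {#}" using degree_eq_sum_Rfactors[OF F_nonzero] F(1) by auto
  then show ?thesis by (simp add: root_stem_def Rfactors_FG)
qed

abbreviation "all_factors \<equiv> set_mset (Rfactors F) \<union> set_mset (Rfactors G)"

lemma all_factors_Rnat: "all_factors \<subseteq> Rnat"
  using Rfactors_subset by blast

lemma finite_tree: "finite (tree (F * G))"
proof -
  let ?E = "\<lambda>l. {(f, g). f \<in> root_stem (F * G) \<and> g \<in> root_stem (F * G) \<and> noc f g \<ge> Fin l}"
  have "finite (root_stem (F * G) // ?E l)" for l
    by (rule finite_quotient) (auto simp: root_stem_FG)
  then have "finite (\<Union>l\<in>contact_set (F * G). (\<lambda>\<sigma>. (\<sigma>, Fin l)) ` (root_stem (F * G) // ?E l))"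
    using finite_contact_set by blast
  moreover have "tree (F * G) \<subseteq> insert (root_stem (F * G), Minf) (\<Union>l\<in>contact_set (F * G). (\<lambda>\<sigma>. (\<sigma>, Fin l)) ` (root_stem (F * G) // ?E l))"
    unfolding tree_def by blast
  ultimately show ?thesis by (meson finite_insert finite_subset)
qed

lemma tree_class:
  assumes f: "f \<in> all_factors"
  shows "bud ({x \<in> all_factors. Fin c \<le> noc f x}, Fin c)"
    and "{x \<in> all_factors. Fin c \<le> noc f x} = all_factors \<inter> tau ({x \<in> all_factors. Fin c \<le> noc f x}, Fin c)"
    and "f \<in> {x \<in> all_factors. Fin c \<le> noc f x}"
proof -
  let ?C = "{x \<in> all_factors. Fin c \<le> noc f x}"
  have fR: "f \<in> Rnat" using f all_factors_Rnat by blast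
  show fC: "f \<in> ?C" using f noc_self[OF fR] by simp
  have CR: "?C \<subseteq> Rnat" using all_factors_Rnat by blast
  have "Fin c \<le> noc x y" if "x \<in> ?C" "y \<in> ?C" for x y
  proof -
    have "x \<in> Rnat" "y \<in> Rnat" "Fin c \<le> noc f x" "Fin c \<le> noc f y" using that CR by blast+
    then show ?thesis using noc_trans(1)[of x f y "Fin c"] noc_sym[of f x] fR by simp
  qed
  then show b: "bud (?C, Fin c)" using fC CR unfolding bud_def fst_conv snd_conv by blast
  have "f \<in> tau (?C, Fin c)" using stem_subset_tau[of "(?C, Fin c)"] b fC by auto
  note t = bud_tau[OF b snd_conv this]
  show "?C = all_factors \<inter> tau (?C, Fin c)" unfolding t using all_factors_Rnat noc_sym[OF fR] by auto
qed

lemma tree_cases: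
  assumes "B \<in> tree (F * G)"
  obtains "improper_bud B" "stem B = all_factors"
  | c where "level B = Fin c" "bud B" "stem B = all_factors \<inter> tau B" "c \<in> contact_set (F * G)"
proof (cases "level B = Minf")
  case True
  then have "B = (all_factors, Minf)" using assms by (auto simp: tree_def root_stem_FG)
  moreover have "all_factors \<noteq> {}" using degree_eq_sum_Rfactors[OF F_nonzero] F(1) by auto
  ultimately show ?thesis using that(1) all_factors_Rnat by (simp add: improper_bud_def)
next
  case False
  let ?E = "\<lambda>l. {(f, g). f \<in> all_factors \<and> g \<in> all_factors \<and> noc f g \<ge> Fin l}"
  obtain \<sigma> c where B: "B = (\<sigma>, Fin c)" "c \<in> contact_set (F * G)" "\<sigma> \<in> all_factors // ?E c"
    using assms False unfolding tree_def root_stem_FG by auto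
  obtain f where f: "f \<in> all_factors" "\<sigma> = ?E c `` {f}" using B(3) by (rule quotientE)
  have "\<sigma> = {x \<in> all_factors. Fin c \<le> noc f x}" unfolding f(2) using f(1) by blast
  then show ?thesis using that(2)[of c] tree_class[OF f(1), of c] B(1,2) by simp
qed

lemma tree_memI:
  assumes "f \<in> all_factors" "c \<in> contact_set (F * G)"
  shows "({x \<in> all_factors. Fin c \<le> noc f x}, Fin c) \<in> tree (F * G)"
proof -
  let ?E = "{(f, g). f \<in> all_factors \<and> g \<in> all_factors \<and> noc f g \<ge> Fin c}"
  have "{x \<in> all_factors. Fin c \<le> noc f x} = ?E `` {f}" using assms(1) by blast
  then have "{x \<in> all_factors. Fin c \<le> noc f x} \<in> all_factors // ?E" using assms(1) by (metis (no_types, lifting) quotientI)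
  then show ?thesis unfolding tree_def root_stem_FG using assms(2) by blast
qed

lemma stem_eq:
  assumes "B \<in> tree (F * G)"
  shows "stem B = all_factors \<inter> tau B" "bud B \<or> improper_bud B"
  using assms all_factors_Rnat by (auto elim!: tree_cases simp: improper_tau)

lemma stem_adapted:
  assumes "B \<in> tree (F * G)" "Omega B G = 1"
  shows "stem B = {f. f \<in># Rfactors F \<and> f \<in> tau B}"
  using stem_eq(1)[OF assms(1)] assms(2) unfolding Omega_eq_1_iff[OF G0] by blast

lemma tree_adapted:
  assumes "B \<in> tree (F * G)" "Omega B G = 1" "level B \<noteq> Minf"
  shows "adapted F G B"
  using stem_adapted[OF assms(1,2)] stem_eq(2)[OF assms(1)] assms(2,3)
  unfolding adapted_def improper_bud_def by blast

lemma contact_set_F: "contact_set F \<subseteq> contact_set (F * G)"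
  unfolding contact_set_def Rfactors_FG by auto

text \<open>
  Let \<open>\<mu>\<close> be the largest contact of \<open>f\<close> with an element
  \<open>g0\<close> of the stem. Then \<open>f\<close> belongs to \<open>tau_prime B2\<close> for
  the bud \<open>B2\<close> of level \<open>\<mu>\<close> around \<open>g0\<close>. So
  \<open>D_prime B2 \<noteq> 0\<close>, which means that \<open>F\<close> has two roots at
  distance exactly \<open>\<mu>\<close>. Hence \<open>\<mu>\<close> lies in the contact set, and
  \<open>B2\<close> in the tree.
\<close>
lemma tau_prime_exists:
  assumes B: "B \<in> tree (F * G)" "Omega B G = 1" and H: "H \<in> derived F G B"
    and f: "f \<in># Rfactors H" "f \<in> tau B"
  shows "\<exists>B'\<in>insert B (tree_pi (tree (F * G)) B). f \<in> tau_prime B'"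
proof (cases "f \<in> tau_prime B")
  case False
  note bB = stem_eq(2)[OF B(1)]
  have fR: "f \<in> Rnat" using f(1) Rfactors_subset by blast
  have fS: "f \<in> tau_star B" using False f(2) by (simp add: tau_prime_def)
  then obtain g where g: "g \<in> stem B" "level B < noc f g" by (auto simp: tau_star_def)
  have sF: "stem B \<subseteq> set_mset (Rfactors F)" using stem_adapted[OF B] by blast
  then have fin: "finite (stem B)" using finite_subset by blast
  define \<mu> where "\<mu> = Max (noc f ` stem B)"
  have le: "noc f x \<le> \<mu>" if "x \<in> stem B" for x unfolding \<mu>_def using fin that by simp
  have "\<mu> \<in> noc f ` stem B" unfolding \<mu>_def using fin g(1) by (intro Max_in) auto
  then obtain g0 where g0: "g0 \<in> stem B" "\<mu> = noc f g0" by blast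
  have g0S: "g0 \<in> all_factors" "g0 \<in> Rnat" "g0 \<in> tau B" using g0(1) stem_eq(1)[OF B(1)] all_factors_Rnat by blast+
  have "f \<noteq> g0" using derived_no_common_factor[OF F_nonzero F_simple G0 bB B(2) _ g0(1) H] sF g0(1) f(1) by blast
  then have "\<mu> \<noteq> Pinf" "\<mu> \<noteq> Minf" unfolding g0(2) using noc_cases(2,3)[OF fR g0S(2)] by auto
  then obtain m where m: "\<mu> = Fin m" by (cases \<mu>) auto
  have lev: "level B < Fin m" using g(2) le[OF g(1)] m by (metis less_le_trans)
  define B2 where "B2 = ({x \<in> all_factors. Fin m \<le> noc g0 x}, Fin m :: rat extended)"
  note tc = tree_class[OF g0S(1), of m, folded B2_def]
  have b2: "bud B2" "level B2 = Fin m" using tc(1) by (simp_all add: B2_def)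
  have g0B2: "g0 \<in> stem B2" using tc(3) by (simp add: B2_def)
  have t2: "g0 \<in> tau B2" using g0B2 stem_subset_tau[of B2] b2 by blast
  note tau2 = bud_tau[OF b2 t2]
  have sub: "tau B2 \<subseteq> tau B"
    using sub_bud_tau[OF bB b2(1) _ g0S(3) t2] lev b2(2) by simp
  have st2: "stem B2 = all_factors \<inter> tau B2" using tc(2) by (simp add: B2_def)
  have O2: "Omega B2 G = 1" using strength_mono(1)[OF bB b2(1) sub G0 B(2)] .
  have ad: "adapted F G B2"
    unfolding adapted_def using b2(1) O2 st2 unfolding Omega_eq_1_iff[OF G0] by blast
  have H2: "H \<in> derived F G B2" using derived_mono[OF F_nonzero F_simple G0 bB b2(1) sub B(2)] H by simp
  have "f \<in> tau B2" unfolding tau2 using fR g0(2) m by simp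
  moreover have "f \<notin> tau_star B2"
  proof
    assume "f \<in> tau_star B2"
    then obtain x where x: "x \<in> stem B2" "Fin m < noc f x" using b2(2) by (auto simp: tau_star_def)
    then have "x \<in> stem B" using st2 sub stem_eq(1)[OF B(1)] by blast
    then show False using le[of x] x(2) m by auto
  qed
  ultimately have f2: "f \<in> tau_prime B2" by (simp add: tau_prime_def)
  have "D_prime B2 \<noteq> 0"
  proof
    assume "D_prime B2 = 0"
    then have "degree (Omega_prime B2 H) = 0" using adapted_main(3)[OF F_nonzero F_simple G0 ad H2] by simp
    moreover have "f \<in># {#f \<in># Rfactors H. f \<in> tau_prime B2#}" using f(1) f2 by simp
    then obtain M where "{#f \<in># Rfactors H. f \<in> tau_prime B2#} = add_mset f M" by (meson multi_member_split)
    then have "degree (Omega_prime B2 H) \<ge> degree f"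
      using degree_Omega(2)[OF adapted_main(1)[OF F_nonzero F_simple G0 ad H2], of B2] by simp
    ultimately show False using Rnat_degree_pos[OF fR] by simp
  qed
  then have "m \<in> contact_set (F * G)"
    using adapted_main(4)[OF F_nonzero F_simple G0 ad H2 _ b2(2)] contact_set_F by blast
  then have "B2 \<in> tree (F * G)" unfolding B2_def by (rule tree_memI[OF g0S(1)])
  then have "B2 \<in> tree_pi (tree (F * G)) B" using lev b2(2) sub by (simp add: tree_pi_def)
  then show ?thesis using f2 by blast
qed blast

text \<open>
  If \<open>B1\<close> has the smaller level, then the contact of \<open>f\<close> with the stem
  of \<open>B2\<close>, which is part of the stem of \<open>B1\<close>, puts \<open>f\<close> into
  \<open>tau_star B1\<close>.
\<close>
lemma tau_prime_unique:
  assumes B: "B1 \<in> tree (F * G)" "B2 \<in> tree (F * G)" and f: "f \<in> tau_prime B1" "f \<in> tau_prime B2"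
  shows "B1 = B2"
proof -
  have less: "\<not> level B1 < level B2" if B: "B1 \<in> tree (F * G)" "B2 \<in> tree (F * G)" and f: "f \<in> tau_prime B1" "f \<in> tau_prime B2" for B1 B2
  proof
    assume l: "level B1 < level B2"
    have f1: "f \<in> tau B1" "f \<notin> tau_star B1" and f2: "f \<in> tau B2" using f by (auto simp: tau_prime_def)
    have b2: "bud B2" using stem_eq(2)[OF B(2)] l by (auto simp: improper_bud_def)
    then obtain g where g: "g \<in> stem B2" by (auto simp: bud_def)
    have "level B2 \<le> noc f g" using f2 g by (simp add: tau_def)
    then have fg: "level B1 < noc f g" using l by (rule less_le_trans[rotated])
    have "tau B2 \<subseteq> tau B1"
      by (rule sub_bud_tau[OF stem_eq(2)[OF B(1)] b2 less_imp_le[OF l] f1(1) f2])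
    then have "g \<in> stem B1" using g stem_eq(1)[OF B(1)] stem_eq(1)[OF B(2)] by blast
    then show False using fg f1 by (auto simp: tau_star_def)
  qed
  then have l: "level B1 = level B2" using B f by (meson linorder_neqE)
  have ft: "f \<in> tau B1" "f \<in> tau B2" using f by (auto simp: tau_prime_def)
  have "stem B1 = stem B2"
  proof (cases "level B1 = Minf")
    case True
    then have "improper_bud B1" "improper_bud B2" using stem_eq(2)[OF B(1)] stem_eq(2)[OF B(2)] l by (auto simp: bud_def)
    then show ?thesis using stem_eq(1)[OF B(1)] stem_eq(1)[OF B(2)] by (simp add: improper_tau)
  next
    case False
    then have b: "bud B1" "bud B2" using stem_eq(2)[OF B(1)] stem_eq(2)[OF B(2)] l by (auto simp: improper_bud_def)
    then obtain c where c: "level B1 = Fin c" "level B2 = Fin c" using l by (auto simp: bud_def)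
    show ?thesis unfolding stem_eq(1)[OF B(1)] stem_eq(1)[OF B(2)]
      bud_tau[OF b(1) c(1) ft(1)] bud_tau[OF b(2) c(2) ft(2)] ..
  qed
  then show ?thesis using l by (simp add: prod_eq_iff)
qed

lemma Omega_factorization:
  assumes B: "B \<in> tree (F * G)" "Omega B G = 1" and H: "H \<in> derived F G B"
  shows "Omega B H = Omega_prime B H * (\<Prod>B'\<in>tree_pi (tree (F * G)) B. Omega_prime B' H)"
proof -
  let ?P = "tree_pi (tree (F * G)) B"
  have fin: "finite ?P" using finite_tree by (simp add: tree_pi_def)
  have "Omega B H = (\<Prod>B'\<in>insert B ?P. Omega_prime B' H)"
    unfolding Omega_def Omega_prime_def
  proof (rule mset_prod_partition)
    show "finite (insert B ?P)" using fin by simp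
    fix f assume f: "f \<in># Rfactors H"
    have T: "insert B ?P \<subseteq> tree (F * G)" using B(1) by (auto simp: tree_pi_def)
    show "\<exists>!B'. B' \<in> insert B ?P \<and> f \<in> tau_prime B'" if "f \<in> tau B"
    proof -
      obtain B1 where "B1 \<in> insert B ?P" "f \<in> tau_prime B1" using tau_prime_exists[OF B H f \<open>f \<in> tau B\<close>] by blast
      then show ?thesis using tau_prime_unique[of B1] T by blast
    qed
    show "f \<in> tau B" if "B' \<in> insert B ?P" "f \<in> tau_prime B'" for B'
      using that by (auto simp: tree_pi_def tau_prime_def)
  qed
  also have "\<dots> = Omega_prime B H * (\<Prod>B'\<in>?P. Omega_prime B' H)"
    using fin by (intro prod.insert) (auto simp: tree_pi_def)
  finally show ?thesis .
qed

text \<open>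
  At the root of the tree, \<open>G\<close> is a series in \<open>X\<close> alone, so the three
  polynomials are multiples of \<open>F\<^sub>Y\<close> by such series. Nonzero strength means
  \<open>ord G \<noteq> 0\<close> and implies \<open>G\<^sub>X \<noteq> 0\<close>.
\<close>
lemma derived_degrees:
  assumes B: "B \<in> tree (F * G)" "Omega B G = 1" and H: "H \<in> derived F G B"
  shows "of_nat (degree (Omega B H)) = D_pprime B" "of_nat (degree (Omega_prime B H)) = D_prime B"
proof -
  have "of_nat (degree (Omega B H)) = D_pprime B \<and> of_nat (degree (Omega_prime B H)) = D_prime B"
  proof (cases "level B = Minf")
    case False
    then show ?thesis using adapted_main(2,3)[OF F_nonzero F_simple G0 tree_adapted[OF B False] H] by simp
  next
    case True
    then have im: "improper_bud B" using stem_eq(2)[OF B(1)] by (auto simp: bud_def)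
    have tB: "tau B = Rnat" by (rule improper_tau[OF im])
    have ts: "tau_star B' = Rnat" if i: "improper_bud B'" for B' :: "'a gbud"
    proof -
      obtain g where g: "g \<in> stem B'" "g \<in> Rnat" using i by (auto simp: improper_bud_def)
      have "Minf < noc f g" if "f \<in> Rnat" for f
        using noc_cases(3)[OF that g(2)] by (cases "noc f g") auto
      then show ?thesis using i g(1) improper_tau[OF i] by (auto simp: tau_star_def improper_bud_def)
    qed
    have "\<forall>f\<in>#Rfactors G. f \<notin> Rnat" using B(2) unfolding Omega_eq_1_iff[OF G0] tB .
    then have "Rfactors G = {#}" using Rfactors_subset by (metis multiset_nonemptyE subsetD)
    then have G: "G = [:lead_coeff G:]" using Rfactors(2)[OF G0] by simp
    define c where "c = lead_coeff G"
    have Gc: "G = [:c:]" "c \<noteq> 0" using G G0 c_def by auto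
    have str: "strength G B = ordX_fls c"
      using True \<open>Rfactors G = {#}\<close> c_def by (simp add: strength_def)
    have dF: "degree (DY F) = degree F - 1" by (rule degree_pderiv)
    have "\<exists>b. b \<noteq> 0 \<and> H = smult b (DY F)"
    proof -
      consider "H = DY F" | "H = DY (F * G)" | "H = jac F G" "strength G B \<noteq> 0"
        using H by (auto simp: derived_def split: if_splits)
      then show ?thesis
      proof cases
        case 1
        then show ?thesis by (intro exI[of _ 1]) simp
      next
        case 2
        then show ?thesis using Gc by (intro exI[of _ c]) (simp add: pderiv_smult)
      next
        case 3
        have "fls_subdegree c \<noteq> 0" using 3(2) Gc(2) unfolding str by (auto simp: ordX_fls_def zero_extended_def)
        then have "fls_deriv c $$ (fls_subdegree c - 1) \<noteq> 0" using Gc(2) by simp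
        then have "fls_deriv c \<noteq> 0" by (metis fls_zero_nth)
        moreover have "H = smult (- fls_deriv c) (DY F)"
        proof -
          have "DX G = [:fls_deriv c:]" unfolding Gc(1) DX_def by (simp add: map_poly_pCons)
          then show ?thesis unfolding 3(1) jac_def by (simp add: Gc(1))
        qed
        ultimately show ?thesis by (intro exI[of _ "- fls_deriv c"]) simp
      qed
    qed
    then obtain b where b: "b \<noteq> 0" "H = smult b (DY F)" by blast
    have H0: "H \<noteq> 0" using b F(1) by (simp add: pderiv_eq_0_iff)
    have dH: "degree H = degree F - 1" using b dF by simp
    have "{#f \<in># Rfactors H. f \<in> Rnat#} = Rfactors H"
      using Rfactors_subset[of H] by (simp add: filter_mset_eq_conv subset_iff)
    then have "degree (Omega B H) = degree F - 1"
      unfolding degree_Omega(1)[OF H0] tB using degree_eq_sum_Rfactors[OF H0] dH by simp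
    moreover have "D_pprime B = of_nat (degree F) - 1"
    proof -
      have sB: "stem B = set_mset (Rfactors F)" using stem_adapted[OF B] tB Rfactors_subset by auto
      have "Rfactors F = mset_set (stem B)" unfolding sB using F_simple by (intro multiset_eqI) (auto simp: count_mset_set' not_in_iff)
      then have "degree F = (\<Sum>f\<in>stem B. degree f)" using degree_eq_sum_Rfactors[OF F_nonzero] by (simp only: sum_unfold_sum_mset)
      then show ?thesis using True by (simp add: D_pprime_def)
    qed
    moreover have "D_prime B = 0"
    proof -
      have "R_star B = {B}"
      proof (intro equalityI subsetI)
        fix B' assume "B' \<in> R_star B"
        then have B': "strict_bud B' \<or> improper_bud B'" "level B' = Minf" "stem B' = tau_star B' \<inter> stem B"
          using True by (auto simp: R_star_def)
        then have ib: "improper_bud B'" by (auto simp: strict_bud_def bud_def)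
        have "stem B \<subseteq> Rnat" using im unfolding improper_bud_def by blast
        then have "stem B' = stem B" unfolding B'(3) ts[OF ib] by blast
        then show "B' \<in> {B}" using B'(2) True by (simp add: prod_eq_iff)
      next
        fix B' assume "B' \<in> {B}"
        then show "B' \<in> R_star B" using im ts[OF im] by (auto simp: R_star_def improper_bud_def)
      qed
      then show ?thesis using True by (simp add: D_prime_def)
    qed
    moreover have "degree (Omega_prime B H) = 0"
      unfolding degree_Omega(2)[OF H0] tau_prime_def tB ts[OF im] by simp
    ultimately show ?thesis using F(1) by (simp add: of_nat_diff)
  qed
  then show "of_nat (degree (Omega B H)) = D_pprime B" "of_nat (degree (Omega_prime B H)) = D_prime B" by auto
qed

lemma tree_pi_mono:
  assumes B: "B \<in> tree (F * G)" "Omega B G = 1" and B': "B' \<in> tree_pi (tree (F * G)) B"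
  shows "B' \<in> tree (F * G)" "Omega B' G = 1" "strength G B' = strength G B" "derived F G B' = derived F G B"
proof -
  show T: "B' \<in> tree (F * G)" using B' by (simp add: tree_pi_def)
  have sub: "tau B' \<subseteq> tau B" and l: "level B < level B'" using B' by (auto simp: tree_pi_def)
  have b: "bud B'" using stem_eq(2)[OF T] l by (auto simp: improper_bud_def)
  note bB = stem_eq(2)[OF B(1)]
  show "Omega B' G = 1" "strength G B' = strength G B" using strength_mono[OF bB b sub G0 B(2)] by blast+
  show "derived F G B' = derived F G B" using derived_mono[OF F_nonzero F_simple G0 bB b sub B(2)] .
qed

end

theorem mainTheorem2:
  fixes F G :: "'a::{alg_closed_field, field_char_0} fls poly"
    and T :: "'a gbud set"
  assumes "degree F > 0"
    and "no_multiple_factors F"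
    and "G \<noteq> 0"
    and "T = tree (F * G)"
  shows "(\<forall>B\<in>T. Omega B G = 1 \<and> strength G B \<noteq> 0 \<longrightarrow>
      (of_nat (degree (Omega B (jac F G))) = D_pprime B \<and>
       of_nat (degree (Omega B (DY (F * G)))) = D_pprime B \<and>
       of_nat (degree (Omega B (DY F))) = D_pprime B) \<and>
      (of_nat (degree (Omega_prime B (jac F G))) = D_prime B \<and>
       of_nat (degree (Omega_prime B (DY (F * G)))) = D_prime B \<and>
       of_nat (degree (Omega_prime B (DY F))) = D_prime B) \<and>
      Omega B (jac F G) =
        Omega_prime B (jac F G) * (\<Prod>B'\<in>tree_pi T B. Omega_prime B' (jac F G)) \<and>
      (\<forall>B'\<in>tree_pi T B.
        Omega B' G = 1 \<and> strength G B' \<noteq> 0 \<and>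
        (of_nat (degree (Omega B' (jac F G))) = D_pprime B' \<and>
         of_nat (degree (Omega B' (DY (F * G)))) = D_pprime B' \<and>
         of_nat (degree (Omega B' (DY F))) = D_pprime B') \<and>
        (of_nat (degree (Omega_prime B' (jac F G))) = D_prime B' \<and>
         of_nat (degree (Omega_prime B' (DY (F * G)))) = D_prime B' \<and>
         of_nat (degree (Omega_prime B' (DY F))) = D_prime B'))) \<and>
    (\<forall>B\<in>T. Omega B G = 1 \<longrightarrow>
      (of_nat (degree (Omega B (DY (F * G)))) = D_pprime B \<and>
       of_nat (degree (Omega B (DY F))) = D_pprime B) \<and>
      (of_nat (degree (Omega_prime B (DY (F * G)))) = D_prime B \<and>
       of_nat (degree (Omega_prime B (DY F))) = D_prime B) \<and>
      Omega B (DY (F * G)) =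
        Omega_prime B (DY (F * G)) * (\<Prod>B'\<in>tree_pi T B. Omega_prime B' (DY (F * G))) \<and>
      (\<forall>B'\<in>tree_pi T B.
        Omega B' G = 1 \<and>
        (of_nat (degree (Omega B' (DY (F * G)))) = D_pprime B' \<and>
         of_nat (degree (Omega B' (DY F))) = D_pprime B') \<and>
        (of_nat (degree (Omega_prime B' (DY (F * G)))) = D_prime B' \<and>
         of_nat (degree (Omega_prime B' (DY F))) = D_prime B')))"
proof -
  note hyps = assms(1-3)
  let ?deg = "\<lambda>B H. of_nat (degree (Omega B H)) = D_pprime B \<and> of_nat (degree (Omega_prime B H)) = D_prime B"
  have deg: "?deg B H" if "B \<in> T" "Omega B G = 1" "H \<in> derived F G B" for B H
    using derived_degrees[OF hyps] that unfolding assms(4) by blast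
  have pi: "Omega B' G = 1" "strength G B' = strength G B" "H \<in> derived F G B \<Longrightarrow> ?deg B' H"
    if B: "B \<in> T" "Omega B G = 1" and B': "B' \<in> tree_pi T B" for B B' H
  proof -
    note pm = tree_pi_mono[OF hyps B[unfolded assms(4)] B'[unfolded assms(4)]]
    show "Omega B' G = 1" "strength G B' = strength G B" by (rule pm(2), rule pm(3))
    show "?deg B' H" if "H \<in> derived F G B"
      using deg[of B' H] pm(1,2,4) that unfolding assms(4) by blast
  qed
  have fac: "Omega B H = Omega_prime B H * (\<Prod>B'\<in>tree_pi T B. Omega_prime B' H)"
    if "B \<in> T" "Omega B G = 1" "H \<in> derived F G B" for B H
    using Omega_factorization[OF hyps] that unfolding assms(4) by blast
  have Y: "DY F \<in> derived F G B" "DY (F * G) \<in> derived F G B" for B by (auto simp: derived_def)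
  have J: "jac F G \<in> derived F G B" if "strength G B \<noteq> 0" for B using that by (auto simp: derived_def)
  show ?thesis
  proof (rule conjI, goal_cases)
    case 1
    show ?case
    proof (rule ballI, rule impI, goal_cases)
    case (1 B)
    then have B: "B \<in> T" "Omega B G = 1" and s: "strength G B \<noteq> 0" by blast+
    have "strength G B' \<noteq> 0" if "B' \<in> tree_pi T B" for B' using pi(2)[OF B that] s by simp
    then show ?case
      using deg[OF B J[OF s]] deg[OF B Y(1)] deg[OF B Y(2)] fac[OF B J[OF s]] pi(1)[OF B]
        pi(3)[OF B _ J[OF s]] pi(3)[OF B _ Y(1)] pi(3)[OF B _ Y(2)] by blast
    qed
  next
    case 2
    show ?case
    proof (rule ballI, rule impI, goal_cases)
    case (1 B)
    then have B: "B \<in> T" "Omega B G = 1" by blast+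
    show ?case
      using deg[OF B Y(1)] deg[OF B Y(2)] fac[OF B Y(2)] pi(1)[OF B]
        pi(3)[OF B _ Y(1)] pi(3)[OF B _ Y(2)] by blast
    qed
  qed
qed

end
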